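(* Let $$P(x)=\left(x^2+\frac{2\sqrt{273}}{3}+13\right)^5\left(x^3-\frac{13x^2}{3}-x\left(\frac{2\sqrt{273}}{11}-\frac{39}{11}\right)+\frac{91}{15}+\frac{26\sqrt{273}}{45}\right),$$ $$Q(x)=x\left(x-\frac{896}{120285}\left(-21+\sqrt{273}\right)^5\left(-111+7\sqrt{273}\right)\right).$$ Then the composition $Q(P(x))$ is a Shabat polynomial of the first of the two trees with passport $[5^3,1^{11};2^{13};26]$, and a Shabat polynomial of the second tree is obtained by $\sqrt{273}\mapsto-\sqrt{273}$.
   Context: A Shabat polynomial is a complex polynomial with at most two finite critical values $c_1,c_2$. The tree of a Shabat polynomial $F$ is the bicolored plane tree $F^{-1}([c_1,c_2])$, with black vertices the points of $F^{-1}(c_1)$, white vertices the points of $F^{-1}(c_2)$, edges the connected components of the preimage of the open segment $(c_1,c_2)$, and vertex degree equal to the multiplicity of the corresponding root of $F-c_1$ or $F-c_2$. The passport $[\alpha;\beta;n]$ of a tree with $n$ edges records the partition $\alpha\vdash n$ of black vertex degrees and the partition $\beta\vdash n$ of white vertex degrees ($k^m$ means $k$ repeated $m$ times). There are exactly two trees with passport $[5^3,1^{11};2^{13};26]$. In the claim, $c_1=0$ for $F=Q\circ P$.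
   Formalization: The printed constant in Q has a sign slip: it is the conjugate of P(1), so Q(P(x)) would have three critical values. The formal statement uses (-21-√273)^5(-111-7√273) in Q, with P unchanged. *)

theory Defs
  imports "HOL-Analysis.Analysis" "HOL-Computational_Algebra.Polynomial" "HOL-Library.Multiset"
begin

section \<open>Bicolored plane trees\<close>

text \<open>A bicolored plane graph is recorded combinatorially.  The relation \<open>ccw T v e f g\<close> describes
  the cyclic order of the edges around \<open>v\<close>: turning counterclockwise around \<open>v\<close> from the edge
  \<open>e\<close>, one meets the edge \<open>f\<close> strictly before the edge \<open>g\<close>.\<close>

record ('v, 'e) bicolored_map =
  black :: "'v set"
  white :: "'v set"
  edges :: "'e set"
  incident :: "'v \<Rightarrow> 'e \<Rightarrow> bool"
  ccw :: "'v \<Rightarrow> 'e \<Rightarrow> 'e \<Rightarrow> 'e \<Rightarrow> bool"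

definition vertices :: "('v, 'e) bicolored_map \<Rightarrow> 'v set" where
  "vertices T = black T \<union> white T"

definition edges_at :: "('v, 'e) bicolored_map \<Rightarrow> 'v \<Rightarrow> 'e set" where
  "edges_at T v = {e \<in> edges T. incident T v e}"

definition vertex_degree :: "('v, 'e) bicolored_map \<Rightarrow> 'v \<Rightarrow> nat" where
  "vertex_degree T v = card (edges_at T v)"

definition adjacency :: "('v, 'e) bicolored_map \<Rightarrow> ('v \<times> 'v) set" where
  "adjacency T = {(x, y). x \<in> vertices T \<and> y \<in> vertices T \<and>
                          (\<exists>e \<in> edges T. incident T x e \<and> incident T y e)}"

definition cyclic_order_on :: "'e set \<Rightarrow> ('e \<Rightarrow> 'e \<Rightarrow> 'e \<Rightarrow> bool) \<Rightarrow> bool" where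
  "cyclic_order_on A R \<longleftrightarrow>
     (\<forall>a\<in>A. \<forall>b\<in>A. \<forall>c\<in>A. R a b c \<longrightarrow> R b c a) \<and>
     (\<forall>a\<in>A. \<forall>b\<in>A. \<forall>c\<in>A. R a b c \<longrightarrow> \<not> R c b a) \<and>
     (\<forall>a\<in>A. \<forall>b\<in>A. \<forall>c\<in>A. \<forall>d\<in>A. R a b c \<longrightarrow> R a c d \<longrightarrow> R a b d) \<and>
     (\<forall>a\<in>A. \<forall>b\<in>A. \<forall>c\<in>A. a \<noteq> b \<longrightarrow> b \<noteq> c \<longrightarrow> a \<noteq> c \<longrightarrow> R a b c \<or> R c b a)"

text \<open>Being a tree is expressed as being connected with one more vertex than edges.  (The predicate
  \<open>tree\<close> from the AFP graph library is about directed cycles; it would be satisfied by every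
  connected graph whose edges are all oriented from black to white.)\<close>

definition bicolored_plane_tree :: "('v, 'e) bicolored_map \<Rightarrow> bool" where
  "bicolored_plane_tree T \<longleftrightarrow>
     finite (black T) \<and> finite (white T) \<and> finite (edges T) \<and>
     black T \<inter> white T = {} \<and>
     (\<forall>e \<in> edges T. (\<exists>!b. b \<in> black T \<and> incident T b e) \<and> (\<exists>!w. w \<in> white T \<and> incident T w e)) \<and>
     (\<forall>x \<in> vertices T. \<forall>y \<in> vertices T. (x, y) \<in> (adjacency T)\<^sup>*) \<and>
     card (vertices T) = card (edges T) + 1 \<and>
     (\<forall>v \<in> vertices T. cyclic_order_on (edges_at T v) (ccw T v))"

text \<open>Isomorphisms of bicolored plane trees preserve colors, incidence and the counterclockwise
  cyclic order of the edges around each vertex.\<close>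

definition plane_isomorphic ::
    "('v, 'e) bicolored_map \<Rightarrow> ('w, 'f) bicolored_map \<Rightarrow> bool" where
  "plane_isomorphic T U \<longleftrightarrow>
     (\<exists>f g. bij_betw f (black T) (black U) \<and> bij_betw f (white T) (white U) \<and>
            bij_betw g (edges T) (edges U) \<and>
            (\<forall>v \<in> vertices T. \<forall>e \<in> edges T. incident U (f v) (g e) \<longleftrightarrow> incident T v e) \<and>
            (\<forall>v \<in> vertices T. \<forall>e1 \<in> edges_at T v. \<forall>e2 \<in> edges_at T v. \<forall>e3 \<in> edges_at T v.
               ccw U (f v) (g e1) (g e2) (g e3) \<longleftrightarrow> ccw T v e1 e2 e3))"

definition passport :: "('v, 'e) bicolored_map \<Rightarrow> nat multiset \<times> nat multiset \<times> nat" where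
  "passport T = (image_mset (vertex_degree T) (mset_set (black T)),
                 image_mset (vertex_degree T) (mset_set (white T)),
                 card (edges T))"


section \<open>Shabat polynomials and their trees\<close>

definition critical_values :: "complex poly \<Rightarrow> complex set" where
  "critical_values F = poly F ` {z. poly (pderiv F) z = 0}"

definition shabat_polynomial :: "complex poly \<Rightarrow> complex \<Rightarrow> complex \<Rightarrow> bool" where
  "shabat_polynomial F c1 c2 \<longleftrightarrow> degree F > 0 \<and> c1 \<noteq> c2 \<and> critical_values F \<subseteq> {c1, c2}"

text \<open>The edge \<open>e\<close> leaves the point \<open>v\<close> in the direction of the unit vector \<open>u\<close>
  (meaningful only if \<open>v\<close> is in the closure of \<open>e\<close>).\<close>

definition edge_direction :: "complex \<Rightarrow> complex set \<Rightarrow> complex \<Rightarrow> bool" where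
  "edge_direction v e u \<longleftrightarrow> ((\<lambda>z. sgn (z - v)) \<longlongrightarrow> u) (at v within e)"

text \<open>The plane tree \<open>F -` closed_segment c1 c2\<close>.  Distinct edges at a vertex leave it in distinct
  directions, so their cyclic order is that of the arguments of these directions.\<close>

definition shabat_tree ::
    "complex poly \<Rightarrow> complex \<Rightarrow> complex \<Rightarrow> (complex, complex set) bicolored_map" where
  "shabat_tree F c1 c2 =
     \<lparr> black = {z. poly F z = c1},
       white = {z. poly F z = c2},
       edges = components (poly F -` open_segment c1 c2),
       incident = (\<lambda>v e. v \<in> closure e),
       ccw = (\<lambda>v e1 e2 e3. \<exists>u1 u2 u3.
                edge_direction v e1 u1 \<and> edge_direction v e2 u2 \<and> edge_direction v e3 u3 \<and>
                0 < Arg2pi (u2 / u1) \<and> Arg2pi (u2 / u1) < Arg2pi (u3 / u1)) \<rparr>"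

text \<open>The last two clauses say that vertex degrees are root multiplicities.  They hold for every
  Shabat polynomial, but are recorded since the degrees are often introduced in this way, whereas
  \<open>vertex_degree\<close> counts the incident edges.\<close>

definition shabat_polynomial_of ::
    "complex poly \<Rightarrow> complex \<Rightarrow> complex \<Rightarrow> ('v, 'e) bicolored_map \<Rightarrow> bool" where
  "shabat_polynomial_of F c1 c2 T \<longleftrightarrow>
     shabat_polynomial F c1 c2 \<and> plane_isomorphic (shabat_tree F c1 c2) T \<and>
     (\<forall>z. poly F z = c1 \<longrightarrow> vertex_degree (shabat_tree F c1 c2) z = order z (F - [:c1:])) \<and>
     (\<forall>z. poly F z = c2 \<longrightarrow> vertex_degree (shabat_tree F c1 c2) z = order z (F - [:c2:]))"


section \<open>The polynomials\<close>

text \<open>The argument \<open>s\<close> stands for one of the two square roots of 273.\<close>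

definition P_poly :: "complex \<Rightarrow> complex poly" where
  "P_poly s = [: 2 * s / 3 + 13, 0, 1 :] ^ 5 *
              [: 91/15 + 26 * s / 45, - (2 * s / 11 - 39/11), - (13/3), 1 :]"

text \<open>For \<open>s\<^sup>2 = 273\<close> the derivative of \<open>P_poly s\<close> is \<open>13 (x\<^sup>2 + 2 s / 3 + 13)\<^sup>4 (x - 1)\<^sup>4\<close>,
  so \<open>P_poly s\<close> has the critical values 0 and \<open>P_poly s (1)\<close>, and the roots of \<open>Q_poly s\<close> must be
  these two numbers.  In the literature the constant is printed as
  \<open>896/120285 * (-21 + s)^5 * (-111 + 7 * s)\<close>, which is the value at 1 of \<open>P_poly (-s)\<close> instead;
  with that sign the composition would have three distinct finite critical values.\<close>

definition Q_poly :: "complex \<Rightarrow> complex poly" where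
  "Q_poly s = [: 0, 1 :] * [: - (896/120285 * (-21 - s) ^ 5 * (-111 - 7 * s)), 1 :]"

lemma poly_P_poly_1: "poly (P_poly s) 1 = 896/120285 * (-21 - s) ^ 5 * (-111 - 7 * s)"
proof -
  define u where "u = (21 + s) ^ 5"
  have 1: "poly [: 2 * s / 3 + 13, 0, 1 :] 1 = 2/3 * (21 + s)"
    and 2: "poly [: 91/15 + 26 * s / 45, - (2 * s / 11 - 39/11), - (13/3), 1 :] 1 =
            28/495 * (111 + 7 * s)"
    by (simp_all add: field_simps)
  have "(-21 - s) ^ 5 = (- (21 + s)) ^ 5"
    by simp
  also have "\<dots> = - u"
    unfolding u_def by (rule power_minus_odd) simp
  finally have 3: "(-21 - s) ^ 5 = - u" .
  have "poly (P_poly s) 1 = (2/3) ^ 5 * u * (28/495 * (111 + 7 * s))"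
    unfolding P_poly_def poly_mult poly_power 1 2 power_mult_distrib u_def ..
  also have "\<dots> = 896/120285 * (-21 - s) ^ 5 * (-111 - 7 * s)"
    unfolding 3 by (simp add: power_divide field_simps)
  finally show ?thesis .
qed

end

theory Submission
  imports Defs "HOL-Complex_Analysis.Complex_Analysis"
    "HOL-Computational_Algebra.Fundamental_Theorem_Algebra"
begin

text \<open>The derivative of \<open>P\<close> is \<open>13 (z\<^sup>2 + a)\<^sup>4 (z - 1)\<^sup>4\<close>, so \<open>P\<close> has the critical values
  0, attained at \<open>A\<close> and \<open>-A\<close> with \<open>A\<^sup>2 = -a\<close>, and \<open>c\<close>, attained at 1.  Since \<open>Q\<close> folds the
  segment from 0 to \<open>c\<close> at its midpoint, the tree of \<open>Q \<circ> P\<close> is the preimage of this segment under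
  \<open>P\<close> with every edge subdivided.  Over an open segment without critical values a polynomial is a
  covering, whose components are the edges; an \<open>m\<close>-th root of the polynomial is a chart near a
  vertex of order \<open>m\<close>, and shows that \<open>m\<close> edges leave it in \<open>m\<close> distinct directions.

  In a tree with the given passport, the three vertices of degree 5 lie on a path with a middle
  vertex \<open>B\<close>, and the number of edges at \<open>B\<close> strictly between the two edges of this path determines
  the tree; the two sides of the path carry three such edges in all, so there are two trees.

  For \<open>Q \<circ> P\<close> the middle vertex is 1, and the edges at 1 are in known directions.  The preimage of
  the segment avoids a certain ray issuing from 1, which together with the symmetry under complex
  conjugation leaves only one direction for an edge between 1 and \<open>A\<close>.  Hence there is at most one
  such edge, and counting edges gives connectedness.\<close>

section \<open>Edges over a segment without critical values\<close>

text \<open>The obstacle is that multiplicities give only local data: they show that five equally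
  spaced edges leave 1, but not which of them leads to \<open>A\<close>, and exactly this
  distinguishes the two trees. Instead of following an edge from 1, the proof confines any edge that
  ends at \<open>A\<close> to a sector at 1 that contains a single admissible direction. The count
  then leaves no slack. \<open>P\<close> has 13 edges, five at each of 1, \<open>A\<close> and
  \<open>-A\<close>. With at most one edge from 1 to \<open>A\<close>, hence by conjugation at most
  one from 1 to \<open>-A\<close>, these are at least 5 + 4 + 4 = 13 edges; so both connecting edges
  exist and every edge touches one of the three vertices. Both signs of the square root run through
  the same argument. They differ in the ray, in the estimates for it, and in the admissible
  direction, which has argument 3 pi / 5 or 4 pi / 5. The angle from this direction to its conjugate
  is two fifths or one fifth of a turn, so one edge or none lies in between.\<close>

lemma root_chart:
  fixes q :: "complex poly" and v :: complex
  assumes m: "m > 0" and qv: "poly q v \<noteq> 0" and r: "r > 0"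
  obtains N \<rho> h \<psi> where "open N" "v \<in> N" "N \<subseteq> ball v r" "0 < \<rho>"
    "homeomorphism N (ball 0 \<rho>) (\<lambda>z. (z - v) * h z) \<psi>" "isCont h v" "h v \<noteq> 0"
    "\<And>z. z \<in> N \<Longrightarrow> h z ^ m = poly q z"
proof -
  obtain w0 where w0: "w0 ^ m = poly q v"
    using card_nth_roots[OF qv m] m by (metis (mono_tags, lifting) card.empty empty_Collect_eq less_not_refl)
  have "isCont (\<lambda>z. poly q z / poly q v) v"
    using qv by (intro continuous_intros)
  then obtain d0 where d0: "d0 > 0"
    and d0': "\<And>z. dist v z < d0 \<Longrightarrow> norm (poly q z / poly q v - 1) < 1"
    using qv unfolding continuous_at_eps_delta
    by (metis dist_commute dist_norm divide_self zero_less_one)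
  define d where "d = min d0 r"
  have d: "d > 0" "d \<le> d0" "d \<le> r" using d0 r by (auto simp: d_def)
  \<comment> \<open>Dividing by \<open>poly q v\<close> keeps the argument of \<open>Ln\<close> near
    1, away from the branch cut; \<open>w0\<close> restores the constant that was divided
    out.\<close>
  define h where "h = (\<lambda>z. w0 * exp (Ln (poly q z / poly q v) / of_nat m))"
  define \<phi> where "\<phi> = (\<lambda>z. (z - v) * h z)"
  have nonpos: "poly q z / poly q v \<notin> \<real>\<^sub>\<le>\<^sub>0" if "z \<in> ball v d" for z
  proof
    assume *: "poly q z / poly q v \<in> \<real>\<^sub>\<le>\<^sub>0"
    have "norm (poly q z / poly q v - 1) < 1" using that d d0' by auto
    then have "\<bar>Re (poly q z / poly q v - 1)\<bar> < 1" using abs_Re_le_cmod le_less_trans by blast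
    with * show False by (auto simp: complex_nonpos_Reals_iff)
  qed
  have holh: "h holomorphic_on ball v d"
    unfolding h_def using qv m nonpos by (intro holomorphic_intros) auto
  have hm: "h z ^ m = poly q z" if "z \<in> ball v d" for z
  proof -
    have nz: "poly q z / poly q v \<noteq> 0" using nonpos[OF that] by auto
    have "h z ^ m = w0 ^ m * exp (Ln (poly q z / poly q v) / of_nat m) ^ m"
      by (simp add: h_def power_mult_distrib)
    also have "exp (Ln (poly q z / poly q v) / of_nat m) ^ m = poly q z / poly q v"
      using m nz by (simp add: exp_of_nat_mult[symmetric])
    finally show ?thesis using w0 qv by simp
  qed
  have poly_holomorphic\<phi>: "\<phi> holomorphic_on ball v d"
    unfolding \<phi>_def using holh by (intro holomorphic_intros)
  have hv: "h v \<noteq> 0" using hm[of v] qv m d by (auto simp: zero_power)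
  have "(\<phi> has_field_derivative (1 - 0) * h v + deriv h v * (v - v)) (at v)"
    unfolding \<phi>_def using holh d
    by (intro derivative_intros) (auto intro!: holomorphic_derivI)
  then have "deriv \<phi> v = h v" by (auto dest: DERIV_imp_deriv)
  with hv have "deriv \<phi> v \<noteq> 0" by simp
  then obtain d' where d': "d' > 0" "ball v d' \<subseteq> ball v d" "open (\<phi> ` ball v d')" "inj_on \<phi> (ball v d')"
    using has_complex_derivative_locally_invertible[OF poly_holomorphic\<phi>, of v] d by auto
  have poly_holomorphic\<phi>': "\<phi> holomorphic_on ball v d'" using poly_holomorphic\<phi> d' holomorphic_on_subset by blast
  obtain \<psi> where \<psi>: "\<psi> holomorphic_on (\<phi> ` ball v d')" "\<And>z. z \<in> ball v d' \<Longrightarrow> \<psi> (\<phi> z) = z"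
    using holomorphic_has_inverse[OF poly_holomorphic\<phi>' open_ball d'(4)] by metis
  have "0 \<in> \<phi> ` ball v d'" using d' by (auto simp: \<phi>_def image_iff intro!: bexI[of _ v])
  then obtain \<rho> where \<rho>: "\<rho> > 0" "ball 0 \<rho> \<subseteq> \<phi> ` ball v d'"
    using d'(3) openE by blast
  define N where "N = ball v d' \<inter> \<phi> -` ball 0 \<rho>"
  have cont: "continuous_on (ball v d') \<phi>" using poly_holomorphic\<phi>' holomorphic_on_imp_continuous_on by blast
  show thesis
  proof (rule that[of N \<rho> h \<psi>])
    show "open N" unfolding N_def using cont by (intro continuous_open_preimage) auto
    show "v \<in> N" using d' \<rho> by (simp add: N_def \<phi>_def)
    show "N \<subseteq> ball v r" using d' d by (auto simp: N_def)
    show "0 < \<rho>" by fact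
    show "homeomorphism N (ball 0 \<rho>) (\<lambda>z. (z - v) * h z) \<psi>"
      unfolding \<phi>_def[symmetric] homeomorphism_def
    proof (intro conjI ballI)
      show "\<And>x. x \<in> N \<Longrightarrow> \<psi> (\<phi> x) = x" using \<psi> by (auto simp: N_def)
      show img: "\<phi> ` N = ball 0 \<rho>" using \<rho> by (auto simp: N_def)
      show "continuous_on N \<phi>" using cont by (auto simp: N_def intro: continuous_on_subset)
      show "\<psi> ` ball 0 \<rho> = N" unfolding img[symmetric] using \<psi> by (force simp: N_def)
      show "\<And>y. y \<in> ball 0 \<rho> \<Longrightarrow> \<phi> (\<psi> y) = y" unfolding img[symmetric] using \<psi> by (force simp: N_def)
      show "continuous_on (ball 0 \<rho>) \<psi>"
        using \<psi>(1) \<rho>(2) holomorphic_on_imp_continuous_on continuous_on_subset by blast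
    qed
    show "isCont h v" using holh d holomorphic_on_imp_continuous_on
      by (metis centre_in_ball continuous_on_eq_continuous_at open_ball)
    show "h v \<noteq> 0" by fact
    show "\<And>z. z \<in> N \<Longrightarrow> h z ^ m = poly q z" using hm d' by (auto simp: N_def)
  qed
qed

section \<open>Edges as sheets of a covering\<close>

lemma card_simple_roots:
  fixes F :: "complex poly"
  assumes "F \<noteq> 0" "\<And>z. poly F z = 0 \<Longrightarrow> poly (pderiv F) z \<noteq> 0"
  shows "card {z. poly F z = 0} = degree F"
proof -
  have "rsquarefree F" using assms by (auto simp: rsquarefree_roots)
  then have "smult (lead_coeff F) (\<Prod>z|poly F z = 0. [:-z, 1:]) = F"
    by (rule complex_poly_decompose_rsquarefree)
  then have "degree F = degree (\<Prod>z|poly F z = 0. [:-z, 1:])"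
    using assms by (metis degree_smult_eq leading_coeff_0_iff)
  also have "\<dots> = card {z. poly F z = 0}"
    by (subst degree_prod_eq_sum_degree) auto
  finally show ?thesis by simp
qed

text \<open>Only the open segment has to be free of critical values; its ends may be critical. The
  same results therefore serve \<open>P\<close> over the segment from 0 to \<open>c\<close>, the
  composition with \<open>Q\<close>, and each of them with the two ends exchanged.\<close>

locale noncritical_segment =
  fixes F :: "complex poly" and c1 c2 :: complex
  assumes degree_pos: "degree F > 0" and neq: "c1 \<noteq> c2"
    and noncritical: "\<And>z. poly F z \<in> open_segment c1 c2 \<Longrightarrow> poly (pderiv F) z \<noteq> 0"
begin

abbreviation "L \<equiv> open_segment c1 c2"
abbreviation "E \<equiv> poly F -` L"

lemma swap: "noncritical_segment F c2 c1"
  using degree_pos neq noncritical by unfold_locales (auto simp: open_segment_commute)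

lemma nonzero_shift: "F - [:c:] \<noteq> 0"
  using degree_pos by auto

lemma card_fibre:
  assumes "y \<in> L"
  shows "card {z. poly F z = y} = degree F"
proof -
  have "card {z. poly (F - [:y:]) z = 0} = degree (F - [:y:])"
    using assms noncritical by (intro card_simple_roots nonzero_shift) (auto simp: pderiv_diff)
  also have "degree (F - [:y:]) = degree F"
    using degree_add_eq_left[of "- [:y:]" F] degree_pos by (simp del: minus_pCons)
  finally show ?thesis by simp
qed

lemma finite_fibre: "finite {z. poly F z = y}"
  using poly_roots_finite[OF nonzero_shift[of y]] by simp

lemma segment_convex: "convex L" "L \<noteq> {}"
  using neq by auto

lemma poly_holomorphic: "poly F holomorphic_on X"
  by (simp add: holomorphic_on_def field_differentiable_def) (meson poly_DERIV has_field_derivative_at_within)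

text \<open>Every point of the open segment has exactly \<open>degree F\<close> preimages, all of
  them simple. Disjoint discs around the preimages of \<open>x\<close>, on which \<open>F\<close> is
  injective, contain the sheets over the part of the segment that lies in all of their
  images.\<close>

lemma covering: "covering_space E (poly F) L"
proof (rule covering_spaceI)
  show "continuous_on E (poly F)" by (intro continuous_intros)
  have "y \<in> poly F ` E" if "y \<in> L" for y
  proof -
    have "{z. poly F z = y} \<noteq> {}" using card_fibre[OF that] degree_pos by force
    then show ?thesis using that by auto
  qed
  then show "poly F ` E = L" by auto
  fix x assume x: "x \<in> L"
  define R where "R = {z. poly F z = x}"
  have finR: "finite R" and cardR: "card R = degree F"
    using finite_fibre card_fibre[OF x] by (auto simp: R_def)
  obtain \<epsilon> where \<epsilon>: "\<epsilon> > 0" "\<And>a b. a \<in> R \<Longrightarrow> b \<in> R \<Longrightarrow> a \<noteq> b \<Longrightarrow> dist a b \<ge> \<epsilon>"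
  proof -
    define D where "D = insert 1 ((\<lambda>(a, b). dist a b) ` {p \<in> R \<times> R. fst p \<noteq> snd p})"
    have D: "finite D" "D \<noteq> {}" using finR by (auto simp: D_def)
    show thesis
    proof (rule that[of "Min D"])
      show "Min D > 0" using D by (subst Min_gr_iff) (auto simp: D_def)
      show "dist a b \<ge> Min D" if "a \<in> R" "b \<in> R" "a \<noteq> b" for a b
        using D that by (intro Min_le) (auto simp: D_def image_iff)
    qed
  qed
  have "\<exists>s>0. s \<le> \<epsilon> / 2 \<and> open (poly F ` ball z s) \<and> inj_on (poly F) (ball z s)" if "z \<in> R" for z
  proof -
    have "deriv (poly F) z \<noteq> 0"
      using noncritical[of z] x that by (simp add: R_def DERIV_imp_deriv[OF poly_DERIV])
    then obtain s where "s > 0" "ball z s \<subseteq> ball z (\<epsilon> / 2)" "open (poly F ` ball z s)" "inj_on (poly F) (ball z s)"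
      using has_complex_derivative_locally_invertible[OF poly_holomorphic, of z "ball z (\<epsilon> / 2)"] \<epsilon>(1)
      by (metis centre_in_ball half_gt_zero open_ball)
    then show ?thesis by (auto simp: ball_subset_ball_iff)
  qed
  then obtain s where s: "\<And>z. z \<in> R \<Longrightarrow> s z > 0 \<and> s z \<le> \<epsilon> / 2 \<and> open (poly F ` ball z (s z)) \<and> inj_on (poly F) (ball z (s z))"
    by metis
  have disj: "disjnt (ball a (s a)) (ball b (s b))" if "a \<in> R" "b \<in> R" "a \<noteq> b" for a b
    using \<epsilon>(2)[OF that] s[OF that(1)] s[OF that(2)]
    by (auto simp: disjnt_def disjoint_ballI)
  define T0 where "T0 = (\<Inter>z\<in>R. poly F ` ball z (s z))"
  have "open T0" unfolding T0_def using finR s by (intro open_INT) auto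
  have xT0: "x \<in> T0" using s by (force simp: T0_def R_def)
  define T where "T = L \<inter> T0"
  define U where "U = (\<lambda>z. ball z (s z) \<inter> poly F -` T)"
  \<comment> \<open>No preimage lies outside the discs: each disc contains one, the discs are
    disjoint, and the whole fibre has only \<open>degree F\<close> points.\<close>
  have cover: "w \<in> \<Union> (U ` R)" if w: "poly F w \<in> T" for w
  proof -
    have "\<exists>p. \<forall>z\<in>R. p z \<in> ball z (s z) \<and> poly F (p z) = poly F w"
    proof -
      have "\<forall>z\<in>R. \<exists>y. y \<in> ball z (s z) \<and> poly F y = poly F w"
        using w by (force simp: T_def T0_def)
      then show ?thesis by metis
    qed
    then obtain p where p: "\<And>z. z \<in> R \<Longrightarrow> p z \<in> ball z (s z) \<and> poly F (p z) = poly F w" by blast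
    have "inj_on p R"
    proof (rule inj_onI, rule ccontr)
      fix a b assume "a \<in> R" "b \<in> R" "p a = p b" "a \<noteq> b"
      then show False using p[of a] p[of b] disj[of a b] by (metis disjnt_iff)
    qed
    then have "card (p ` R) = card {z. poly F z = poly F w}"
      using card_fibre[of "poly F w"] cardR w by (simp add: card_image T_def)
    moreover have "p ` R \<subseteq> {z. poly F z = poly F w}" using p by auto
    ultimately have "p ` R = {z. poly F z = poly F w}"
      by (intro card_subset_eq finite_fibre)
    then obtain z where "z \<in> R" "w = p z" by blast
    then have "w \<in> U z" using p[of z] w by (simp add: U_def)
    then show ?thesis using \<open>z \<in> R\<close> by blast
  qed
  have sheet: "openin (top_of_set E) (U z)" "\<exists>g. homeomorphism (U z) T (poly F) g" if z: "z \<in> R" for z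
  proof -
    have op: "open (ball z (s z) \<inter> poly F -` T0)"
      using \<open>open T0\<close> by (intro open_Int continuous_open_vimage) (auto intro!: continuous_intros)
    have "U z = E \<inter> (ball z (s z) \<inter> poly F -` T0)" by (auto simp: U_def T_def)
    then show "openin (top_of_set E) (U z)" using op openin_open_Int by metis
    obtain g where g: "g holomorphic_on poly F ` ball z (s z)"
       "\<And>w. w \<in> ball z (s z) \<Longrightarrow> g (poly F w) = w"
      using holomorphic_has_inverse[of "poly F" "ball z (s z)"] s[OF z]
      by (metis poly_holomorphic open_ball)
    have sub: "T \<subseteq> poly F ` ball z (s z)" using z by (auto simp: T_def T0_def)
    have img: "poly F ` U z = T"
    proof
      show "poly F ` U z \<subseteq> T" by (auto simp: U_def)
      show "T \<subseteq> poly F ` U z" unfolding U_def using sub by blast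
    qed
    have gu: "g (poly F w) = w" if "w \<in> U z" for w using g(2) that by (auto simp: U_def)
    have "homeomorphism (U z) T (poly F) g"
      unfolding homeomorphism_def
    proof (intro conjI ballI)
      show "continuous_on (U z) (poly F)" by (intro continuous_intros)
      show "continuous_on T g" using sub g(1) holomorphic_on_imp_continuous_on continuous_on_subset by blast
      show "poly F ` U z = T" by fact
      show "g ` T = U z" unfolding img[symmetric] image_image using gu by simp
      show "g (poly F w) = w" if "w \<in> U z" for w using gu that .
      show "poly F (g y) = y" if "y \<in> T" for y using that unfolding img[symmetric] by (auto simp: gu)
    qed
    then show "\<exists>g. homeomorphism (U z) T (poly F) g" by (rule exI[of _ g])
  qed
  have disjU: "pairwise disjnt (U ` R)"
    unfolding pairwise_image
  proof (rule pairwiseI)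
    fix a b assume "a \<in> R" "b \<in> R" "a \<noteq> b"
    then show "U a \<noteq> U b \<longrightarrow> disjnt (U a) (U b)"
      using disj[of a b] by (auto simp: U_def disjnt_def)
  qed
  have unionU: "\<Union> (U ` R) = E \<inter> poly F -` T" using cover by (auto simp: U_def T_def)
  show "\<exists>T. x \<in> T \<and> openin (top_of_set L) T \<and> (\<exists>v. \<Union> v = E \<inter> poly F -` T \<and>
      (\<forall>u\<in>v. openin (top_of_set E) u) \<and> pairwise disjnt v \<and> (\<forall>u\<in>v. \<exists>q. homeomorphism u T (poly F) q))"
  proof (rule exI[of _ T], intro conjI, goal_cases)
    case 1 show ?case using x xT0 by (simp add: T_def)
  next
    case 2 show ?case unfolding T_def using \<open>open T0\<close> by (rule openin_open_Int)
  next
    case 3 show ?case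
      using sheet by (intro exI[of _ "U ` R"] conjI unionU disjU) auto
  qed
qed

text \<open>The segment is simply connected, so its identity map lifts through any given point of
  \<open>e\<close>; the lift is the inverse of \<open>F\<close> on \<open>e\<close>.\<close>

lemma edge_homeomorphism:
  assumes e: "e \<in> components E"
  obtains g where "homeomorphism e L (poly F) g"
proof -
  obtain z where z: "z \<in> E" "e = connected_component_set E z"
    using e by (auto simp: components_iff)
  have ze: "z \<in> e" using z by simp
  have eE: "e \<subseteq> E" using e in_components_subset by blast
  have con: "connected e" using e in_components_connected by blast
  obtain g where g: "continuous_on L g" "g \<in> L \<rightarrow> E" "g (poly F z) = z" "\<And>y. y \<in> L \<Longrightarrow> poly F (g y) = y"
    using covering_space_lift_strong[OF covering z(1), of "poly F z" L "\<lambda>y. y"] z(1) segment_convex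
    by (auto simp: convex_imp_locally_path_connected convex_imp_simply_connected)
  have conF: "continuous_on X (poly F)" for X by (intro continuous_intros)
  have gF: "g (poly F w) = w" if w: "w \<in> e" for w
  proof -
    \<comment> \<open>The maps w \<mapsto> g (F w) and w \<mapsto> w both lift \<open>F\<close> on
      the connected set \<open>e\<close> and agree at \<open>z\<close>, so they are equal.\<close>
    have "continuous_on e (\<lambda>w. g (poly F w))"
      using eE by (intro continuous_on_compose2[OF g(1) conF]) auto
    from covering_space_lift_unique[OF covering, of "\<lambda>w. g (poly F w)" z "\<lambda>w. w" e "poly F", OF _ _ _ this]
    show ?thesis using g eE con ze w conF by fastforce
  qed
  have "g ` L \<subseteq> e"
  proof -
    have "connected (g ` L)" using g(1) segment_convex convex_connected connected_continuous_image by blast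
    moreover have "z \<in> g ` L" using g(3) z(1) by force
    moreover have "g ` L \<subseteq> E" using g(2) by auto
    ultimately show ?thesis unfolding z(2) using connected_component_maximal by metis
  qed
  then have "homeomorphism e L (poly F) g"
    using gF g eE conF by (intro homeomorphismI) auto
  then show thesis by (rule that)
qed

lemma inj_on_edge: "e \<in> components E \<Longrightarrow> inj_on (poly F) e"
  by (erule edge_homeomorphism) (auto simp: homeomorphism_def intro: inj_on_inverseI)

lemma image_edge: "e \<in> components E \<Longrightarrow> poly F ` e = L"
  by (erule edge_homeomorphism) (simp add: homeomorphism_def)

text \<open>Each edge maps bijectively onto the segment, so it meets the fibre over a fixed
  \<open>y\<close> exactly once.\<close>

lemma card_edges: "finite (components E)" "card (components E) = degree F"
proof -
  obtain y where y: "y \<in> L" using segment_convex by blast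
  let ?C = "\<lambda>z. connected_component_set E z"
  have "bij_betw ?C {z. poly F z = y} (components E)"
    unfolding bij_betw_def
  proof
    show "inj_on ?C {z. poly F z = y}"
    proof (rule inj_onI)
      fix a b assume ab: "a \<in> {z. poly F z = y}" "b \<in> {z. poly F z = y}" "?C a = ?C b"
      have E: "a \<in> E" "b \<in> E" using ab(1,2) y by simp_all
      have "?C a \<in> components E" using E(1) by (rule componentsI)
      then have "inj_on (poly F) (?C a)" by (rule inj_on_edge)
      moreover have "poly F a = poly F b" using ab(1,2) by simp
      moreover have "a \<in> ?C a" using E(1) by simp
      moreover have "b \<in> ?C a" unfolding ab(3) using E(2) by simp
      ultimately show "a = b" by (rule inj_onD)
    qed
    show "?C ` {z. poly F z = y} = components E"
    proof
      show "?C ` {z. poly F z = y} \<subseteq> components E"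
        using y componentsI[of _ E] by (intro image_subsetI) simp
      show "components E \<subseteq> ?C ` {z. poly F z = y}"
      proof
        fix e assume e: "e \<in> components E"
        obtain w where w: "w \<in> e" "poly F w = y" using image_edge[OF e] y by (metis imageE)
        obtain z where z: "e = ?C z" using e by (rule componentsE)
        then have "e = ?C w" using w by (metis connected_component_eq)
        then show "e \<in> ?C ` {z. poly F z = y}" using w by auto
      qed
    qed
  qed
  then show "finite (components E)" "card (components E) = degree F"
    using finite_fibre[of y] card_fibre[OF y] bij_betw_finite bij_betw_same_card by metis+
qed

section \<open>Ends of the edges and the star of a vertex\<close>

lemma bounded_edge: "bounded E"
proof -
  obtain a cs where F: "F = pCons a cs" by (cases F)
  then have "cs \<noteq> 0" using degree_pos by auto
  then obtain r where r: "\<And>z. r \<le> cmod z \<Longrightarrow> cmod c1 + cmod c2 + 1 \<le> cmod (poly F z)"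
    using poly_infinity[of cs "cmod c1 + cmod c2 + 1" a] F by blast
  have "norm z \<le> r" if "z \<in> E" for z
  proof (rule ccontr)
    assume "\<not> norm z \<le> r"
    then have "cmod c1 + cmod c2 + 1 \<le> cmod (poly F z)" using r by simp
    moreover have "poly F z \<in> L" using that by simp
    then obtain u where u: "0 < u" "u < 1" "poly F z = (1 - u) *\<^sub>R c1 + u *\<^sub>R c2"
      by (auto simp only: in_segment)
    have "cmod (poly F z) \<le> (1 - u) * cmod c1 + u * cmod c2"
      using norm_triangle_ineq[of "(1 - u) *\<^sub>R c1" "u *\<^sub>R c2"] u by simp
    moreover have "(1 - u) * cmod c1 \<le> cmod c1" "u * cmod c2 \<le> cmod c2"
      using u by (auto intro: mult_left_le_one_le)
    ultimately show False by linarith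
  qed
  then show ?thesis by (auto simp: bounded_iff)
qed

text \<open>The closure of an edge is compact, so its image is closed and contains the closure of
  the segment, in particular \<open>c1\<close>.\<close>

lemma exists_end:
  assumes e: "e \<in> components E"
  shows "\<exists>v. poly F v = c1 \<and> v \<in> closure e"
proof -
  have "compact (closure e)"
    using bounded_edge e by (meson bounded_subset compact_closure in_components_subset)
  then have "compact (poly F ` closure e)"
    by (intro compact_continuous_image continuous_intros)
  then have "closed (poly F ` closure e)" by (rule compact_imp_closed)
  moreover have "L \<subseteq> poly F ` closure e" using image_edge[OF e] closure_subset by blast
  ultimately have "closure L \<subseteq> poly F ` closure e" by (rule closure_minimal[rotated])
  then have "c1 \<in> poly F ` closure e" using neq by auto
  then show ?thesis by auto
qed

text \<open>In the chart \<phi> supplied by an m-th root of \<open>q\<close>, the polynomial is c1 +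
  \<phi>^m, and the preimage of the segment consists of m radii.
  \<open>\<gamma> \<zeta> \<tau>\<close> is the point with chart coordinate \<tau> \<zeta>, with one
  arc for each m-th root \<zeta> of \<open>c2 - c1\<close>. The number \<open>d\<close> is the
  derivative of the chart at \<open>v\<close>; it converts directions in the chart into directions
  in the plane.\<close>

lemma vertex_star:
  assumes v: "poly F v = c1" and m: "m > 0" and q: "F - [:c1:] = [:-v, 1:] ^ m * q" "poly q v \<noteq> 0"
    and r: "r > 0"
  obtains N \<epsilon> \<gamma> d where "open N" "v \<in> N" "N \<subseteq> ball v r" "0 < \<epsilon>"
    "\<And>\<zeta> \<tau>. \<zeta> ^ m = c2 - c1 \<Longrightarrow> 0 < \<tau> \<Longrightarrow> \<tau> < \<epsilon> \<Longrightarrow>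
        \<gamma> \<zeta> \<tau> \<in> N \<and> poly F (\<gamma> \<zeta> \<tau>) = c1 + of_real (\<tau> ^ m) * (c2 - c1) \<and> \<gamma> \<zeta> \<tau> \<in> E"
    "\<And>\<zeta>. \<zeta> ^ m = c2 - c1 \<Longrightarrow> connected (\<gamma> \<zeta> ` {0<..<\<epsilon>})"
    "\<And>\<zeta>. \<zeta> ^ m = c2 - c1 \<Longrightarrow> v \<in> closure (\<gamma> \<zeta> ` {0<..<\<epsilon>})"
    "\<And>z. z \<in> N \<Longrightarrow> z \<in> E \<Longrightarrow> \<exists>\<zeta> \<tau>. \<zeta> ^ m = c2 - c1 \<and> 0 < \<tau> \<and> \<tau> < \<epsilon> \<and> z = \<gamma> \<zeta> \<tau>"
    "\<And>\<zeta> \<tau> \<zeta>' \<tau>'. \<zeta> ^ m = c2 - c1 \<Longrightarrow> 0 < \<tau> \<Longrightarrow> \<tau> < \<epsilon> \<Longrightarrow> \<zeta>' ^ m = c2 - c1 \<Longrightarrow> 0 < \<tau>' \<Longrightarrow> \<tau>' < \<epsilon>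
        \<Longrightarrow> \<gamma> \<zeta> \<tau> = \<gamma> \<zeta>' \<tau>' \<Longrightarrow> \<zeta> = \<zeta>'"
    "\<And>\<zeta>. \<zeta> ^ m = c2 - c1 \<Longrightarrow> ((\<lambda>z. sgn (z - v)) \<longlongrightarrow> sgn (\<zeta> / d)) (at v within \<gamma> \<zeta> ` {0<..<\<epsilon>})"
    "d ^ m = poly q v"
proof -
  obtain N \<rho> h \<psi> where N: "open N" "v \<in> N" "N \<subseteq> ball v r" "0 < \<rho>"
    and hom: "homeomorphism N (ball 0 \<rho>) (\<lambda>z. (z - v) * h z) \<psi>" and h: "isCont h v" "h v \<noteq> 0"
    "\<And>z. z \<in> N \<Longrightarrow> h z ^ m = poly q z"
    by (rule root_chart[OF m q(2) r]) blast
  define \<phi> where "\<phi> = (\<lambda>z. (z - v) * h z)"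
  have hom': "homeomorphism N (ball 0 \<rho>) \<phi> \<psi>" using hom by (simp add: \<phi>_def)
  have \<psi>N: "\<psi> w \<in> N" and \<phi>\<psi>: "\<phi> (\<psi> w) = w" if "norm w < \<rho>" for w
    using hom' that by (auto simp: homeomorphism_def)
  have \<psi>\<phi>: "\<psi> (\<phi> z) = z" and \<phi>N: "norm (\<phi> z) < \<rho>" if "z \<in> N" for z
    using hom' that by (auto simp: homeomorphism_def)
  have F\<phi>: "poly F z = c1 + \<phi> z ^ m" if "z \<in> N" for z
  proof -
    have "poly (F - [:c1:]) z = (z - v) ^ m * poly q z"
      unfolding q(1) by (simp add: poly_power)
    also have "\<dots> = \<phi> z ^ m" using h(3)[OF that] by (simp add: \<phi>_def power_mult_distrib)
    finally show ?thesis by (simp add: diff_eq_eq add.commute)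
  qed
  define R where "R = root m (cmod (c2 - c1))"
  have R: "R > 0" using neq m by (simp add: R_def)
  have norm\<zeta>: "cmod \<zeta> = R" if "\<zeta> ^ m = c2 - c1" for \<zeta>
    using m by (simp add: R_def that[symmetric] norm_power real_root_power_cancel)
  \<comment> \<open>The bound 1 keeps \<tau>^m below 1, hence inside the open segment; \<rho> / R
    keeps \<tau> \<zeta> inside the image of the chart.\<close>
  define \<epsilon> where "\<epsilon> = min 1 (\<rho> / R)"
  have \<epsilon>: "0 < \<epsilon>" "\<epsilon> \<le> 1" "\<epsilon> * R \<le> \<rho>"
    using R N by (auto simp: \<epsilon>_def min_def field_simps)
  define \<gamma> where "\<gamma> = (\<lambda>\<zeta> \<tau>. \<psi> (of_real \<tau> * \<zeta>))"
  have small: "norm (of_real \<tau> * \<zeta>) < \<rho>" if "\<zeta> ^ m = c2 - c1" "0 \<le> \<tau>" "\<tau> < \<epsilon>" for \<zeta> \<tau>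
  proof -
    have "\<tau> * R < \<epsilon> * R" using that R by simp
    then show ?thesis using norm\<zeta>[OF that(1)] that \<epsilon> by (simp add: norm_mult)
  qed
  have \<phi>\<gamma>: "\<phi> (\<gamma> \<zeta> \<tau>) = of_real \<tau> * \<zeta>" and \<gamma>N: "\<gamma> \<zeta> \<tau> \<in> N"
    if "\<zeta> ^ m = c2 - c1" "0 \<le> \<tau>" "\<tau> < \<epsilon>" for \<zeta> \<tau>
    using \<phi>\<psi> \<psi>N small[OF that] by (auto simp: \<gamma>_def)
  have F\<gamma>: "poly F (\<gamma> \<zeta> \<tau>) = c1 + of_real (\<tau> ^ m) * (c2 - c1)" if "\<zeta> ^ m = c2 - c1" "0 \<le> \<tau>" "\<tau> < \<epsilon>" for \<zeta> \<tau>
    using F\<phi>[OF \<gamma>N[OF that]] \<phi>\<gamma>[OF that] that(1) by (simp add: power_mult_distrib)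
  have contpsi: "continuous_on (ball 0 \<rho>) \<psi>" using hom' by (simp add: homeomorphism_def)
  have cont\<gamma>: "continuous_on {0..<\<epsilon>} (\<gamma> \<zeta>)" if "\<zeta> ^ m = c2 - c1" for \<zeta>
    unfolding \<gamma>_def using small[OF that]
    by (intro continuous_on_compose2[OF contpsi]) (auto intro!: continuous_intros)
  have \<gamma>0: "\<gamma> \<zeta> 0 = v" for \<zeta>
    using \<psi>\<phi>[OF N(2)] by (simp add: \<gamma>_def \<phi>_def)
  have zero_closure: "(0::real) \<in> closure {0<..<\<epsilon>}" using \<epsilon> by simp
  show thesis
  proof (rule that[of N \<epsilon> \<gamma> "h v"])
    show "open N" "v \<in> N" "N \<subseteq> ball v r" "0 < \<epsilon>" using N \<epsilon> by auto
    show "h v ^ m = poly q v" using h N by simp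
  next
    fix \<zeta> \<tau> assume *: "\<zeta> ^ m = c2 - c1" "0 < \<tau>" "\<tau> < \<epsilon>"
    have t: "0 < \<tau> ^ m" "\<tau> ^ m < 1" using * m \<epsilon> by (auto intro: power_less_one_iff[THEN iffD2] simp: power_less_one_iff)
    have "poly F (\<gamma> \<zeta> \<tau>) \<in> L"
      unfolding in_segment F\<gamma>[OF *(1) less_imp_le[OF *(2)] *(3)] using t neq
      by (intro conjI exI[of _ "\<tau> ^ m"]) (auto simp: scaleR_conv_of_real algebra_simps)
    then show "\<gamma> \<zeta> \<tau> \<in> N \<and> poly F (\<gamma> \<zeta> \<tau>) = c1 + of_real (\<tau> ^ m) * (c2 - c1) \<and> \<gamma> \<zeta> \<tau> \<in> E"
      using F\<gamma> \<gamma>N * by auto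
  next
    fix \<zeta> assume *: "\<zeta> ^ m = c2 - c1"
    have sub: "{0<..<\<epsilon>} \<subseteq> {0..<\<epsilon>}" by auto
    show "connected (\<gamma> \<zeta> ` {0<..<\<epsilon>})"
      using continuous_on_subset[OF cont\<gamma>[OF *] sub] by (intro connected_continuous_image) auto
    have "(\<gamma> \<zeta> \<longlongrightarrow> v) (at 0 within {0..<\<epsilon>})"
      using cont\<gamma>[OF *] \<epsilon> \<gamma>0[of \<zeta>] by (auto simp: continuous_on_def)
    then have lim: "(\<gamma> \<zeta> \<longlongrightarrow> v) (at 0 within {0<..<\<epsilon>})"
      by (rule tendsto_within_subset) (rule sub)
    show "v \<in> closure (\<gamma> \<zeta> ` {0<..<\<epsilon>})"
    proof (rule Lim_in_closed_set[OF closed_closure _ _ lim])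
      show "\<forall>\<^sub>F x in at 0 within {0<..<\<epsilon>}. \<gamma> \<zeta> x \<in> closure (\<gamma> \<zeta> ` {0<..<\<epsilon>})"
        unfolding eventually_at_filter
        by (intro always_eventually) (auto intro: closure_subset[THEN subsetD])
      show "at 0 within {0<..<\<epsilon>} \<noteq> bot"
        using zero_closure by (simp add: at_within_eq_bot_iff)
    qed
    \<comment> \<open>On the arc (z - v) h(z) = \<tau> \<zeta> with \<tau> > 0, so the direction of
      z - v is that of \<zeta> divided by that of h(z), and h(z) tends to h(v).\<close>
    have ev: "\<forall>\<^sub>F z in at v within \<gamma> \<zeta> ` {0<..<\<epsilon>}. sgn \<zeta> / sgn (h z) = sgn (z - v)"
    proof -
      have "sgn \<zeta> / sgn (h z) = sgn (z - v)" if "z \<in> \<gamma> \<zeta> ` {0<..<\<epsilon>}" for z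
      proof -
        obtain \<tau> where \<tau>: "0 < \<tau>" "\<tau> < \<epsilon>" "z = \<gamma> \<zeta> \<tau>" using \<open>z \<in> _\<close> by auto
        have "(z - v) * h z = of_real \<tau> * \<zeta>"
          using \<phi>\<gamma>[OF *, of \<tau>] \<tau> by (simp add: \<phi>_def)
        then have "sgn (z - v) * sgn (h z) = sgn (of_real \<tau> * \<zeta>)" by (simp flip: sgn_mult)
        also have "\<dots> = sgn \<zeta>" using \<tau> by (simp add: sgn_mult sgn_of_real)
        finally have eq: "sgn (z - v) * sgn (h z) = sgn \<zeta>" .
        have "\<zeta> \<noteq> 0" using norm\<zeta>[OF *] R by auto
        then have "sgn (h z) \<noteq> 0" using eq by (metis mult_zero_right sgn_zero_iff)
        then show ?thesis using eq by (simp add: field_simps)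
      qed
      then show ?thesis by (simp add: eventually_at_filter)
    qed
    have "(h \<longlongrightarrow> h v) (at v within \<gamma> \<zeta> ` {0<..<\<epsilon>})"
      using h(1) unfolding isCont_def by (rule tendsto_within_subset) simp
    then have "((\<lambda>z. sgn \<zeta> / sgn (h z)) \<longlongrightarrow> sgn \<zeta> / sgn (h v)) (at v within \<gamma> \<zeta> ` {0<..<\<epsilon>})"
      using h(2) by (intro tendsto_divide tendsto_const tendsto_sgn) (auto simp: sgn_zero_iff)
    then have "((\<lambda>z. sgn (z - v)) \<longlongrightarrow> sgn \<zeta> / sgn (h v)) (at v within \<gamma> \<zeta> ` {0<..<\<epsilon>})"
      by (rule Lim_transform_eventually) (rule ev)
    moreover have "sgn \<zeta> / sgn (h v) = sgn (\<zeta> / h v)"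
      by (simp only: divide_inverse sgn_mult sgn_inverse)
    ultimately show "((\<lambda>z. sgn (z - v)) \<longlongrightarrow> sgn (\<zeta> / h v)) (at v within \<gamma> \<zeta> ` {0<..<\<epsilon>})"
      by (simp only:)
  next
    fix z assume z: "z \<in> N" "z \<in> E"
    then have "poly F z \<in> L" by simp
    then obtain t where t: "0 < t" "t < 1" "poly F z = (1 - t) *\<^sub>R c1 + t *\<^sub>R c2"
      by (auto simp only: in_segment)
    define \<tau> where "\<tau> = root m t"
    define \<zeta> where "\<zeta> = \<phi> z / of_real \<tau>"
    have \<tau>: "0 < \<tau>" "\<tau> < 1" "\<tau> ^ m = t" using t m by (auto simp: \<tau>_def)
    have eq: "\<phi> z = of_real \<tau> * \<zeta>" using \<tau> by (simp add: \<zeta>_def)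
    have "\<phi> z ^ m = of_real t * (c2 - c1)"
      using F\<phi>[OF z(1)] t(3) by (simp add: scaleR_conv_of_real algebra_simps)
    then have "of_real t * \<zeta> ^ m = of_real t * (c2 - c1)"
      unfolding eq power_mult_distrib \<tau>(3)[symmetric] by simp
    then have \<zeta>: "\<zeta> ^ m = c2 - c1" using t by simp
    have "norm (\<phi> z) < \<rho>" using \<phi>N z by blast
    then have "\<tau> * R < \<rho>" unfolding eq using norm\<zeta>[OF \<zeta>] \<tau> by (simp add: norm_mult)
    then have "\<tau> < \<epsilon>" using R \<tau> by (simp add: \<epsilon>_def field_simps)
    moreover have "z = \<gamma> \<zeta> \<tau>" using \<psi>\<phi>[OF z(1)] eq by (simp add: \<gamma>_def)
    ultimately show "\<exists>\<zeta> \<tau>. \<zeta> ^ m = c2 - c1 \<and> 0 < \<tau> \<and> \<tau> < \<epsilon> \<and> z = \<gamma> \<zeta> \<tau>"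
      using \<zeta> \<tau> by blast
  next
    fix \<zeta> \<tau> \<zeta>' \<tau>' assume *: "\<zeta> ^ m = c2 - c1" "0 < \<tau>" "\<tau> < \<epsilon>" "\<zeta>' ^ m = c2 - c1" "0 < \<tau>'" "\<tau>' < \<epsilon>" "\<gamma> \<zeta> \<tau> = \<gamma> \<zeta>' \<tau>'"
    then have eq: "of_real \<tau> * \<zeta> = of_real \<tau>' * \<zeta>'"
      using \<phi>\<gamma>[of \<zeta> \<tau>] \<phi>\<gamma>[of \<zeta>' \<tau>'] by simp
    then have "\<tau> * R = \<tau>' * R" using norm\<zeta>[OF *(1)] norm\<zeta>[OF *(4)] *
      by (metis abs_of_pos norm_mult norm_of_real)
    then show "\<zeta> = \<zeta>'" using eq R * by simp
  qed
qed

lemma order_factor: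
  assumes "poly F v = c1"
  obtains q where "F - [:c1:] = [:-v, 1:] ^ order v (F - [:c1:]) * q" "poly q v \<noteq> 0"
    "order v (F - [:c1:]) > 0"
proof -
  have "poly (F - [:c1:]) v = 0" using assms by simp
  then have "order v (F - [:c1:]) > 0" using nonzero_shift[of c1] order_root by blast
  moreover obtain q where "F - [:c1:] = [:-v, 1:] ^ order v (F - [:c1:]) * q" "\<not> [:-v, 1:] dvd q"
    using order_decomp[OF nonzero_shift[of c1]] by blast
  ultimately show thesis using that by (simp add: poly_eq_0_iff_dvd)
qed

lemma component_superset:
  assumes e: "e \<in> components E" and X: "connected X" "X \<subseteq> E" and z: "z \<in> e" "z \<in> X"
  shows "X \<subseteq> e"
  using components_maximal[OF e X(1) X(2)] z by blast

lemma component_eq: "e \<in> components E \<Longrightarrow> e' \<in> components E \<Longrightarrow> z \<in> e \<Longrightarrow> z \<in> e' \<Longrightarrow> e = e'"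
  using components_eq by blast

text \<open>Near each of two different ends the edge would contain an arc on which \<open>F\<close>
  takes all values of the segment close to \<open>c1\<close>. As \<open>F\<close> is injective on
  the edge, the arcs would share a point, although they lie in disjoint discs.\<close>

lemma unique_end:
  assumes e: "e \<in> components E" and v: "poly F v = c1" "v \<in> closure e"
    and v': "poly F v' = c1" "v' \<in> closure e"
  shows "v = v'"
proof (rule ccontr)
  assume "v \<noteq> v'"
  define r where "r = dist v v' / 2"
  have r: "r > 0" using \<open>v \<noteq> v'\<close> by (simp add: r_def)
  have eE: "e \<subseteq> E" using e in_components_subset by blast
  have *: "\<exists>m \<epsilon> \<gamma>. 0 < \<epsilon> \<and> m > 0 \<and> (\<forall>\<tau>. 0 < \<tau> \<longrightarrow> \<tau> < \<epsilon> \<longrightarrow> \<gamma> \<tau> \<in> ball w r \<and> \<gamma> \<tau> \<in> e \<and>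
      poly F (\<gamma> \<tau>) = c1 + of_real (\<tau> ^ m) * (c2 - c1))" if w: "poly F w = c1" "w \<in> closure e" for w
  proof -
    obtain q where q: "F - [:c1:] = [:-w, 1:] ^ order w (F - [:c1:]) * q" "poly q w \<noteq> 0"
      "order w (F - [:c1:]) > 0" using order_factor[OF w(1)] by blast
    define m where "m = order w (F - [:c1:])"
    obtain N \<epsilon> \<gamma> where N: "open N" "w \<in> N" "N \<subseteq> ball w r" and \<epsilon>: "0 < \<epsilon>"
      and \<gamma>: "\<And>\<zeta> \<tau>. \<zeta> ^ m = c2 - c1 \<Longrightarrow> 0 < \<tau> \<Longrightarrow> \<tau> < \<epsilon> \<Longrightarrow>
        \<gamma> \<zeta> \<tau> \<in> N \<and> poly F (\<gamma> \<zeta> \<tau>) = c1 + of_real (\<tau> ^ m) * (c2 - c1) \<and> \<gamma> \<zeta> \<tau> \<in> E"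
      and con: "\<And>\<zeta>. \<zeta> ^ m = c2 - c1 \<Longrightarrow> connected (\<gamma> \<zeta> ` {0<..<\<epsilon>})"
      and cov: "\<And>z. z \<in> N \<Longrightarrow> z \<in> E \<Longrightarrow> \<exists>\<zeta> \<tau>. \<zeta> ^ m = c2 - c1 \<and> 0 < \<tau> \<and> \<tau> < \<epsilon> \<and> z = \<gamma> \<zeta> \<tau>"
      by (rule vertex_star[OF w(1) q(3) q(1) q(2) r, folded m_def]) blast
    obtain z where z: "z \<in> e" "z \<in> N"
      using N w(2) by (meson closure_iff_nhds_not_empty disjoint_iff subset_refl)
    then obtain \<zeta> \<tau> where \<zeta>: "\<zeta> ^ m = c2 - c1" "0 < \<tau>" "\<tau> < \<epsilon>" "z = \<gamma> \<zeta> \<tau>"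
      using cov eE by blast
    have sub: "\<gamma> \<zeta> ` {0<..<\<epsilon>} \<subseteq> e"
    proof (rule component_superset[OF e con[OF \<zeta>(1)] _ z(1)])
      show "\<gamma> \<zeta> ` {0<..<\<epsilon>} \<subseteq> E" using \<gamma>[OF \<zeta>(1)]
        by (intro image_subsetI) (simp only: greaterThanLessThan_iff)
      show "z \<in> \<gamma> \<zeta> ` {0<..<\<epsilon>}" unfolding \<zeta>(4) using \<zeta> by (intro imageI) simp
    qed
    show ?thesis
    proof (intro exI conjI allI impI)
      show "0 < \<epsilon>" "0 < m" using \<epsilon> q(3) by (auto simp: m_def)
      fix \<tau> assume \<tau>: "0 < \<tau>" "\<tau> < \<epsilon>"
      show "\<gamma> \<zeta> \<tau> \<in> ball w r" using \<gamma>[OF \<zeta>(1) \<tau>] N by blast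
      show "\<gamma> \<zeta> \<tau> \<in> e" using sub \<tau> by (simp add: image_subset_iff)
      show "poly F (\<gamma> \<zeta> \<tau>) = c1 + of_real (\<tau> ^ m) * (c2 - c1)" using \<gamma>[OF \<zeta>(1) \<tau>] by blast
    qed
  qed
  obtain m \<epsilon> \<gamma> where 1: "0 < \<epsilon>" "m > 0" "\<And>\<tau>. 0 < \<tau> \<Longrightarrow> \<tau> < \<epsilon> \<Longrightarrow> \<gamma> \<tau> \<in> ball v r \<and> \<gamma> \<tau> \<in> e \<and>
      poly F (\<gamma> \<tau>) = c1 + of_real (\<tau> ^ m) * (c2 - c1)" using *[OF v] by blast
  obtain m' \<epsilon>' \<gamma>' where 2: "0 < \<epsilon>'" "m' > 0" "\<And>\<tau>. 0 < \<tau> \<Longrightarrow> \<tau> < \<epsilon>' \<Longrightarrow> \<gamma>' \<tau> \<in> ball v' r \<and> \<gamma>' \<tau> \<in> e \<and>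
      poly F (\<gamma>' \<tau>) = c1 + of_real (\<tau> ^ m') * (c2 - c1)" using *[OF v'] by blast
  \<comment> \<open>The parameters \<open>s ^ m'\<close> on the first arc and \<open>s ^ m\<close>
    on the second give the same value of \<open>F\<close>, because both enter it as the power of
    \<open>s\<close> with exponent m m'. This allows for different multiplicities at the two
    ends.\<close>
  define s where "s = min 1 (min \<epsilon> \<epsilon>') / 2"
  have s: "0 < s" "s < 1" "s < \<epsilon>" "s < \<epsilon>'" using 1(1) 2(1) by (auto simp: s_def)
  have "s ^ m \<le> s ^ 1" "s ^ m' \<le> s ^ 1"
    using s 1(2) 2(2) power_decreasing[of 1 m s] power_decreasing[of 1 m' s] by auto
  then have t: "0 < s ^ m'" "s ^ m' < \<epsilon>" "0 < s ^ m" "s ^ m < \<epsilon>'" using s by auto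
  have "poly F (\<gamma> (s ^ m')) = poly F (\<gamma>' (s ^ m))"
    using 1(3)[OF t(1,2)] 2(3)[OF t(3,4)] by (simp add: power_mult[symmetric] mult.commute)
  then have "\<gamma> (s ^ m') = \<gamma>' (s ^ m)"
    using inj_on_edge[OF e] 1(3)[OF t(1,2)] 2(3)[OF t(3,4)] by (blast dest: inj_onD)
  then have "dist v (\<gamma> (s ^ m')) < r" "dist v' (\<gamma> (s ^ m')) < r"
    using 1(3)[OF t(1,2)] 2(3)[OF t(3,4)] by auto
  then have "dist v v' < r + r" using dist_triangle2 by (smt (verit))
  then show False by (simp add: r_def)
qed

text \<open>The m arcs of the star belong to m different edges, since at equal parameters they have
  equal values under \<open>F\<close>, which is injective on each edge. The equation for
  \<open>dir e ^ m\<close> is kept because it later pins down the actual directions at 1.\<close>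

lemma vertex_edges:
  assumes v: "poly F v = c1" and q: "F - [:c1:] = [:-v, 1:] ^ m * q" "poly q v \<noteq> 0" and m: "m > 0"
  shows "card {e \<in> components E. v \<in> closure e} = m"
    and "\<exists>dir. inj_on dir {e \<in> components E. v \<in> closure e} \<and>
      (\<forall>e. e \<in> components E \<longrightarrow> v \<in> closure e \<longrightarrow>
          edge_direction v e (dir e) \<and> dir e ^ m = sgn ((c2 - c1) / poly q v))"
proof -
  obtain N \<epsilon> \<gamma> d where N: "open N" "v \<in> N" "N \<subseteq> ball v 1" and \<epsilon>: "0 < \<epsilon>"
    and \<gamma>: "\<And>\<zeta> \<tau>. \<zeta> ^ m = c2 - c1 \<Longrightarrow> 0 < \<tau> \<Longrightarrow> \<tau> < \<epsilon> \<Longrightarrow>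
      \<gamma> \<zeta> \<tau> \<in> N \<and> poly F (\<gamma> \<zeta> \<tau>) = c1 + of_real (\<tau> ^ m) * (c2 - c1) \<and> \<gamma> \<zeta> \<tau> \<in> E"
    and con: "\<And>\<zeta>. \<zeta> ^ m = c2 - c1 \<Longrightarrow> connected (\<gamma> \<zeta> ` {0<..<\<epsilon>})"
    and vcl: "\<And>\<zeta>. \<zeta> ^ m = c2 - c1 \<Longrightarrow> v \<in> closure (\<gamma> \<zeta> ` {0<..<\<epsilon>})"
    and cov: "\<And>z. z \<in> N \<Longrightarrow> z \<in> E \<Longrightarrow> \<exists>\<zeta> \<tau>. \<zeta> ^ m = c2 - c1 \<and> 0 < \<tau> \<and> \<tau> < \<epsilon> \<and> z = \<gamma> \<zeta> \<tau>"
    and inj\<gamma>: "\<And>\<zeta> \<tau> \<zeta>' \<tau>'. \<zeta> ^ m = c2 - c1 \<Longrightarrow> 0 < \<tau> \<Longrightarrow> \<tau> < \<epsilon> \<Longrightarrow> \<zeta>' ^ m = c2 - c1 \<Longrightarrow> 0 < \<tau>' \<Longrightarrow> \<tau>' < \<epsilon>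
        \<Longrightarrow> \<gamma> \<zeta> \<tau> = \<gamma> \<zeta>' \<tau>' \<Longrightarrow> \<zeta> = \<zeta>'"
    and dirlim: "\<And>\<zeta>. \<zeta> ^ m = c2 - c1 \<Longrightarrow> ((\<lambda>z. sgn (z - v)) \<longlongrightarrow> sgn (\<zeta> / d)) (at v within \<gamma> \<zeta> ` {0<..<\<epsilon>})"
    and d: "d ^ m = poly q v"
    by (rule vertex_star[OF v m q zero_less_one]) blast
  define W where "W = {\<zeta>. \<zeta> ^ m = c2 - c1}"
  have cardW: "card W = m" using card_nth_roots[of "c2 - c1" m] neq m by (simp add: W_def)
  define C where "C = (\<lambda>\<zeta>. connected_component_set E (\<gamma> \<zeta> (\<epsilon> / 2)))"
  have half: "0 < \<epsilon> / 2" "\<epsilon> / 2 < \<epsilon>" using \<epsilon> by auto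
  have C: "C \<zeta> \<in> components E" "\<gamma> \<zeta> (\<epsilon> / 2) \<in> C \<zeta>" "\<gamma> \<zeta> ` {0<..<\<epsilon>} \<subseteq> C \<zeta>" if "\<zeta> \<in> W" for \<zeta>
  proof -
    have \<zeta>: "\<zeta> ^ m = c2 - c1" using that by (simp add: W_def)
    have inE: "\<gamma> \<zeta> (\<epsilon> / 2) \<in> E" using \<gamma>[OF \<zeta> half] by blast
    show 1: "C \<zeta> \<in> components E" unfolding C_def using inE by (rule componentsI)
    show 2: "\<gamma> \<zeta> (\<epsilon> / 2) \<in> C \<zeta>" unfolding C_def using inE by simp
    show "\<gamma> \<zeta> ` {0<..<\<epsilon>} \<subseteq> C \<zeta>"
    proof (rule component_superset[OF 1 con[OF \<zeta>] _ 2])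
      show "\<gamma> \<zeta> ` {0<..<\<epsilon>} \<subseteq> E" using \<gamma>[OF \<zeta>]
        by (intro image_subsetI) (simp only: greaterThanLessThan_iff)
      show "\<gamma> \<zeta> (\<epsilon> / 2) \<in> \<gamma> \<zeta> ` {0<..<\<epsilon>}" using half by (intro imageI) simp
    qed
  qed
  have injC: "inj_on C W"
  proof (rule inj_onI)
    fix \<zeta> \<zeta>' assume *: "\<zeta> \<in> W" "\<zeta>' \<in> W" "C \<zeta> = C \<zeta>'"
    have 1: "\<zeta> ^ m = c2 - c1" "\<zeta>' ^ m = c2 - c1" using * by (auto simp: W_def)
    have "poly F (\<gamma> \<zeta> (\<epsilon> / 2)) = poly F (\<gamma> \<zeta>' (\<epsilon> / 2))"
      using \<gamma>[OF 1(1) half] \<gamma>[OF 1(2) half] by simp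
    then have "\<gamma> \<zeta> (\<epsilon> / 2) = \<gamma> \<zeta>' (\<epsilon> / 2)"
      using inj_onD[OF inj_on_edge[OF C(1)[OF *(1)]]] C(2)[OF *(1)] C(2)[OF *(2)] *(3) by simp
    then show "\<zeta> = \<zeta>'" by (rule inj\<gamma>[OF 1(1) half 1(2) half])
  qed
  \<comment> \<open>Within \<open>N\<close> an edge consists of its own arc only, as every other arc
    belongs to another edge. Hence a limit along the arc is a limit along the edge.\<close>
  have near: "\<exists>\<tau>. 0 < \<tau> \<and> \<tau> < \<epsilon> \<and> z = \<gamma> \<zeta> \<tau>" if \<zeta>: "\<zeta> \<in> W" and z: "z \<in> N" "z \<in> C \<zeta>" for \<zeta> z
  proof -
    have "z \<in> E" using z(2) C(1)[OF \<zeta>] in_components_subset by blast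
    then obtain \<zeta>' \<tau> where \<zeta>': "\<zeta>' ^ m = c2 - c1" "0 < \<tau>" "\<tau> < \<epsilon>" "z = \<gamma> \<zeta>' \<tau>"
      using cov z(1) by blast
    have W': "\<zeta>' \<in> W" using \<zeta>' by (simp add: W_def)
    have "z \<in> C \<zeta>'" using C(3)[OF W'] \<zeta>' by (simp add: image_subset_iff)
    then have "C \<zeta> = C \<zeta>'" by (rule component_eq[OF C(1)[OF \<zeta>] C(1)[OF W'] z(2)])
    then have "\<zeta> = \<zeta>'" by (rule inj_onD[OF injC _ \<zeta> W'])
    then show ?thesis using \<zeta>' by blast
  qed
  define D where "D = {e \<in> components E. v \<in> closure e}"
  have img: "C ` W = D"
  proof
    show "C ` W \<subseteq> D"
    proof (rule image_subsetI)
      fix \<zeta> assume \<zeta>: "\<zeta> \<in> W"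
      then have "v \<in> closure (C \<zeta>)" using closure_mono[OF C(3)[OF \<zeta>]] vcl by (auto simp: W_def)
      then show "C \<zeta> \<in> D" using C(1)[OF \<zeta>] by (simp add: D_def)
    qed
    show "D \<subseteq> C ` W"
    proof
      fix e assume "e \<in> D"
      then have e: "e \<in> components E" "v \<in> closure e" by (auto simp: D_def)
      obtain z where z: "z \<in> e" "z \<in> N"
        using N e(2) by (meson closure_iff_nhds_not_empty disjoint_iff subset_refl)
      have "z \<in> E" using z(1) e(1) in_components_subset by blast
      then obtain \<zeta> \<tau> where \<zeta>: "\<zeta> ^ m = c2 - c1" "0 < \<tau>" "\<tau> < \<epsilon>" "z = \<gamma> \<zeta> \<tau>"
        using cov z(2) by blast
      have W': "\<zeta> \<in> W" using \<zeta> by (simp add: W_def)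
      have "z \<in> C \<zeta>" using C(3)[OF W'] \<zeta> by (simp add: image_subset_iff)
      then have "e = C \<zeta>" by (rule component_eq[OF e(1) C(1)[OF W'] z(1)])
      then show "e \<in> C ` W" using W' by blast
    qed
  qed
  show "card {e \<in> components E. v \<in> closure e} = m"
    using card_image[OF injC] cardW unfolding img D_def by simp
  have dir: "edge_direction v (C \<zeta>) (sgn (\<zeta> / d))" if \<zeta>: "\<zeta> \<in> W" for \<zeta>
  proof -
    have "C \<zeta> \<inter> N - {v} = \<gamma> \<zeta> ` {0<..<\<epsilon>} \<inter> N - {v}"
    proof -
      have "C \<zeta> \<inter> N \<subseteq> \<gamma> \<zeta> ` {0<..<\<epsilon>}"
      proof
        fix z assume "z \<in> C \<zeta> \<inter> N"
        then obtain \<tau> where "0 < \<tau>" "\<tau> < \<epsilon>" "z = \<gamma> \<zeta> \<tau>" using near[OF \<zeta>] by blast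
        then show "z \<in> \<gamma> \<zeta> ` {0<..<\<epsilon>}" by simp
      qed
      then show ?thesis using C(3)[OF \<zeta>] by blast
    qed
    then have "at v within C \<zeta> = at v within \<gamma> \<zeta> ` {0<..<\<epsilon>}"
      by (rule at_within_nhd[OF N(2,1)])
    then show ?thesis unfolding edge_direction_def using dirlim \<zeta> by (simp add: W_def)
  qed
  have pow: "sgn (\<zeta> / d) ^ m = sgn ((c2 - c1) / poly q v)" if "\<zeta> \<in> W" for \<zeta>
  proof -
    have "sgn (z ^ n) = sgn z ^ n" for z :: complex and n by (induction n) (simp_all add: sgn_mult)
    then have "sgn (\<zeta> / d) ^ m = sgn ((\<zeta> / d) ^ m)" by simp
    then show ?thesis using that d by (simp add: W_def power_divide)
  qed
  \<comment> \<open>All \<zeta> have the same modulus, so their directions determine them.\<close>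
  have injdir: "\<zeta> = \<zeta>'" if "\<zeta> \<in> W" "\<zeta>' \<in> W" "sgn (\<zeta> / d) = sgn (\<zeta>' / d)" for \<zeta> \<zeta>'
  proof -
    have "d \<noteq> 0" using d q(2) m by (metis power_0_left not_gr_zero)
    have "cmod \<zeta> ^ m = cmod \<zeta>' ^ m" using that by (simp add: W_def flip: norm_power)
    then have "cmod \<zeta> = cmod \<zeta>'" using m by (metis norm_ge_zero power_eq_iff_eq_base)
    then have n: "norm (\<zeta> / d) = norm (\<zeta>' / d)" by (simp add: norm_divide)
    have polar: "x = norm x *\<^sub>R sgn x" for x :: complex by (cases "x = 0") (simp_all add: sgn_div_norm)
    have "\<zeta> / d = \<zeta>' / d" using polar[of "\<zeta> / d"] polar[of "\<zeta>' / d"] unfolding that(3) n by metis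
    then show ?thesis using \<open>d \<noteq> 0\<close> by simp
  qed
  define dir' where "dir' = (\<lambda>e. sgn (inv_into W C e / d))"
  have dir': "dir' (C \<zeta>) = sgn (\<zeta> / d)" if "\<zeta> \<in> W" for \<zeta>
    using injC that by (simp add: dir'_def)
  show "\<exists>dir. inj_on dir {e \<in> components E. v \<in> closure e} \<and>
      (\<forall>e. e \<in> components E \<longrightarrow> v \<in> closure e \<longrightarrow>
          edge_direction v e (dir e) \<and> dir e ^ m = sgn ((c2 - c1) / poly q v))"
  proof (rule exI[of _ dir'], intro conjI allI impI, unfold D_def[symmetric])
    show "inj_on dir' D"
    proof (rule inj_onI)
      fix a b assume ab: "a \<in> D" "b \<in> D" "dir' a = dir' b"
      obtain \<zeta> where 1: "\<zeta> \<in> W" "a = C \<zeta>" using ab(1) img by blast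
      obtain \<zeta>' where 2: "\<zeta>' \<in> W" "b = C \<zeta>'" using ab(2) img by blast
      have "\<zeta> = \<zeta>'" using injdir[OF 1(1) 2(1)] ab(3) 1 2 dir' by simp
      then show "a = b" using 1 2 by simp
    qed
  next
    fix e assume "e \<in> components E" "v \<in> closure e"
    then have "e \<in> C ` W" unfolding img D_def by simp
    then obtain \<zeta> where 1: "\<zeta> \<in> W" "e = C \<zeta>" by blast
    show "edge_direction v e (dir' e)" "dir' e ^ m = sgn ((c2 - c1) / poly q v)"
      using dir[OF 1(1)] pow[OF 1(1)] dir'[OF 1(1)] 1(2) by simp_all
  qed
qed

end

section \<open>The tree over a segment\<close>

text \<open>Translates the quotients of directions that occur in \<open>ccw\<close> into differences
  of arguments modulo a full turn.\<close>

lemma Arg2pi_quotient: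
  assumes "u \<noteq> 0" "w \<noteq> 0"
  shows "Arg2pi (w / u) = (if Arg2pi u \<le> Arg2pi w then Arg2pi w - Arg2pi u else Arg2pi w - Arg2pi u + 2 * pi)"
proof (cases "Arg2pi u \<le> Arg2pi w")
  case True
  then show ?thesis using Arg2pi_divide[OF assms] by simp
next
  case False
  then have 1: "Arg2pi (u / w) = Arg2pi u - Arg2pi w" using Arg2pi_divide[OF assms(2,1)] by simp
  have "Arg2pi (w / u) = Arg2pi (inverse (u / w))" by simp
  also have "\<dots> = Arg2pi w - Arg2pi u + 2 * pi"
  proof (cases "u / w \<in> \<real>")
    case True
    then have "Arg2pi (u / w) = pi" using Arg2pi_eq_0_pi[of "u / w"] 1 False by auto
    then show ?thesis using True 1 unfolding Arg2pi_inverse by simp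
  next
    case nr: False
    then show ?thesis using 1 unfolding Arg2pi_inverse by simp
  qed
  finally show ?thesis using False by simp
qed

text \<open>In terms of the arguments \<open>t e\<close>, the relation is a disjunction of three
  chains of inequalities, one for each rotation of the triple. In this form the axioms of a cyclic
  order are linear arithmetic.\<close>

lemma cyclic_order_by_argument:
  assumes nz: "\<And>e. e \<in> A \<Longrightarrow> u e \<noteq> 0" and inj: "\<And>e d. e \<in> A \<Longrightarrow> d \<in> A \<Longrightarrow> Arg2pi (u e) = Arg2pi (u d) \<Longrightarrow> e = d"
    and R: "\<And>a b c. a \<in> A \<Longrightarrow> b \<in> A \<Longrightarrow> c \<in> A \<Longrightarrow>
      R a b c \<longleftrightarrow> 0 < Arg2pi (u b / u a) \<and> Arg2pi (u b / u a) < Arg2pi (u c / u a)"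
  shows "cyclic_order_on A R"
proof -
  define t where "t = (\<lambda>e. Arg2pi (u e))"
  have tt: "Arg2pi (u e) = t e" for e by (simp add: t_def)
  have t: "0 \<le> t e" "t e < 2 * pi" for e unfolding t_def by (rule Arg2pi_ge_0 Arg2pi_lt_2pi)+
  have Rt: "R a b c \<longleftrightarrow> t a < t b \<and> t b < t c \<or> t b < t c \<and> t c < t a \<or> t c < t a \<and> t a < t b"
    if "a \<in> A" "b \<in> A" "c \<in> A" for a b c
    unfolding R[OF that] Arg2pi_quotient[OF nz[OF that(1)] nz[OF that(2)]] Arg2pi_quotient[OF nz[OF that(1)] nz[OF that(3)]]
      tt
    using t[of a] t[of b] t[of c] by (cases "t a \<le> t b"; cases "t a \<le> t c"; simp; linarith)
  have tinj: "t a = t b \<Longrightarrow> a = b" if "a \<in> A" "b \<in> A" for a b using inj[OF that] by (simp add: t_def)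
  show ?thesis
    unfolding cyclic_order_on_def
  proof (intro conjI ballI impI)
    fix a b c assume abc: "a \<in> A" "b \<in> A" "c \<in> A"
    show "R b c a" if "R a b c"
      using that unfolding Rt[OF abc] Rt[OF abc(2,3,1)] by linarith
    show "\<not> R c b a" if "R a b c"
      using that unfolding Rt[OF abc] Rt[OF abc(3,2,1)] by linarith
    show "R a b d" if "d \<in> A" "R a b c" "R a c d" for d
      using that(2,3) unfolding Rt[OF abc] Rt[OF abc(1,3) that(1)] Rt[OF abc(1,2) that(1)] by linarith
    assume "a \<noteq> b" "b \<noteq> c" "a \<noteq> c"
    then have "t a \<noteq> t b" "t b \<noteq> t c" "t a \<noteq> t c" using tinj abc by blast+
    then show "R a b c \<or> R c b a" unfolding Rt[OF abc] Rt[OF abc(3,2,1)] by linarith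
  qed
qed

context noncritical_segment
begin

abbreviation "tree \<equiv> shabat_tree F c1 c2"

lemma tree_simps [simp]: "black tree = {z. poly F z = c1}" "white tree = {z. poly F z = c2}"
    "edges tree = components E" "incident tree v e \<longleftrightarrow> v \<in> closure e"
  by (simp_all add: shabat_tree_def)

lemma edges_at_tree: "edges_at tree v = {e \<in> components E. v \<in> closure e}"
  by (simp add: edges_at_def)

lemma swap_segment: "open_segment c2 c1 = L"
  by (rule open_segment_commute)

lemma exists_end2:
  assumes e: "e \<in> components E"
  shows "\<exists>v. poly F v = c2 \<and> v \<in> closure e"
proof -
  interpret S: noncritical_segment F c2 c1 by (rule swap)
  show ?thesis using S.exists_end e unfolding swap_segment by blast
qed

lemma unique_end2:
  assumes e: "e \<in> components E" and v: "poly F v = c2" "v \<in> closure e"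
    and v': "poly F v' = c2" "v' \<in> closure e"
  shows "v = v'"
proof -
  interpret S: noncritical_segment F c2 c1 by (rule swap)
  show ?thesis using S.unique_end[OF _ v v'] e unfolding swap_segment by blast
qed

text \<open>An end lies in the closure of its edge but not on the edge, so the limit is taken along
  a nontrivial filter.\<close>

lemma edge_direction_unique:
  assumes e: "e \<in> components E" and v: "v \<in> closure e" "poly F v = c1 \<or> poly F v = c2"
    and u: "edge_direction v e u" "edge_direction v e u'"
  shows "u = u'"
proof -
  have "v \<notin> E" using v(2) by (auto simp: open_segment_def)
  then have "v \<notin> e" using e in_components_subset by blast
  then have "at v within e \<noteq> bot" using v(1) by (simp add: at_within_eq_bot_iff)
  then show ?thesis using u unfolding edge_direction_def by (rule tendsto_unique)
qed

lemma degree_direction: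
  assumes v: "poly F v = c1"
  shows "vertex_degree tree v = order v (F - [:c1:])"
    and "\<exists>dir. inj_on dir (edges_at tree v) \<and> (\<forall>e\<in>edges_at tree v. edge_direction v e (dir e) \<and> norm (dir e) = 1)"
proof -
  obtain q where q: "F - [:c1:] = [:-v, 1:] ^ order v (F - [:c1:]) * q" "poly q v \<noteq> 0"
      "order v (F - [:c1:]) > 0" using order_factor[OF v] by blast
  show "vertex_degree tree v = order v (F - [:c1:])"
    unfolding vertex_degree_def edges_at_tree by (rule vertex_edges(1)[OF v q])
  obtain dir where dir: "inj_on dir {e \<in> components E. v \<in> closure e}"
     "\<And>e. e \<in> components E \<Longrightarrow> v \<in> closure e \<Longrightarrow> edge_direction v e (dir e) \<and>
        dir e ^ order v (F - [:c1:]) = sgn ((c2 - c1) / poly q v)"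
    using vertex_edges(2)[OF v q] by blast
  have "norm (dir e) = 1" if "e \<in> components E" "v \<in> closure e" for e
  proof -
    have "norm (dir e) ^ order v (F - [:c1:]) = 1"
      using dir(2)[OF that] neq q(2) by (simp add: norm_sgn norm_divide flip: norm_power)
    then show ?thesis using q(3) power_eq_iff_eq_base[of "order v (F - [:c1:])" "norm (dir e)" 1] by simp
  qed
  then show "\<exists>dir. inj_on dir (edges_at tree v) \<and> (\<forall>e\<in>edges_at tree v. edge_direction v e (dir e) \<and> norm (dir e) = 1)"
    unfolding edges_at_tree using dir by (intro exI[of _ dir]) auto
qed

lemma degree_direction2:
  assumes v: "poly F v = c2"
  shows "vertex_degree tree v = order v (F - [:c2:])"
    and "\<exists>dir. inj_on dir (edges_at tree v) \<and> (\<forall>e\<in>edges_at tree v. edge_direction v e (dir e) \<and> norm (dir e) = 1)"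
proof -
  interpret S: noncritical_segment F c2 c1 by (rule swap)
  have eq: "edges_at S.tree v = edges_at tree v"
    unfolding S.edges_at_tree edges_at_tree swap_segment ..
  show "vertex_degree tree v = order v (F - [:c2:])"
    using S.degree_direction(1)[OF v] unfolding vertex_degree_def eq .
  show "\<exists>dir. inj_on dir (edges_at tree v) \<and> (\<forall>e\<in>edges_at tree v. edge_direction v e (dir e) \<and> norm (dir e) = 1)"
    using S.degree_direction(2)[OF v] unfolding eq .
qed

lemma tree_ccw:
  assumes v: "poly F v = c1 \<or> poly F v = c2"
    and dir: "\<And>e. e \<in> edges_at tree v \<Longrightarrow> edge_direction v e (dir e)"
    and e: "a \<in> edges_at tree v" "b \<in> edges_at tree v" "c \<in> edges_at tree v"
  shows "ccw tree v a b c \<longleftrightarrow> 0 < Arg2pi (dir b / dir a) \<and> Arg2pi (dir b / dir a) < Arg2pi (dir c / dir a)"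
proof -
  have u: "edge_direction v e u \<longleftrightarrow> u = dir e" if "e \<in> edges_at tree v" for e u
    using edge_direction_unique[of e v u "dir e"] that dir[OF that] v unfolding edges_at_tree by blast
  show ?thesis by (simp add: shabat_tree_def u[OF e(1)] u[OF e(2)] u[OF e(3)])
qed

text \<open>Ends, finiteness and cyclic orders are available for every such \<open>F\<close>. What
  depends on the polynomial is connectedness and the number of vertices, which must exceed the
  number \<open>degree F\<close> of edges by one.\<close>

lemma plane_tree:
  assumes con: "\<And>x y. x \<in> vertices tree \<Longrightarrow> y \<in> vertices tree \<Longrightarrow> (x, y) \<in> (adjacency tree)\<^sup>*"
    and card: "card {z. poly F z = c1} + card {z. poly F z = c2} = degree F + 1"
  shows "bicolored_plane_tree tree"
  unfolding bicolored_plane_tree_def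
proof (intro conjI ballI)
  show "finite (black tree)" "finite (white tree)" unfolding tree_simps by (rule finite_fibre)+
  show "finite (edges tree)" unfolding tree_simps by (rule card_edges)
  show "black tree \<inter> white tree = {}" unfolding tree_simps using neq by blast
  show "\<exists>!b. b \<in> black tree \<and> incident tree b e" if "e \<in> edges tree" for e
    unfolding tree_simps mem_Collect_eq
  proof (rule ex_ex1I)
    show "\<exists>v. poly F v = c1 \<and> v \<in> closure e" using that exists_end by simp
    show "v = w" if "poly F v = c1 \<and> v \<in> closure e" "poly F w = c1 \<and> w \<in> closure e" for v w
      using unique_end[of e v w] that \<open>e \<in> edges tree\<close> by simp
  qed
  show "\<exists>!b. b \<in> white tree \<and> incident tree b e" if "e \<in> edges tree" for e
    unfolding tree_simps mem_Collect_eq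
  proof (rule ex_ex1I)
    show "\<exists>v. poly F v = c2 \<and> v \<in> closure e" using that exists_end2 by simp
    show "v = w" if "poly F v = c2 \<and> v \<in> closure e" "poly F w = c2 \<and> w \<in> closure e" for v w
      using unique_end2[of e v w] that \<open>e \<in> edges tree\<close> by simp
  qed
  show "(x, y) \<in> (adjacency tree)\<^sup>*" if "x \<in> vertices tree" "y \<in> vertices tree" for x y
    using con that .
  have "card (vertices tree) = card {z. poly F z = c1} + card {z. poly F z = c2}"
    unfolding vertices_def tree_simps using finite_fibre neq by (intro card_Un_disjoint) auto
  then show "card (vertices tree) = card (edges tree) + 1" using card card_edges by simp
  fix v assume "v \<in> vertices tree"
  then have v: "poly F v = c1 \<or> poly F v = c2" by (auto simp: vertices_def)
  obtain dir where dir: "inj_on dir (edges_at tree v)"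
      "\<And>e. e \<in> edges_at tree v \<Longrightarrow> edge_direction v e (dir e)" "\<And>e. e \<in> edges_at tree v \<Longrightarrow> norm (dir e) = 1"
    using degree_direction(2)[of v] degree_direction2(2)[of v] v by blast
  show "cyclic_order_on (edges_at tree v) (ccw tree v)"
  proof (rule cyclic_order_by_argument[of _ dir])
    show "dir e \<noteq> 0" if "e \<in> edges_at tree v" for e using dir(3)[OF that] by auto
    show "ccw tree v a b c \<longleftrightarrow> 0 < Arg2pi (dir b / dir a) \<and> Arg2pi (dir b / dir a) < Arg2pi (dir c / dir a)"
      if "a \<in> edges_at tree v" "b \<in> edges_at tree v" "c \<in> edges_at tree v" for a b c
      using tree_ccw[OF v dir(2) that] .
    show "e = d" if e: "e \<in> edges_at tree v" "d \<in> edges_at tree v" and eq: "Arg2pi (dir e) = Arg2pi (dir d)" for e d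
    proof -
      have "dir e = dir d"
        using Arg2pi_eq[of "dir e"] Arg2pi_eq[of "dir d"] dir(3)[OF e(1)] dir(3)[OF e(2)] eq by simp
      then show ?thesis using inj_onD[OF dir(1) _ e] by simp
    qed
  qed
qed

end

section \<open>Trees with the given passport\<close>

definition cyclic3 :: "nat \<Rightarrow> nat \<Rightarrow> nat \<Rightarrow> bool" where
  "cyclic3 i j k \<longleftrightarrow> i < j \<and> j < k \<or> j < k \<and> k < i \<or> k < i \<and> i < j"

text \<open>The position of \<open>e\<close> when counting from \<open>e0\<close>. It is one more
  than the number of elements strictly between the two, so the second middle edge of a spine,
  counted from the first, has rank gap plus one.\<close>

definition cyclic_rank :: "'e set \<Rightarrow> ('e \<Rightarrow> 'e \<Rightarrow> 'e \<Rightarrow> bool) \<Rightarrow> 'e \<Rightarrow> 'e \<Rightarrow> nat" where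
  "cyclic_rank A R e0 e = (if e = e0 then 0 else Suc (card {x \<in> A. R e0 x e}))"

lemma cyclic_order_rotate:
  "cyclic_order_on A R \<Longrightarrow> a \<in> A \<Longrightarrow> b \<in> A \<Longrightarrow> c \<in> A \<Longrightarrow> R a b c \<Longrightarrow> R b c a"
  unfolding cyclic_order_on_def by meson

lemma cyclic_order_asym:
  "cyclic_order_on A R \<Longrightarrow> a \<in> A \<Longrightarrow> b \<in> A \<Longrightarrow> c \<in> A \<Longrightarrow> R a b c \<Longrightarrow> \<not> R c b a"
  unfolding cyclic_order_on_def by meson

lemma cyclic_order_trans:
  "cyclic_order_on A R \<Longrightarrow> a \<in> A \<Longrightarrow> b \<in> A \<Longrightarrow> c \<in> A \<Longrightarrow> d \<in> A \<Longrightarrow> R a b c \<Longrightarrow> R a c d \<Longrightarrow> R a b d"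
  unfolding cyclic_order_on_def by meson

lemma cyclic_order_total:
  "cyclic_order_on A R \<Longrightarrow> a \<in> A \<Longrightarrow> b \<in> A \<Longrightarrow> c \<in> A \<Longrightarrow> a \<noteq> b \<Longrightarrow> b \<noteq> c \<Longrightarrow> a \<noteq> c \<Longrightarrow> R a b c \<or> R c b a"
  unfolding cyclic_order_on_def by meson

lemma cyclic_order_distinct:
  assumes "cyclic_order_on A R" "a \<in> A" "b \<in> A" "c \<in> A" "R a b c"
  shows "a \<noteq> b" "b \<noteq> c" "a \<noteq> c"
proof -
  note rot = cyclic_order_rotate[OF assms(1)] and asym = cyclic_order_asym[OF assms(1-5)]
  show "a \<noteq> b"
  proof
    assume "a = b"
    then have "R c b a" using rot[OF assms(2,4,2) rot[OF assms(2,2,4)]] assms(5) by simp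
    then show False using asym by simp
  qed
  show "b \<noteq> c"
  proof
    assume "b = c"
    then have "R c b a" using rot[OF assms(2,3,3)] assms(5) by simp
    then show False using asym by simp
  qed
  show "a \<noteq> c" using asym assms(5) by auto
qed

text \<open>Cutting the circle at \<open>e0\<close> leaves a linear order on the other elements, and
  the rank counts predecessors in it. It suffices to recover \<open>R\<close> from the ranks: of a
  triple of distinct elements and its reversal, one is related by \<open>cyclic3\<close>, and
  \<open>R\<close> cannot hold for both.\<close>

lemma cyclic_rank:
  assumes R: "cyclic_order_on A R" and A: "finite A" "e0 \<in> A"
  shows "bij_betw (cyclic_rank A R e0) A {..<card A}"
    and "\<And>a b c. a \<in> A \<Longrightarrow> b \<in> A \<Longrightarrow> c \<in> A \<Longrightarrow>
      R a b c \<longleftrightarrow> cyclic3 (cyclic_rank A R e0 a) (cyclic_rank A R e0 b) (cyclic_rank A R e0 c)"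
proof -
  let ?r = "cyclic_rank A R e0"
  note rot = cyclic_order_rotate[OF R] and asym = cyclic_order_asym[OF R]
    and tr = cyclic_order_trans[OF R] and tot = cyclic_order_total[OF R] and dst = cyclic_order_distinct[OF R]
  have r0: "?r e0 = 0" by (simp add: cyclic_rank_def)
  have rpos: "?r a > 0" if "a \<noteq> e0" for a using that by (simp add: cyclic_rank_def)
  have mono: "?r a < ?r b" if "a \<in> A" "b \<in> A" "R e0 a b" for a b
  proof -
    have ne: "a \<noteq> e0" "b \<noteq> e0" using dst[OF A(2) that] by auto
    have "{x \<in> A. R e0 x a} \<subseteq> {x \<in> A. R e0 x b}" using tr[OF A(2) _ that(1,2) _ that(3)] by blast
    moreover have "a \<in> {x \<in> A. R e0 x b}" "a \<notin> {x \<in> A. R e0 x a}" using that dst(2)[OF A(2) that(1,1)] by auto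
    ultimately have "{x \<in> A. R e0 x a} \<subset> {x \<in> A. R e0 x b}" by blast
    then show ?thesis using ne A(1) by (simp add: cyclic_rank_def psubset_card_mono)
  qed
  have less: "?r a < ?r b \<longleftrightarrow> R e0 a b" if "a \<in> A" "b \<in> A" "a \<noteq> e0" "b \<noteq> e0" for a b
  proof (cases "a = b")
    case True
    then show ?thesis using dst(2)[OF A(2) that(1,1)] by auto
  next
    case False
    then have "R e0 a b \<or> R b a e0" using tot[OF A(2) that(1,2)] that by auto
    then have "R e0 a b \<or> R e0 b a" using rot[OF that(2,1) A(2)] rot[OF that(1) A(2) that(2)] by blast
    then show ?thesis using mono[OF that(1,2)] mono[OF that(2,1)] by fastforce
  qed
  have inj: "inj_on ?r A"
  proof (rule inj_onI)
    fix a b assume ab: "a \<in> A" "b \<in> A" "?r a = ?r b"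
    show "a = b"
    proof (rule ccontr)
      assume "a \<noteq> b"
      moreover have "a \<noteq> e0" "b \<noteq> e0" using ab(3) r0 rpos \<open>a \<noteq> b\<close> by (metis less_irrefl)+
      ultimately have "R e0 a b \<or> R b a e0" using tot[OF A(2) ab(1,2)] by auto
      then have "R e0 a b \<or> R e0 b a" using rot[OF ab(2,1) A(2)] rot[OF ab(1) A(2) ab(2)] by blast
      then show False using mono[OF ab(1,2)] mono[OF ab(2,1)] ab(3) by auto
    qed
  qed
  have "?r ` A \<subseteq> {..<card A}"
  proof (rule image_subsetI)
    fix a assume a: "a \<in> A"
    have "?r a < card A"
    proof (cases "a = e0")
      case True
      then show ?thesis using A r0 card_gt_0_iff by auto
    next
      case False
      have sub: "{x \<in> A. R e0 x a} \<subseteq> A - {e0, a}"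
        using dst[OF A(2) _ a] by auto
      have "card {x \<in> A. R e0 x a} \<le> card (A - {e0, a})" by (rule card_mono[OF _ sub]) (use A in auto)
      also have "\<dots> = card A - 2" using A a False by (subst card_Diff_subset) auto
      finally have "card {x \<in> A. R e0 x a} \<le> card A - 2" .
      moreover have "card {e0, a} \<le> card A" by (rule card_mono) (use A a in auto)
      ultimately show ?thesis using False by (simp add: cyclic_rank_def)
    qed
    then show "?r a \<in> {..<card A}" by simp
  qed
  then have "?r ` A = {..<card A}" using card_image[OF inj] by (intro card_subset_eq) auto
  then show "bij_betw ?r A {..<card A}" using inj by (simp add: bij_betw_def)
  fix a b c assume abc: "a \<in> A" "b \<in> A" "c \<in> A"
  have *: "R x y z" if xyz: "x \<in> A" "y \<in> A" "z \<in> A" and lt: "?r x < ?r y" "?r y < ?r z" for x y z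
  proof (cases "x = e0")
    case True
    have "y \<noteq> e0" "z \<noteq> e0" using lt r0 by auto
    then show ?thesis using less[OF xyz(2,3)] lt True by simp
  next
    case False
    have ne: "y \<noteq> e0" "z \<noteq> e0" using lt r0 by auto
    have 1: "R e0 x y" "R e0 y z" using less[OF xyz(1,2)] less[OF xyz(2,3)] lt ne False by auto
    have 2: "R y z e0" "R y e0 x" using rot[OF A(2) xyz(2,3) 1(2)] rot[OF xyz(1,2) A(2) rot[OF A(2) xyz(1,2) 1(1)]] by auto
    have "R y z x" by (rule tr[OF xyz(2,3) A(2) xyz(1) 2])
    then show ?thesis using rot xyz by blast
  qed
  have conv: "R x y z" if c: "cyclic3 (?r x) (?r y) (?r z)" and xyz: "x \<in> A" "y \<in> A" "z \<in> A" for x y z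
    using c unfolding cyclic3_def
  proof (elim disjE conjE)
    assume "?r x < ?r y" "?r y < ?r z"
    then show ?thesis by (rule *[OF xyz])
  next
    assume "?r y < ?r z" "?r z < ?r x"
    then have "R y z x" by (rule *[OF xyz(2,3,1)])
    then show ?thesis using rot xyz by meson
  next
    assume "?r z < ?r x" "?r x < ?r y"
    then have "R z x y" by (rule *[OF xyz(3,1,2)])
    then show ?thesis using rot xyz by meson
  qed
  show "R a b c \<longleftrightarrow> cyclic3 (?r a) (?r b) (?r c)"
  proof
    assume "cyclic3 (?r a) (?r b) (?r c)"
    then show "R a b c" by (rule conv[OF _ abc])
  next
    assume Rabc: "R a b c"
    then have "a \<noteq> b" "b \<noteq> c" "a \<noteq> c" using dst[OF abc] by auto
    then have ne: "?r a \<noteq> ?r b" "?r b \<noteq> ?r c" "?r a \<noteq> ?r c" using inj abc by (auto dest: inj_onD)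
    show "cyclic3 (?r a) (?r b) (?r c)"
    proof (rule ccontr)
      assume "\<not> cyclic3 (?r a) (?r b) (?r c)"
      then have "cyclic3 (?r c) (?r b) (?r a)" using ne unfolding cyclic3_def by linarith
      then have "R c b a" by (rule conv[OF _ abc(3,2,1)])
      then show False using asym[OF abc Rabc] by blast
    qed
  qed
qed

section \<open>Trees described through their edges\<close>

lemma count_image_mset_set:
  "finite A \<Longrightarrow> count (image_mset f (mset_set A)) x = card {a \<in> A. f a = x}"
proof (induction A rule: finite_induct)
  case (insert a A)
  have "{b \<in> insert a A. f b = x} = (if f a = x then insert a {b \<in> A. f b = x} else {b \<in> A. f b = x})"
    by auto
  then show ?case using insert by simp
qed simp

definition end_black :: "('v, 'e) bicolored_map \<Rightarrow> 'e \<Rightarrow> 'v" where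
  "end_black T e = (THE b. b \<in> black T \<and> incident T b e)"

definition end_white :: "('v, 'e) bicolored_map \<Rightarrow> 'e \<Rightarrow> 'v" where
  "end_white T e = (THE w. w \<in> white T \<and> incident T w e)"

locale bicolored_tree =
  fixes T :: "('v, 'e) bicolored_map"
  assumes tree: "bicolored_plane_tree T"
begin

lemma fin: "finite (black T)" "finite (white T)" "finite (edges T)" "black T \<inter> white T = {}"
  using tree unfolding bicolored_plane_tree_def by simp_all

lemma ex1_ends: "\<forall>e \<in> edges T. (\<exists>!b. b \<in> black T \<and> incident T b e) \<and> (\<exists>!w. w \<in> white T \<and> incident T w e)"
  and connected: "\<forall>x \<in> vertices T. \<forall>y \<in> vertices T. (x, y) \<in> (adjacency T)\<^sup>*"
  and cyclic: "\<forall>v \<in> vertices T. cyclic_order_on (edges_at T v) (ccw T v)"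
  using tree unfolding bicolored_plane_tree_def by meson+

lemma end_black: "e \<in> edges T \<Longrightarrow> end_black T e \<in> black T" "e \<in> edges T \<Longrightarrow> incident T (end_black T e) e"
  and end_black_unique: "e \<in> edges T \<Longrightarrow> b \<in> black T \<Longrightarrow> incident T b e \<longleftrightarrow> end_black T e = b"
proof -
  have ex: "\<exists>!b. b \<in> black T \<and> incident T b e" if "e \<in> edges T" for e
    using ex1_ends that by blast
  have *: "end_black T e \<in> black T \<and> incident T (end_black T e) e" if "e \<in> edges T" for e
    unfolding end_black_def by (rule theI'[OF ex[OF that]])
  then show "e \<in> edges T \<Longrightarrow> end_black T e \<in> black T" "e \<in> edges T \<Longrightarrow> incident T (end_black T e) e" by auto
  show "incident T b e \<longleftrightarrow> end_black T e = b" if "e \<in> edges T" "b \<in> black T"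
    using *[OF that(1)] ex[OF that(1)] that(2) by blast
qed

lemma end_white: "e \<in> edges T \<Longrightarrow> end_white T e \<in> white T" "e \<in> edges T \<Longrightarrow> incident T (end_white T e) e"
  and end_white_unique: "e \<in> edges T \<Longrightarrow> w \<in> white T \<Longrightarrow> incident T w e \<longleftrightarrow> end_white T e = w"
proof -
  have ex: "\<exists>!b. b \<in> white T \<and> incident T b e" if "e \<in> edges T" for e
    using ex1_ends that by blast
  have *: "end_white T e \<in> white T \<and> incident T (end_white T e) e" if "e \<in> edges T" for e
    unfolding end_white_def by (rule theI'[OF ex[OF that]])
  then show "e \<in> edges T \<Longrightarrow> end_white T e \<in> white T" "e \<in> edges T \<Longrightarrow> incident T (end_white T e) e" by auto
  show "incident T w e \<longleftrightarrow> end_white T e = w" if "e \<in> edges T" "w \<in> white T"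
    using *[OF that(1)] ex[OF that(1)] that(2) by blast
qed

lemma edges_at_black: "b \<in> black T \<Longrightarrow> edges_at T b = {e \<in> edges T. end_black T e = b}"
  using end_black_unique by (auto simp: edges_at_def)

lemma edges_at_white: "w \<in> white T \<Longrightarrow> edges_at T w = {e \<in> edges T. end_white T e = w}"
  using end_white_unique by (auto simp: edges_at_def)

lemma finite_edges_at: "finite (edges_at T v)"
  using fin(3) by (simp add: edges_at_def)

lemma cyclic_at: "v \<in> vertices T \<Longrightarrow> cyclic_order_on (edges_at T v) (ccw T v)"
  using cyclic by blast

text \<open>The form in which connectedness is used: a configuration is refuted by exhibiting a
  proper set of vertices that no edge leaves.\<close>

lemma connected_closed:
  assumes S: "v \<in> S" "v \<in> vertices T" and cl: "\<And>e. e \<in> edges T \<Longrightarrow> end_black T e \<in> S \<longleftrightarrow> end_white T e \<in> S"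
  shows "vertices T \<subseteq> S"
proof
  fix u assume u: "u \<in> vertices T"
  have "(v, u) \<in> (adjacency T)\<^sup>*" using connected u S(2) by blast
  then show "u \<in> S"
  proof (induction rule: rtrancl_induct)
    case base then show ?case using S by simp
  next
    case (step y z)
    then obtain e where e: "e \<in> edges T" "incident T y e" "incident T z e" "y \<in> vertices T" "z \<in> vertices T"
      by (auto simp: adjacency_def)
    have "x \<in> S \<longleftrightarrow> end_black T e \<in> S" if "x \<in> vertices T" "incident T x e" for x
      using that end_black_unique[OF e(1), of x] end_white_unique[OF e(1), of x] cl[OF e(1)]
      by (auto simp: vertices_def)
    then show ?case using step.IH e by blast
  qed
qed

end

text \<open>Without isolated vertices, a vertex amounts to the class of edges that end there. A
  bijection of the edges that respects these classes therefore carries the vertices along.\<close>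

lemma plane_isomorphic_if_edge_map:
  fixes T :: "('v, 'e) bicolored_map" and U :: "('w, 'f) bicolored_map"
  assumes T: "bicolored_plane_tree T" and U: "bicolored_plane_tree U"
    and deg: "\<And>v. v \<in> vertices T \<Longrightarrow> edges_at T v \<noteq> {}" "\<And>v. v \<in> vertices U \<Longrightarrow> edges_at U v \<noteq> {}"
    and g: "bij_betw g (edges T) (edges U)"
    and b: "\<And>e e'. e \<in> edges T \<Longrightarrow> e' \<in> edges T \<Longrightarrow>
        end_black U (g e) = end_black U (g e') \<longleftrightarrow> end_black T e = end_black T e'"
    and w: "\<And>e e'. e \<in> edges T \<Longrightarrow> e' \<in> edges T \<Longrightarrow>
        end_white U (g e) = end_white U (g e') \<longleftrightarrow> end_white T e = end_white T e'"
    and cb: "\<And>v e1 e2 e3. v \<in> black T \<Longrightarrow> e1 \<in> edges_at T v \<Longrightarrow> e2 \<in> edges_at T v \<Longrightarrow> e3 \<in> edges_at T v \<Longrightarrow>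
        ccw U (end_black U (g e1)) (g e1) (g e2) (g e3) \<longleftrightarrow> ccw T v e1 e2 e3"
    and cw: "\<And>v e1 e2 e3. v \<in> white T \<Longrightarrow> e1 \<in> edges_at T v \<Longrightarrow> e2 \<in> edges_at T v \<Longrightarrow> e3 \<in> edges_at T v \<Longrightarrow>
        ccw U (end_white U (g e1)) (g e1) (g e2) (g e3) \<longleftrightarrow> ccw T v e1 e2 e3"
  shows "plane_isomorphic T U"
proof -
  interpret T: bicolored_tree T by unfold_locales fact
  interpret U: bicolored_tree U by unfold_locales fact
  define pick where "pick = (\<lambda>v. SOME e. e \<in> edges_at T v)"
  have pick: "pick v \<in> edges_at T v" if "v \<in> vertices T" for v
    using deg(1)[OF that] unfolding pick_def some_in_eq .
  define f where "f = (\<lambda>v. if v \<in> black T then end_black U (g (pick v)) else end_white U (g (pick v)))"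
  have gE: "g e \<in> edges U" if "e \<in> edges T" for e using g that by (auto simp: bij_betw_def)
  have fb: "f (end_black T e) = end_black U (g e)" if e: "e \<in> edges T" for e
  proof -
    have v: "end_black T e \<in> black T" by (rule T.end_black(1)[OF e])
    have p: "pick (end_black T e) \<in> edges T" "end_black T (pick (end_black T e)) = end_black T e"
      using pick[of "end_black T e"] T.edges_at_black[OF v] v by (auto simp: vertices_def)
    then show ?thesis using b[OF p(1) e] v by (simp add: f_def)
  qed
  have fw: "f (end_white T e) = end_white U (g e)" if e: "e \<in> edges T" for e
  proof -
    have v: "end_white T e \<in> white T" by (rule T.end_white(1)[OF e])
    then have nb: "end_white T e \<notin> black T" using T.fin(4) by blast
    have p: "pick (end_white T e) \<in> edges T" "end_white T (pick (end_white T e)) = end_white T e"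
      using pick[of "end_white T e"] T.edges_at_white[OF v] v by (auto simp: vertices_def)
    then show ?thesis using w[OF p(1) e] nb by (simp add: f_def)
  qed
  have exb: "\<exists>e\<in>edges T. end_black T e = v" if "v \<in> black T" for v
    using deg(1)[of v] T.edges_at_black[OF that] that by (auto simp: vertices_def)
  have exw: "\<exists>e\<in>edges T. end_white T e = v" if "v \<in> white T" for v
    using deg(1)[of v] T.edges_at_white[OF that] that by (auto simp: vertices_def)
  have exbU: "\<exists>e\<in>edges T. end_black U (g e) = v" if "v \<in> black U" for v
  proof -
    have "\<exists>e'\<in>g ` edges T. end_black U e' = v"
      using deg(2)[of v] U.edges_at_black[OF that] that bij_betw_imp_surj_on[OF g] by (auto simp: vertices_def)
    then show ?thesis by blast
  qed
  have exwU: "\<exists>e\<in>edges T. end_white U (g e) = v" if "v \<in> white U" for v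
  proof -
    have "\<exists>e'\<in>g ` edges T. end_white U e' = v"
      using deg(2)[of v] U.edges_at_white[OF that] that bij_betw_imp_surj_on[OF g] by (auto simp: vertices_def)
    then show ?thesis by blast
  qed
  have bijb: "bij_betw f (black T) (black U)"
    unfolding bij_betw_def
  proof
    show "inj_on f (black T)"
    proof (rule inj_onI)
      fix x y assume "x \<in> black T" "y \<in> black T" "f x = f y"
      moreover obtain e e' where "e \<in> edges T" "end_black T e = x" "e' \<in> edges T" "end_black T e' = y"
        using exb calculation by meson
      ultimately show "x = y" using fb b by metis
    qed
    show "f ` black T = black U"
    proof
      show "f ` black T \<subseteq> black U"
      proof (rule image_subsetI)
        fix x assume "x \<in> black T"
        then obtain e where "e \<in> edges T" "end_black T e = x" using exb by blast
        then show "f x \<in> black U" using fb U.end_black(1)[OF gE] by metis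
      qed
      show "black U \<subseteq> f ` black T"
      proof
        fix v assume "v \<in> black U"
        then obtain e where "e \<in> edges T" "end_black U (g e) = v" using exbU by blast
        then show "v \<in> f ` black T" using fb T.end_black(1) by (metis imageI)
      qed
    qed
  qed
  have bijw: "bij_betw f (white T) (white U)"
    unfolding bij_betw_def
  proof
    show "inj_on f (white T)"
    proof (rule inj_onI)
      fix x y assume "x \<in> white T" "y \<in> white T" "f x = f y"
      moreover obtain e e' where "e \<in> edges T" "end_white T e = x" "e' \<in> edges T" "end_white T e' = y"
        using exw calculation by meson
      ultimately show "x = y" using fw w by metis
    qed
    show "f ` white T = white U"
    proof
      show "f ` white T \<subseteq> white U"
      proof (rule image_subsetI)
        fix x assume "x \<in> white T"
        then obtain e where "e \<in> edges T" "end_white T e = x" using exw by blast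
        then show "f x \<in> white U" using fw U.end_white(1)[OF gE] by metis
      qed
      show "white U \<subseteq> f ` white T"
      proof
        fix v assume "v \<in> white U"
        then obtain e where "e \<in> edges T" "end_white U (g e) = v" using exwU by blast
        then show "v \<in> f ` white T" using fw T.end_white(1) by (metis imageI)
      qed
    qed
  qed
  have inc: "incident U (f v) (g e) \<longleftrightarrow> incident T v e" if v: "v \<in> vertices T" and e: "e \<in> edges T" for v e
  proof (cases "v \<in> black T")
    case True
    obtain e' where e': "e' \<in> edges T" "end_black T e' = v" using exb True by blast
    have "f v \<in> black U" using bijb True by (auto simp: bij_betw_def)
    then have "incident U (f v) (g e) \<longleftrightarrow> end_black U (g e) = end_black U (g e')"
      using U.end_black_unique[OF gE[OF e]] fb[OF e'(1)] e'(2) by simp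
    also have "\<dots> \<longleftrightarrow> end_black T e = v" using b[OF e e'(1)] e'(2) by simp
    finally show ?thesis using T.end_black_unique[OF e True] by simp
  next
    case False
    then have W: "v \<in> white T" using v by (simp add: vertices_def)
    obtain e' where e': "e' \<in> edges T" "end_white T e' = v" using exw W by blast
    have "f v \<in> white U" using bijw W by (auto simp: bij_betw_def)
    then have "incident U (f v) (g e) \<longleftrightarrow> end_white U (g e) = end_white U (g e')"
      using U.end_white_unique[OF gE[OF e]] fw[OF e'(1)] e'(2) by simp
    also have "\<dots> \<longleftrightarrow> end_white T e = v" using w[OF e e'(1)] e'(2) by simp
    finally show ?thesis using T.end_white_unique[OF e W] by simp
  qed
  have ord: "ccw U (f v) (g e1) (g e2) (g e3) \<longleftrightarrow> ccw T v e1 e2 e3"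
    if v: "v \<in> vertices T" and e: "e1 \<in> edges_at T v" "e2 \<in> edges_at T v" "e3 \<in> edges_at T v" for v e1 e2 e3
  proof (cases "v \<in> black T")
    case True
    have "e1 \<in> edges T" "end_black T e1 = v" using e(1) T.edges_at_black[OF True] by auto
    then have "f v = end_black U (g e1)" using fb by metis
    then show ?thesis using cb[OF True e] by simp
  next
    case False
    then have W: "v \<in> white T" using v by (simp add: vertices_def)
    have "e1 \<in> edges T" "end_white T e1 = v" using e(1) T.edges_at_white[OF W] by auto
    then have "f v = end_white U (g e1)" using fw by metis
    then show ?thesis using cw[OF W e] by simp
  qed
  show ?thesis unfolding plane_isomorphic_def using bijb bijw g inc ord by blast
qed

section \<open>The structure forced by the passport\<close>

locale pp_tree = bicolored_tree T for T :: "('v, 'e) bicolored_map" +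
  assumes pp: "passport T = (replicate_mset 3 5 + replicate_mset 11 1, replicate_mset 13 2, 26)"
begin

abbreviation "bl \<equiv> end_black T"
abbreviation "wh \<equiv> end_white T"

definition "leaf_edges = {e \<in> edges T. vertex_degree T (bl e) = 1}"
definition "big_edges = {e \<in> edges T. vertex_degree T (bl e) = 5}"
text \<open>The white vertices both of whose edges lead to black vertices of degree 5. Only these
  can connect the three vertices of degree 5 with each other.\<close>

definition "special = white T - wh ` leaf_edges"

lemma card_edges: "card (edges T) = 26"
  using pp by (simp add: passport_def)

lemma black_degree_count: "card {b \<in> black T. vertex_degree T b = d} =
    (if d = 5 then 3 else if d = 1 then 11 else 0)"
proof -
  have "image_mset (vertex_degree T) (mset_set (black T)) = replicate_mset 3 5 + replicate_mset 11 1"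
    using pp by (simp add: passport_def)
  then have "card {b \<in> black T. vertex_degree T b = d} = count (replicate_mset 3 5 + replicate_mset 11 1) d"
    using count_image_mset_set[OF fin(1)] by metis
  then show ?thesis by simp
qed

lemma black_degree: "b \<in> black T \<Longrightarrow> vertex_degree T b = 5 \<or> vertex_degree T b = 1"
proof (rule ccontr)
  assume b: "b \<in> black T" and "\<not> (vertex_degree T b = 5 \<or> vertex_degree T b = 1)"
  then have "card {b' \<in> black T. vertex_degree T b' = vertex_degree T b} = 0"
    by (subst black_degree_count) simp
  then show False using b fin(1) by auto
qed

lemma white_mset: "image_mset (vertex_degree T) (mset_set (white T)) = replicate_mset 13 2"
  using pp by (simp add: passport_def)

lemma white_degree: "w \<in> white T \<Longrightarrow> vertex_degree T w = 2"
proof -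
  assume "w \<in> white T"
  then have "vertex_degree T w \<in># image_mset (vertex_degree T) (mset_set (white T))"
    using fin(2) by simp
  then show ?thesis unfolding white_mset by simp
qed

lemma card_white: "card (white T) = 13"
  using arg_cong[OF white_mset, of size] by simp

lemma edges_at_nonempty: "v \<in> vertices T \<Longrightarrow> edges_at T v \<noteq> {}"
  using black_degree[of v] white_degree[of v] by (auto simp: vertices_def vertex_degree_def)

lemma edge_cases: "e \<in> edges T \<Longrightarrow> e \<in> leaf_edges \<longleftrightarrow> e \<notin> big_edges"
  using black_degree[OF end_black(1)] by (auto simp: leaf_edges_def big_edges_def)

lemma leaf_edges_sub: "leaf_edges \<subseteq> edges T" and big_edges_sub: "big_edges \<subseteq> edges T"
  by (auto simp: leaf_edges_def big_edges_def)

lemma edges_at_bl: "e \<in> edges T \<Longrightarrow> edges_at T (bl e) = {d \<in> edges T. bl d = bl e}"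
  using edges_at_black[OF end_black(1)] by simp

lemma edges_at_wh: "e \<in> edges T \<Longrightarrow> edges_at T (wh e) = {d \<in> edges T. wh d = wh e}"
  using edges_at_white[OF end_white(1)] by simp

lemma leaf_edge_unique:
  assumes e: "e \<in> leaf_edges" and d: "d \<in> edges T" "bl d = bl e"
  shows "d = e"
proof -
  have "card (edges_at T (bl e)) = 1" using e by (simp add: leaf_edges_def vertex_degree_def)
  then obtain z where "edges_at T (bl e) = {z}" by (auto simp: card_1_singleton_iff)
  moreover have "e \<in> edges_at T (bl e)" "d \<in> edges_at T (bl e)"
    using e d edges_at_bl[of e] by (auto simp: leaf_edges_def)
  ultimately show ?thesis by simp
qed

lemma white_two:
  assumes "a \<in> edges T" "b \<in> edges T" "wh a = wh b" "a \<noteq> b" "d \<in> edges T" "wh d = wh a"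
  shows "d = a \<or> d = b"
proof -
  have "card (edges_at T (wh a)) = 2"
    using white_degree[OF end_white(1)[OF assms(1)]] by (simp add: vertex_degree_def)
  moreover have "{a, b, d} \<subseteq> edges_at T (wh a)" using edges_at_wh[OF assms(1)] assms by auto
  ultimately have "card {a, b, d} \<le> 2" using card_mono[OF finite_edges_at] by metis
  then show ?thesis using assms(4) by (auto simp: card_insert_if split: if_splits)
qed

lemma white_other:
  assumes "a \<in> edges T"
  obtains b where "b \<in> edges T" "b \<noteq> a" "wh b = wh a"
proof -
  have "card (edges_at T (wh a)) = 2"
    using white_degree[OF end_white(1)[OF assms(1)]] by (simp add: vertex_degree_def)
  then have "\<not> edges_at T (wh a) \<subseteq> {a}" using card_mono[of "{a}" "edges_at T (wh a)"] by auto
  then show thesis using that edges_at_wh[OF assms] by auto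
qed

lemma card_vertices: "card (vertices T) = 27"
  using tree card_edges unfolding bicolored_plane_tree_def by simp

lemma bl_neq_wh: "e \<in> edges T \<Longrightarrow> d \<in> edges T \<Longrightarrow> bl e \<noteq> wh d"
proof
  assume "e \<in> edges T" "d \<in> edges T" "bl e = wh d"
  then have "bl e \<in> black T" "bl e \<in> white T" using end_black(1) end_white(1) by metis+
  then show False using fin(4) by blast
qed

text \<open>Two leaves at the same white vertex, which has degree 2, would form with it a component
  of three vertices.\<close>

lemma inj_wh_leaf: "inj_on wh leaf_edges"
proof (rule inj_onI, rule ccontr)
  fix e e' assume e: "e \<in> leaf_edges" "e' \<in> leaf_edges" "wh e = wh e'" "e \<noteq> e'"
  have E: "e \<in> edges T" "e' \<in> edges T" using e leaf_edges_sub by auto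
  let ?S = "{wh e, bl e, bl e'}"
  have "vertices T \<subseteq> ?S"
  proof (rule connected_closed)
    show "bl e \<in> ?S" by simp
    show "bl e \<in> vertices T" using end_black(1)[OF E(1)] by (simp add: vertices_def)
    fix d assume d: "d \<in> edges T"
    have ne: "bl d \<noteq> wh e" "bl e \<noteq> wh d" "bl e' \<noteq> wh d"
      using bl_neq_wh d E by auto
    show "bl d \<in> ?S \<longleftrightarrow> wh d \<in> ?S"
    proof
      assume "bl d \<in> ?S"
      then have "d = e \<or> d = e'" using ne(1) leaf_edge_unique[OF e(1) d] leaf_edge_unique[OF e(2) d] by blast
      then show "wh d \<in> ?S" using e(3) by auto
    next
      assume "wh d \<in> ?S"
      then have "d = e \<or> d = e'" using ne(2,3) white_two[OF E e(3,4) d] by auto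
      then show "bl d \<in> ?S" by auto
    qed
  qed
  then have "card (vertices T) \<le> card ?S" by (intro card_mono) auto
  also have "\<dots> \<le> 3" by (simp add: card_insert_if)
  finally show False using card_vertices by simp
qed

lemma card_leaf_edges: "card leaf_edges = 11"
proof -
  have "bij_betw bl leaf_edges {b \<in> black T. vertex_degree T b = 1}"
    unfolding bij_betw_def
  proof
    show "inj_on bl leaf_edges" using leaf_edge_unique leaf_edges_sub by (auto intro!: inj_onI)
    have "\<exists>e\<in>leaf_edges. bl e = b" if "b \<in> black T" "vertex_degree T b = 1" for b
    proof -
      have "edges_at T b \<noteq> {}" using that by (auto simp: vertex_degree_def)
      then show ?thesis using edges_at_black[OF that(1)] that by (auto simp: leaf_edges_def)
    qed
    then show "bl ` leaf_edges = {b \<in> black T. vertex_degree T b = 1}"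
      using end_black(1) by (auto simp: leaf_edges_def image_iff)
  qed
  then show ?thesis using black_degree_count[of 1] by (simp add: bij_betw_same_card)
qed

text \<open>The 11 leaves have different white neighbours, and there are 13 white vertices.\<close>

lemma card_special: "card special = 2"
proof -
  have "wh ` leaf_edges \<subseteq> white T" using leaf_edges_sub end_white(1) by auto
  moreover have "card (wh ` leaf_edges) = 11" using card_image[OF inj_wh_leaf] card_leaf_edges by simp
  moreover have "finite (wh ` leaf_edges)" using fin(3) leaf_edges_sub by (auto intro: finite_subset)
  ultimately show ?thesis unfolding special_def using card_Diff_subset card_white by fastforce
qed

lemma special_big: "e \<in> edges T \<Longrightarrow> wh e \<in> special \<Longrightarrow> e \<in> big_edges"
  using edge_cases by (auto simp: special_def)

lemma big_pair_special:
  assumes "e \<in> big_edges" "d \<in> big_edges" "e \<noteq> d" "wh e = wh d"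
  shows "wh e \<in> special"
proof (rule ccontr)
  have E: "e \<in> edges T" "d \<in> edges T" using assms big_edges_sub by auto
  assume "wh e \<notin> special"
  then obtain l where l: "l \<in> leaf_edges" "wh e = wh l"
    using end_white(1)[OF E(1)] by (auto simp: special_def)
  then have "l \<in> edges T" using leaf_edges_sub by auto
  then have "l = e \<or> l = d" using white_two[OF E assms(4,3)] l(2) by simp
  then show False using edge_cases assms l(1) E by blast
qed

text \<open>The path of edges \<open>e1, e2, e3, e4\<close> through the three vertices of degree 5.\<close>

definition "spine e1 e2 e3 e4 \<longleftrightarrow> e1 \<in> big_edges \<and> e2 \<in> big_edges \<and> e3 \<in> big_edges \<and> e4 \<in> big_edges \<and>
   wh e1 = wh e2 \<and> wh e3 = wh e4 \<and> wh e2 \<noteq> wh e3 \<and> bl e2 = bl e3 \<and>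
   bl e1 \<noteq> bl e2 \<and> bl e2 \<noteq> bl e4 \<and> bl e1 \<noteq> bl e4"

text \<open>On the middle edges of a spine this depends on the orientation of the path: reversal
  replaces g by 3 - g, so the invariant of the tree is the pair of g and 3 - g.\<close>

definition "gap e e' = card {d \<in> edges_at T (bl e). ccw T (bl e) e d e'}"

lemma spine_sym: "spine e1 e2 e3 e4 \<Longrightarrow> spine e4 e3 e2 e1"
  unfolding spine_def by auto

lemma spine_edges: "spine e1 e2 e3 e4 \<Longrightarrow> {e1, e2, e3, e4} \<subseteq> edges T"
  using big_edges_sub by (auto simp: spine_def)

lemma spine_special:
  assumes "spine e1 e2 e3 e4"
  shows "special = {wh e2, wh e3}"
proof -
  have "wh e2 \<in> special" "wh e3 \<in> special" "wh e2 \<noteq> wh e3"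
    using assms big_pair_special[of e2 e1] big_pair_special[of e3 e4] unfolding spine_def by metis+
  then have "{wh e2, wh e3} \<subseteq> special" "card {wh e2, wh e3} = 2" by auto
  moreover have "finite special" using card_special card.infinite by fastforce
  ultimately show ?thesis using card_special card_subset_eq by metis
qed

lemma spine_white:
  assumes s: "spine e1 e2 e3 e4" and d: "d \<in> edges T"
  shows "wh d = wh e2 \<Longrightarrow> d = e1 \<or> d = e2" "wh d = wh e3 \<Longrightarrow> d = e3 \<or> d = e4"
proof -
  have E: "e1 \<in> edges T" "e2 \<in> edges T" "e3 \<in> edges T" "e4 \<in> edges T"
    using spine_edges[OF s] by auto
  have *: "wh e2 = wh e1" "e2 \<noteq> e1" "wh e3 = wh e4" "e3 \<noteq> e4" using s unfolding spine_def by metis+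
  show "wh d = wh e2 \<Longrightarrow> d = e1 \<or> d = e2" using white_two[OF E(2,1) *(1,2) d] by blast
  show "wh d = wh e3 \<Longrightarrow> d = e3 \<or> d = e4" using white_two[OF E(3,4) *(3,4) d] by blast
qed

text \<open>The white vertices of any spine are the two special vertices, and each of them carries
  just two edges. As the middle edges have a common black end while the outer ones end elsewhere,
  only reversal is possible.\<close>

lemma spine_unique:
  assumes e: "spine e1 e2 e3 e4" and f: "spine f1 f2 f3 f4"
  shows "f2 = e2 \<and> f3 = e3 \<or> f2 = e3 \<and> f3 = e2"
proof -
  have *: "f2 = e2 \<and> f3 = e3" if e: "spine e1 e2 e3 e4" and eq: "wh f2 = wh e2" for e1 e2 e3 e4
  proof -
    have F: "f2 \<in> edges T" "f3 \<in> edges T" using spine_edges[OF f] by auto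
    have "{wh f2, wh f3} = {wh e2, wh e3}" using spine_special[OF e] spine_special[OF f] by simp
    moreover have "wh f2 \<noteq> wh f3" using f unfolding spine_def by blast
    ultimately have "wh f3 = wh e3" using eq by (auto simp: doubleton_eq_iff)
    then have "f2 = e1 \<or> f2 = e2" "f3 = e3 \<or> f3 = e4"
      using spine_white[OF e F(1)] spine_white[OF e F(2)] eq by auto
    moreover have "bl f2 = bl f3" using f unfolding spine_def by blast
    moreover have "bl e2 = bl e3" "bl e1 \<noteq> bl e2" "bl e2 \<noteq> bl e4" "bl e1 \<noteq> bl e4" using e unfolding spine_def by blast+
    ultimately show ?thesis by metis
  qed
  have "wh f2 = wh e2 \<or> wh f2 = wh e3" using spine_special[OF e] spine_special[OF f] by auto
  then show ?thesis using *[OF e] *[OF spine_sym[OF e]] by blast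
qed

lemma gap_sym:
  assumes "spine e1 e2 e3 e4"
  shows "gap e2 e3 + gap e3 e2 = 3"
proof -
  let ?A = "edges_at T (bl e2)"
  let ?X = "{d \<in> ?A. ccw T (bl e2) e2 d e3}" and ?Y = "{d \<in> ?A. ccw T (bl e2) e3 d e2}"
  have e: "e2 \<in> edges T" "e3 \<in> edges T" "bl e3 = bl e2" "e2 \<noteq> e3" "vertex_degree T (bl e2) = 5"
    using assms unfolding spine_def big_edges_def by auto
  have eA: "e2 \<in> ?A" "e3 \<in> ?A" unfolding edges_at_bl[OF e(1)] using e by simp_all
  have cyc: "cyclic_order_on ?A (ccw T (bl e2))"
    using end_black(1)[OF e(1)] by (intro cyclic_at) (simp add: vertices_def)
  have "?X \<union> ?Y = ?A - {e2, e3}"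
    using cyclic_order_distinct[OF cyc eA(1) _ eA(2)] cyclic_order_distinct[OF cyc eA(2) _ eA(1)]
      cyclic_order_total[OF cyc eA(1) _ eA(2)] cyclic_order_asym[OF cyc] e(4) by blast
  moreover have "?X \<inter> ?Y = {}" using cyclic_order_asym[OF cyc eA(1) _ eA(2)] by blast
  moreover have "card (?A - {e2, e3}) = 3"
    using e(4,5) eA finite_edges_at by (subst card_Diff_subset) (auto simp: vertex_degree_def)
  ultimately have "card ?X + card ?Y = 3"
    using card_Un_disjoint[of ?X ?Y] finite_edges_at by simp
  then show ?thesis by (simp add: gap_def e(3))
qed

text \<open>A set \<open>Q\<close> of vertices of degree 5 that neither special vertex joins to its complement would
  split off a component of the tree.\<close>

lemma separation:
  assumes x: "special = {wh a1, wh b1}" and E: "{a1, a2, b1, b2} \<subseteq> edges T"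
    and a: "a1 \<noteq> a2" "wh a2 = wh a1" and b: "b1 \<noteq> b2" "wh b2 = wh b1"
    and Q: "q \<in> Q" "Q \<subseteq> {b \<in> black T. vertex_degree T b = 5}"
    and r: "r \<in> black T" "vertex_degree T r = 5" "r \<notin> Q"
  shows "(bl a1 \<in> Q) \<noteq> (bl a2 \<in> Q) \<or> (bl b1 \<in> Q) \<noteq> (bl b2 \<in> Q)"
proof (rule ccontr)
  assume no: "\<not> ?thesis"
  define W0 where "W0 = {wh e | e. e \<in> edges T \<and> bl e \<in> Q}"
  \<comment> \<open>\<open>Q\<close>, its white neighbours, and the leaves beyond these. If neither
    special vertex joins \<open>Q\<close> to its complement, then no edge leaves \<open>S\<close>,
    but \<open>r\<close> lies outside.\<close>
  define S where "S = Q \<union> W0 \<union> {bl l | l. l \<in> leaf_edges \<and> wh l \<in> W0}"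
  have W0: "W0 \<subseteq> white T" using end_white(1) by (auto simp: W0_def)
  have big: "bl e \<in> Q \<longleftrightarrow> wh e \<in> W0" if e: "e \<in> big_edges" for e
  proof
    have eE: "e \<in> edges T" using e big_edges_sub by auto
    show "bl e \<in> Q \<Longrightarrow> wh e \<in> W0" using eE by (auto simp: W0_def)
    assume "wh e \<in> W0"
    then obtain d where d: "d \<in> edges T" "bl d \<in> Q" "wh e = wh d" by (auto simp: W0_def)
    have dB: "d \<in> big_edges" using d Q(2) by (auto simp: big_edges_def)
    show "bl e \<in> Q"
    proof (cases "e = d")
      case False
      then have "wh e \<in> special" using big_pair_special[OF e dB] d(3) by simp
      then have "wh e = wh a1 \<or> wh e = wh b1" using x by auto
      then show ?thesis
      proof
        assume "wh e = wh a1"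
        then have "e \<in> {a1, a2}" "d \<in> {a1, a2}"
          using white_two[of a1 a2 e] white_two[of a1 a2 d] E a d eE by auto
        then show ?thesis using no d(2) by auto
      next
        assume "wh e = wh b1"
        then have "e \<in> {b1, b2}" "d \<in> {b1, b2}"
          using white_two[of b1 b2 e] white_two[of b1 b2 d] E b d eE by auto
        then show ?thesis using no d(2) by auto
      qed
    qed (use d in simp)
  qed
  have "vertices T \<subseteq> S"
  proof (rule connected_closed)
    show "q \<in> S" "q \<in> vertices T" using Q by (auto simp: S_def vertices_def)
    fix d assume d: "d \<in> edges T"
    have bd: "bl d \<in> black T" "wh d \<in> white T" using end_black(1)[OF d] end_white(1)[OF d] by auto
    have whS: "wh d \<in> S \<longleftrightarrow> wh d \<in> W0"
    proof -
      have "wh d \<notin> black T" using bd fin(4) by blast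
      moreover have "bl l \<in> black T" if "l \<in> leaf_edges" for l
        using that leaf_edges_sub end_black(1) by blast
      ultimately show ?thesis using Q(2) by (auto simp: S_def)
    qed
    have nW: "bl d \<notin> W0" using bd(1) W0 fin(4) by blast
    show "bl d \<in> S \<longleftrightarrow> wh d \<in> S"
    proof (cases "d \<in> big_edges")
      case True
      have "bl d \<noteq> bl l" if "l \<in> leaf_edges" for l
        using True that by (auto simp: big_edges_def leaf_edges_def)
      then have "bl d \<in> S \<longleftrightarrow> bl d \<in> Q" using nW by (auto simp: S_def)
      then show ?thesis using big[OF True] whS by simp
    next
      case False
      then have l: "d \<in> leaf_edges" using edge_cases[OF d] by simp
      then have "bl d \<notin> Q" using Q(2) by (auto simp: leaf_edges_def)
      then have "bl d \<in> S \<longleftrightarrow> (\<exists>l \<in> leaf_edges. bl d = bl l \<and> wh l \<in> W0)" using nW by (auto simp: S_def)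
      also have "\<dots> \<longleftrightarrow> wh d \<in> W0" using leaf_edge_unique[of _ d] d l by metis
      finally show ?thesis using whS by simp
    qed
  qed
  then have "r \<in> S" using r by (auto simp: vertices_def)
  moreover have "r \<notin> W0" using r(1) W0 fin(4) by blast
  ultimately show False using r by (auto simp: S_def leaf_edges_def)
qed

text \<open>By \<open>separation\<close> for singletons, each vertex of degree 5 is joined to
  another one by a special vertex. Two special vertices achieve this for three vertices only if they
  join two different pairs; the pairs then share one vertex, the middle of the path.\<close>

lemma spine_exists: "\<exists>e1 e2 e3 e4. spine e1 e2 e3 e4"
proof -
  obtain x y where xy: "special = {x, y}" "x \<noteq> y" using card_special by (auto simp: card_2_iff)
  have xw: "x \<in> white T" "y \<in> white T" using xy by (auto simp: special_def)
  obtain a1 where a1: "a1 \<in> edges T" "wh a1 = x"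
    using edges_at_nonempty[of x] edges_at_white[OF xw(1)] xw by (auto simp: vertices_def)
  obtain b1 where b1: "b1 \<in> edges T" "wh b1 = y"
    using edges_at_nonempty[of y] edges_at_white[OF xw(2)] xw by (auto simp: vertices_def)
  obtain a2 where a2: "a2 \<in> edges T" "a2 \<noteq> a1" "wh a2 = wh a1" using white_other[OF a1(1)] by blast
  obtain b2 where b2: "b2 \<in> edges T" "b2 \<noteq> b1" "wh b2 = wh b1" using white_other[OF b1(1)] by blast
  have big: "a1 \<in> big_edges" "a2 \<in> big_edges" "b1 \<in> big_edges" "b2 \<in> big_edges"
    using special_big a1 a2 b1 b2 xy by auto
  obtain p q r where pqr: "{b \<in> black T. vertex_degree T b = 5} = {p, q, r}" "p \<noteq> q" "q \<noteq> r" "p \<noteq> r"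
    using black_degree_count[of 5] by (auto simp: card_3_iff)
  have inpqr: "bl e \<in> {p, q, r}" if "e \<in> big_edges" for e
    using that end_black(1) pqr(1) by (auto simp: big_edges_def)
  have sep: "(bl a1 = z) \<noteq> (bl a2 = z) \<or> (bl b1 = z) \<noteq> (bl b2 = z)" if "z \<in> {p, q, r}" for z
  proof -
    have z: "{z} \<subseteq> {b \<in> black T. vertex_degree T b = 5}" using that pqr(1) by auto
    obtain z' where z': "z' \<in> {p, q, r}" "z' \<noteq> z" using pqr that by auto
    then have z'': "z' \<in> black T" "vertex_degree T z' = 5" "z' \<notin> {z}" using pqr(1) by auto
    have "special = {wh a1, wh b1}" "{a1, a2, b1, b2} \<subseteq> edges T" using xy a1 a2 b1 b2 by simp_all
    from separation[OF this a2(2)[symmetric] a2(3) b2(2)[symmetric] b2(3) singletonI z z'']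
    show ?thesis by simp
  qed
  have d: "bl a1 \<noteq> bl a2" "bl b1 \<noteq> bl b2" "{bl a1, bl a2} \<noteq> {bl b1, bl b2}"
  proof -
    have s: "(bl a1 = p) \<noteq> (bl a2 = p) \<or> (bl b1 = p) \<noteq> (bl b2 = p)"
      "(bl a1 = q) \<noteq> (bl a2 = q) \<or> (bl b1 = q) \<noteq> (bl b2 = q)"
      "(bl a1 = r) \<noteq> (bl a2 = r) \<or> (bl b1 = r) \<noteq> (bl b2 = r)"
      using sep by simp_all
    note i = inpqr[OF big(1)] inpqr[OF big(2)] inpqr[OF big(3)] inpqr[OF big(4)]
    show "bl a1 \<noteq> bl a2" "bl b1 \<noteq> bl b2"
      using s i pqr(2-4) by (metis insert_iff singletonD)+
    show "{bl a1, bl a2} \<noteq> {bl b1, bl b2}"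
      unfolding doubleton_eq_iff using s i pqr(2-4) by (metis insert_iff singletonD)
  qed
  have "bl a1 = bl b1 \<or> bl a1 = bl b2 \<or> bl a2 = bl b1 \<or> bl a2 = bl b2"
  proof (rule ccontr)
    assume "\<not> ?thesis"
    then have "card {bl a1, bl a2, bl b1, bl b2} = 4" using d(1,2) by (simp add: card_insert_if)
    moreover have "card {bl a1, bl a2, bl b1, bl b2} \<le> card {p, q, r}"
      using inpqr big by (intro card_mono) auto
    moreover have "card {p, q, r} = 3" using pqr by simp
    ultimately show False by simp
  qed
  moreover have "wh a1 = wh a2" "wh b1 = wh b2" "wh a1 \<noteq> wh b1" using a1 a2 b1 b2 xy by simp_all
  moreover have "\<not> (bl a1 = bl b1 \<and> bl a2 = bl b2)" "\<not> (bl a1 = bl b2 \<and> bl a2 = bl b1)"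
    using d(3) by (auto simp: doubleton_eq_iff)
  ultimately have "spine a2 a1 b1 b2 \<or> spine a2 a1 b2 b1 \<or> spine a1 a2 b1 b2 \<or> spine a1 a2 b2 b1"
    using d(1,2) big unfolding spine_def by metis
  then show ?thesis by blast
qed

end

text \<open>The label \<open>(0, v, i)\<close> denotes the \<open>i\<close>-th edge at the middle vertex (\<open>v = 0\<close>) or at one of the
  other two vertices of degree 5, counted from an edge of the path that joins them; \<open>(1, v, i)\<close> denotes
  the edge to a leaf that continues it.  The second edge of the path at the middle vertex is
  number \<open>j\<close>.\<close>

definition spine_labels :: "nat \<Rightarrow> (nat \<times> nat \<times> nat) set" where
  "spine_labels j = {0} \<times> ({..<3} \<times> {..<5}) \<union> {1} \<times> ({..<3} \<times> {..<5} - {(0, 0), (0, j), (1, 0), (2, 0)})"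

text \<open>A white vertex is named after the position of a big edge at it. A special vertex has two
  big edges, so the positions of the outer edges of the path are identified with those of their
  partners at the middle vertex.\<close>

definition white_label :: "nat \<Rightarrow> nat \<times> nat \<Rightarrow> nat \<times> nat" where
  "white_label j p = (if p = (1, 0) then (0, 0) else if p = (2, 0) then (0, j) else p)"

definition black_label :: "nat \<times> nat \<times> nat \<Rightarrow> nat \<times> nat \<times> nat" where
  "black_label l = (if fst l = 0 then (0, fst (snd l), 0) else l)"

lemma card_spine_labels:
  assumes "0 < j" "j < 5"
  shows "finite (spine_labels j)" "card (spine_labels j) = 26"
proof -
  let ?P = "{..<3::nat} \<times> {..<5::nat}"
  have "card (?P - {(0, 0), (0, j), (1, 0), (2, 0)}) = card ?P - card {(0::nat, 0::nat), (0, j), (1, 0), (2, 0)}"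
    using assms by (intro card_Diff_subset) auto
  also have "\<dots> = 11" using assms by simp
  finally have "card (?P - {(0, 0), (0, j), (1, 0), (2, 0)}) = 11" .
  moreover have "card (spine_labels j) = card ({0::nat} \<times> ?P) + card ({1::nat} \<times> (?P - {(0, 0), (0, j), (1, 0), (2, 0)}))"
    unfolding spine_labels_def by (intro card_Un_disjoint) auto
  ultimately show "card (spine_labels j) = 26" by (simp only: card_cartesian_product) simp
  show "finite (spine_labels j)" unfolding spine_labels_def by simp
qed

context pp_tree
begin

text \<open>A cyclic order relates only three distinct edges, and a white vertex has two.\<close>

lemma no_white_ccw:
  assumes "w \<in> white T" "a \<in> edges_at T w" "b \<in> edges_at T w" "c \<in> edges_at T w"
  shows "\<not> ccw T w a b c"
proof
  assume *: "ccw T w a b c"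
  have cyc: "cyclic_order_on (edges_at T w) (ccw T w)" using assms(1) by (intro cyclic_at) (simp add: vertices_def)
  have "card {a, b, c} = 3" using cyclic_order_distinct[OF cyc assms(2-4) *] by simp
  moreover have "card {a, b, c} \<le> card (edges_at T w)"
    using assms finite_edges_at by (intro card_mono) auto
  ultimately show False using white_degree[OF assms(1)] by (simp add: vertex_degree_def)
qed

lemma gap_less: "spine e1 e2 e3 e4 \<Longrightarrow> gap e2 e3 < 4"
  using gap_sym by fastforce

text \<open>The set of labels depends on \<open>j\<close> alone, so the lemma describes the entire
  tree by one number. The clauses on black ends, white ends and cyclic order are those that a
  bijection of edges must respect in order to induce an isomorphism.\<close>

lemma labelling:
  assumes s: "spine e1 e2 e3 e4" and j: "j = Suc (gap e2 e3)"
  obtains L where "bij_betw L (edges T) (spine_labels j)"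
    "\<And>e d. e \<in> edges T \<Longrightarrow> d \<in> edges T \<Longrightarrow> bl e = bl d \<longleftrightarrow> black_label (L e) = black_label (L d)"
    "\<And>e d. e \<in> edges T \<Longrightarrow> d \<in> edges T \<Longrightarrow> wh e = wh d \<longleftrightarrow> white_label j (snd (L e)) = white_label j (snd (L d))"
    "\<And>a b c. a \<in> edges T \<Longrightarrow> b \<in> edges T \<Longrightarrow> c \<in> edges T \<Longrightarrow> bl a = bl b \<Longrightarrow> bl b = bl c \<Longrightarrow>
      ccw T (bl a) a b c \<longleftrightarrow> fst (L a) = 0 \<and> cyclic3 (snd (snd (L a))) (snd (snd (L b))) (snd (snd (L c)))"
proof -
  have E: "e1 \<in> edges T" "e2 \<in> edges T" "e3 \<in> edges T" "e4 \<in> edges T" using spine_edges[OF s] by auto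
  have B: "e1 \<in> big_edges" "e2 \<in> big_edges" "e3 \<in> big_edges" "e4 \<in> big_edges"
    and W: "wh e1 = wh e2" "wh e3 = wh e4" "wh e2 \<noteq> wh e3" and b23: "bl e2 = bl e3"
    and bne: "bl e1 \<noteq> bl e2" "bl e2 \<noteq> bl e4" "bl e1 \<noteq> bl e4"
    using s unfolding spine_def by blast+
  have j5: "0 < j" "j < 5" using gap_less[OF s] j by auto
  have bigs: "{b \<in> black T. vertex_degree T b = 5} = {bl e1, bl e2, bl e4}"
  proof -
    have "card {b \<in> black T. vertex_degree T b = 5} = 3" using black_degree_count[of 5] by simp
    moreover have "{bl e1, bl e2, bl e4} \<subseteq> {b \<in> black T. vertex_degree T b = 5}"
      using B E end_black(1) by (auto simp: big_edges_def)
    moreover have "card {bl e1, bl e2, bl e4} = 3" using bne by simp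
    moreover have "finite {b \<in> black T. vertex_degree T b = 5}" using fin(1) by simp
    ultimately show ?thesis using card_subset_eq by metis
  qed
  have bl3: "bl e = bl e1 \<or> bl e = bl e2 \<or> bl e = bl e4" if "e \<in> big_edges" for e
    using that bigs end_black(1) unfolding big_edges_def by blast
  define idx where "idx = (\<lambda>b. if b = bl e2 then 0 else if b = bl e1 then 1 else (2::nat))"
  define st where "st = (\<lambda>b. if b = bl e2 then e2 else if b = bl e1 then e1 else e4)"
  define rk where "rk = (\<lambda>e. cyclic_rank (edges_at T (bl e)) (ccw T (bl e)) (st (bl e)) e)"
  define pos where "pos = (\<lambda>e. (idx (bl e), rk e))"
  have idx: "idx (bl e) < 3" for e by (simp add: idx_def)
  have idx_inj: "bl e = bl d" if "e \<in> big_edges" "d \<in> big_edges" "idx (bl e) = idx (bl d)" for e d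
    using bl3[OF that(1)] bl3[OF that(2)] that(3) bne by (auto simp: idx_def split: if_splits)
  have st: "st (bl e) \<in> edges_at T (bl e)" if "e \<in> big_edges" for e
    using bl3[OF that] E bne edges_at_bl[OF E(1)] edges_at_bl[OF E(2)] edges_at_bl[OF E(4)]
    by (elim disjE) (simp_all add: st_def)
  have inat: "e \<in> edges_at T (bl e)" if "e \<in> edges T" for e using edges_at_bl[OF that] that by simp
  have cyc: "cyclic_order_on (edges_at T (bl e)) (ccw T (bl e))" if "e \<in> edges T" for e
    using end_black(1)[OF that] by (intro cyclic_at) (simp add: vertices_def)
  have bigE: "e \<in> edges T" if "e \<in> big_edges" for e using that big_edges_sub by auto
  have rank_bij: "bij_betw (cyclic_rank (edges_at T (bl e)) (ccw T (bl e)) (st (bl e))) (edges_at T (bl e)) {..<5}"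
    if "e \<in> big_edges" for e
    using cyclic_rank(1)[OF cyc[OF bigE[OF that]] finite_edges_at st[OF that]] that
    by (simp add: big_edges_def vertex_degree_def)
  have rk5: "rk e < 5" if "e \<in> big_edges" for e
    using bij_betwE[OF rank_bij[OF that]] inat[OF bigE[OF that]] by (simp add: rk_def)
  have pos_inj: "e = d" if "e \<in> big_edges" "d \<in> big_edges" "pos e = pos d" for e d
  proof -
    have eq: "bl e = bl d" using idx_inj that by (simp add: pos_def)
    then have "rk e = rk d" using that by (simp add: pos_def)
    then have "cyclic_rank (edges_at T (bl e)) (ccw T (bl e)) (st (bl e)) e =
        cyclic_rank (edges_at T (bl e)) (ccw T (bl e)) (st (bl e)) d" by (simp add: rk_def eq)
    moreover have "d \<in> edges_at T (bl e)" unfolding eq by (rule inat[OF bigE[OF that(2)]])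
    ultimately show ?thesis
      by (rule inj_onD[OF bij_betw_imp_inj_on[OF rank_bij[OF that(1)]] _ inat[OF bigE[OF that(1)]]])
  qed
  have pos1: "pos e1 = (1, 0)" "pos e2 = (0, 0)" "pos e4 = (2, 0)"
    using bne by (auto simp: pos_def idx_def rk_def st_def cyclic_rank_def)
  have "e3 \<noteq> e2" using W by auto
  \<comment> \<open>Counting at the middle vertex starts from \<open>e2\<close> with number 0, so
    \<open>e3\<close> comes right after the \<open>gap e2 e3\<close> edges in between and has number
    \<open>j\<close>.\<close>
  then have pos3: "pos e3 = (0, j)"
    by (simp add: pos_def idx_def rk_def st_def cyclic_rank_def b23[symmetric] j gap_def)
  have leaf_partner: "\<exists>b. b \<in> big_edges \<and> wh b = wh l" if l: "l \<in> leaf_edges" for l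
  proof -
    have lE: "l \<in> edges T" using l leaf_edges_sub by auto
    obtain b where b: "b \<in> edges T" "b \<noteq> l" "wh b = wh l" using white_other[OF lE] by blast
    then have "b \<notin> leaf_edges" using inj_wh_leaf l by (auto dest: inj_onD)
    then show ?thesis using b edge_cases[OF b(1)] by blast
  qed
  \<comment> \<open>The white end of an edge to a leaf carries exactly one other edge, which is big
    because no white vertex has two leaves; the edge to the leaf inherits its position.\<close>
  define base where "base = (\<lambda>e. if e \<in> big_edges then e else (SOME b. b \<in> big_edges \<and> wh b = wh e))"
  have base: "base e \<in> big_edges \<and> wh (base e) = wh e" if "e \<in> edges T" for e
  proof (cases "e \<in> big_edges")
    case False
    then have "e \<in> leaf_edges" using edge_cases[OF that] by simp
    then show ?thesis using someI_ex[OF leaf_partner] False by (simp add: base_def)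
  qed (simp add: base_def)
  have base_leaf: "base e \<notin> {e1, e2, e3, e4}" if e: "e \<in> edges T" "e \<notin> big_edges" for e
  proof
    assume "base e \<in> {e1, e2, e3, e4}"
    then have "wh (base e) = wh e2 \<or> wh (base e) = wh e3" using W(1,2) by auto
    then have "wh e \<in> special" using base[OF e(1)] spine_special[OF s] by auto
    then show False using special_big[OF e(1)] e(2) by blast
  qed
  define L where "L = (\<lambda>e. (if e \<in> big_edges then 0 else (1::nat), pos (base e)))"
  have fstL: "fst (L e) = 0 \<longleftrightarrow> e \<in> big_edges" for e by (simp add: L_def)
  have bigL: "L e = (0, pos e)" if "e \<in> big_edges" for e using that by (simp add: L_def base_def)
  have leafL: "L e = (1, pos (base e))" if "e \<notin> big_edges" for e using that by (simp add: L_def)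
  have inj: "inj_on L (edges T)"
  proof (rule inj_onI)
    fix e d assume ed: "e \<in> edges T" "d \<in> edges T" "L e = L d"
    then have "pos (base e) = pos (base d)" by (simp add: L_def)
    then have eq: "base e = base d" by (rule pos_inj[OF base[OF ed(1), THEN conjunct1] base[OF ed(2), THEN conjunct1]])
    have iff: "e \<in> big_edges \<longleftrightarrow> d \<in> big_edges" using fstL[of e] fstL[of d] ed(3) by simp
    show "e = d"
    proof (cases "e \<in> big_edges")
      case True
      then show ?thesis using eq iff by (simp add: base_def)
    next
      case False
      have "wh e = wh d" using base[OF ed(1)] base[OF ed(2)] eq by simp
      then show ?thesis using inj_wh_leaf edge_cases[OF ed(1)] edge_cases[OF ed(2)] False iff by (auto dest: inj_onD)
    qed
  qed
  have mem: "L e \<in> spine_labels j" if e: "e \<in> edges T" for e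
  proof -
    have p: "pos (base e) \<in> {..<3} \<times> {..<5}" using idx rk5 base[OF e] by (simp add: pos_def)
    show ?thesis
    proof (cases "e \<in> big_edges")
      case False
      have "pos (base e) \<noteq> pos e'" if "e' \<in> {e1, e2, e3, e4}" for e'
        using pos_inj[of "base e" e'] base[OF e] base_leaf[OF e False] that B by auto
      then have "pos (base e) \<notin> {(0, 0), (0, j), (1, 0), (2, 0)}" using pos1 pos3 by (metis empty_iff insert_iff)
      then show ?thesis using p False unfolding spine_labels_def L_def by simp
    qed (use p in \<open>simp add: spine_labels_def L_def\<close>)
  qed
  have bij: "bij_betw L (edges T) (spine_labels j)"
    unfolding bij_betw_def
  proof
    show "L ` edges T = spine_labels j"
      using card_spine_labels[OF j5] card_image[OF inj] card_edges mem by (intro card_subset_eq) auto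
  qed (rule inj)
  show thesis
  proof (rule that[OF bij])
    fix e d assume ed: "e \<in> edges T" "d \<in> edges T"
    show "bl e = bl d \<longleftrightarrow> black_label (L e) = black_label (L d)"
    proof (cases "e \<in> big_edges")
      case eb: True
      show ?thesis
      proof (cases "d \<in> big_edges")
        case True
        then show ?thesis using idx_inj[OF eb True] bigL[OF eb] bigL[OF True] by (auto simp: black_label_def pos_def)
      next
        case False
        then have "bl e \<noteq> bl d" using eb ed by (auto simp: big_edges_def)
        then show ?thesis using bigL[OF eb] leafL[OF False] by (auto simp: black_label_def)
      qed
    next
      case el: False
      show ?thesis
      proof (cases "d \<in> big_edges")
        case True
        then have "bl e \<noteq> bl d" using el ed by (auto simp: big_edges_def)
        then show ?thesis using bigL[OF True] leafL[OF el] by (auto simp: black_label_def)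
      next
        case False
        have "bl e = bl d \<longleftrightarrow> e = d"
          using leaf_edge_unique[of d e] edge_cases[OF ed(2)] False ed by blast
        also have "\<dots> \<longleftrightarrow> L e = L d" using inj ed by (auto dest: inj_onD)
        finally show ?thesis using leafL[OF el] leafL[OF False] by (simp add: black_label_def)
      qed
    qed
    have *: "wh e = wh d \<longleftrightarrow> white_label j (pos e) = white_label j (pos d)"
      if e: "e \<in> big_edges" and d: "d \<in> big_edges" for e d
    proof
      assume wh: "wh e = wh d"
      show "white_label j (pos e) = white_label j (pos d)"
      proof (cases "e = d")
        case False
        have "wh e \<in> special" by (rule big_pair_special[OF e d False wh])
        then have "wh e = wh e2 \<or> wh e = wh e3" using spine_special[OF s] by auto
        then have "{e, d} \<subseteq> {e1, e2} \<or> {e, d} \<subseteq> {e3, e4}"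
          using spine_white[OF s bigE[OF e]] spine_white[OF s bigE[OF d]] wh by auto
        then show ?thesis using pos1 pos3 j5 by (auto simp: white_label_def)
      qed simp
    next
      assume wl: "white_label j (pos e) = white_label j (pos d)"
      \<comment> \<open>\<open>white_label\<close> identifies two different positions only at the
        two special vertices.\<close>
      have "pos e = pos d \<or> {pos e, pos d} \<subseteq> {(1, 0), (0, 0)} \<or> {pos e, pos d} \<subseteq> {(2, 0), (0, j)}"
        using wl j5 unfolding white_label_def by (auto split: if_splits)
      then have "pos e = pos d \<or> {pos e, pos d} \<subseteq> {pos e1, pos e2} \<or> {pos e, pos d} \<subseteq> {pos e4, pos e3}"
        unfolding pos1 pos3 .
      moreover have i: "pos a = pos b \<longleftrightarrow> a = b" if "a \<in> big_edges" "b \<in> big_edges" for a b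
        using pos_inj[OF that] by blast
      ultimately have "e = d \<or> (e = e1 \<or> e = e2) \<and> (d = e1 \<or> d = e2) \<or> (e = e4 \<or> e = e3) \<and> (d = e4 \<or> d = e3)"
        by (simp only: insert_subset insert_iff empty_iff empty_subsetI simp_thms
          i[OF e d] i[OF e B(1)] i[OF e B(2)] i[OF e B(3)] i[OF e B(4)] i[OF d B(1)] i[OF d B(2)] i[OF d B(3)] i[OF d B(4)])
      then show "wh e = wh d" using W(1,2) by metis
    qed
    show "wh e = wh d \<longleftrightarrow> white_label j (snd (L e)) = white_label j (snd (L d))"
      using *[of "base e" "base d"] base[OF ed(1)] base[OF ed(2)] by (simp add: L_def)
  next
    fix a b c assume abc: "a \<in> edges T" "b \<in> edges T" "c \<in> edges T" "bl a = bl b" "bl b = bl c"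
    have m: "a \<in> edges_at T (bl a)" "b \<in> edges_at T (bl a)" "c \<in> edges_at T (bl a)"
      unfolding edges_at_bl[OF abc(1)] using abc by simp_all
    show "ccw T (bl a) a b c \<longleftrightarrow> fst (L a) = 0 \<and> cyclic3 (snd (snd (L a))) (snd (snd (L b))) (snd (snd (L c)))"
    proof (cases "a \<in> big_edges")
      case True
      then have big: "b \<in> big_edges" "c \<in> big_edges" using abc by (auto simp: big_edges_def)
      have "ccw T (bl a) a b c \<longleftrightarrow> cyclic3 (rk a) (rk b) (rk c)"
        using cyclic_rank(2)[OF cyc[OF abc(1)] finite_edges_at st[OF True] m] abc(4,5) by (simp add: rk_def)
      then show ?thesis using bigL[OF True] bigL[OF big(1)] bigL[OF big(2)] by (simp add: pos_def)
    next
      case False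
      then have "b = a" using leaf_edge_unique[of a b] edge_cases[OF abc(1)] abc by simp
      then have "\<not> ccw T (bl a) a b c" using cyclic_order_distinct(1)[OF cyc[OF abc(1)] m] by auto
      then show ?thesis using False fstL by simp
    qed
  qed
qed

end

text \<open>Equal gaps give the same set of labels for both trees, and the isomorphism matches edges
  with equal labels.\<close>

lemma spine_isomorphic:
  fixes T :: "('v, 'e) bicolored_map" and U :: "('w, 'f) bicolored_map"
  assumes T: "pp_tree T" and U: "pp_tree U"
    and s: "pp_tree.spine T e1 e2 e3 e4" and t: "pp_tree.spine U f1 f2 f3 f4"
    and gap: "pp_tree.gap T e2 e3 = pp_tree.gap U f2 f3"
  shows "plane_isomorphic T U"
proof -
  interpret T: pp_tree T by fact
  interpret U: pp_tree U by fact
  define j where "j = Suc (T.gap e2 e3)"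
  obtain l where l: "bij_betw l (edges T) (spine_labels j)"
    "\<And>e d. e \<in> edges T \<Longrightarrow> d \<in> edges T \<Longrightarrow> end_black T e = end_black T d \<longleftrightarrow> black_label (l e) = black_label (l d)"
    "\<And>e d. e \<in> edges T \<Longrightarrow> d \<in> edges T \<Longrightarrow> end_white T e = end_white T d \<longleftrightarrow> white_label j (snd (l e)) = white_label j (snd (l d))"
    "\<And>a b c. a \<in> edges T \<Longrightarrow> b \<in> edges T \<Longrightarrow> c \<in> edges T \<Longrightarrow> end_black T a = end_black T b \<Longrightarrow> end_black T b = end_black T c \<Longrightarrow>
      ccw T (end_black T a) a b c \<longleftrightarrow> fst (l a) = 0 \<and> cyclic3 (snd (snd (l a))) (snd (snd (l b))) (snd (snd (l c)))"
    by (rule T.labelling[OF s j_def]) blast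
  have j': "j = Suc (U.gap f2 f3)" by (simp add: j_def gap)
  obtain m where m: "bij_betw m (edges U) (spine_labels j)"
    "\<And>e d. e \<in> edges U \<Longrightarrow> d \<in> edges U \<Longrightarrow> end_black U e = end_black U d \<longleftrightarrow> black_label (m e) = black_label (m d)"
    "\<And>e d. e \<in> edges U \<Longrightarrow> d \<in> edges U \<Longrightarrow> end_white U e = end_white U d \<longleftrightarrow> white_label j (snd (m e)) = white_label j (snd (m d))"
    "\<And>a b c. a \<in> edges U \<Longrightarrow> b \<in> edges U \<Longrightarrow> c \<in> edges U \<Longrightarrow> end_black U a = end_black U b \<Longrightarrow> end_black U b = end_black U c \<Longrightarrow>
      ccw U (end_black U a) a b c \<longleftrightarrow> fst (m a) = 0 \<and> cyclic3 (snd (snd (m a))) (snd (snd (m b))) (snd (snd (m c)))"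
    by (rule U.labelling[OF t j']) blast
  define g where "g = (\<lambda>e. inv_into (edges U) m (l e))"
  have g: "bij_betw g (edges T) (edges U)"
    using bij_betw_trans[OF l(1) bij_betw_inv_into[OF m(1)]] by (simp add: g_def comp_def)
  have gE: "g e \<in> edges U" and mg: "m (g e) = l e" if "e \<in> edges T" for e
    using bij_betwE[OF g] that bij_betw_inv_into_right[OF m(1), of "l e"] bij_betwE[OF l(1)] by (auto simp: g_def)
  show ?thesis
  proof (rule plane_isomorphic_if_edge_map[OF T.tree U.tree T.edges_at_nonempty U.edges_at_nonempty g])
    fix e e' assume e: "e \<in> edges T" "e' \<in> edges T"
    show b: "end_black U (g e) = end_black U (g e') \<longleftrightarrow> end_black T e = end_black T e'"
      using m(2)[OF gE[OF e(1)] gE[OF e(2)]] l(2)[OF e] mg e by simp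
    show "end_white U (g e) = end_white U (g e') \<longleftrightarrow> end_white T e = end_white T e'"
      using m(3)[OF gE[OF e(1)] gE[OF e(2)]] l(3)[OF e] mg e by simp
  next
    fix v a b c assume v: "v \<in> black T" and e: "a \<in> edges_at T v" "b \<in> edges_at T v" "c \<in> edges_at T v"
    have E: "a \<in> edges T" "b \<in> edges T" "c \<in> edges T"
      and bl: "end_black T a = v" "end_black T b = v" "end_black T c = v"
      using e T.edges_at_black[OF v] by auto
    have "end_black U (g a) = end_black U (g b)" "end_black U (g b) = end_black U (g c)"
      using m(2)[OF gE[OF E(1)] gE[OF E(2)]] l(2)[OF E(1,2)] m(2)[OF gE[OF E(2)] gE[OF E(3)]] l(2)[OF E(2,3)] mg E bl
      by simp_all
    then show "ccw U (end_black U (g a)) (g a) (g b) (g c) \<longleftrightarrow> ccw T v a b c"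
      using m(4)[OF gE[OF E(1)] gE[OF E(2)] gE[OF E(3)]] l(4)[OF E] mg E bl by simp
  next
    fix v a b c assume v: "v \<in> white T" and e: "a \<in> edges_at T v" "b \<in> edges_at T v" "c \<in> edges_at T v"
    have E: "a \<in> edges T" "b \<in> edges T" "c \<in> edges T"
      and wh: "end_white T a = v" "end_white T b = v" "end_white T c = v"
      using e T.edges_at_white[OF v] by auto
    have "end_white U (g a) = end_white U (g b)" "end_white U (g a) = end_white U (g c)"
      using m(3)[OF gE[OF E(1)] gE[OF E(2)]] l(3)[OF E(1,2)] m(3)[OF gE[OF E(1)] gE[OF E(3)]] l(3)[OF E(1,3)] mg E wh
      by simp_all
    then have "\<not> ccw U (end_white U (g a)) (g a) (g b) (g c)"
      using gE E U.end_white(1)[OF gE[OF E(1)]] U.edges_at_wh[OF gE[OF E(1)]] by (intro U.no_white_ccw) auto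
    then show "ccw U (end_white U (g a)) (g a) (g b) (g c) \<longleftrightarrow> ccw T v a b c"
      using T.no_white_ccw[OF v e] by simp
  qed
qed

text \<open>Isomorphisms transport spines and preserve gaps. Together with uniqueness of the spine
  up to reversal, this makes the gap usable for telling trees apart.\<close>

lemma isomorphic_spine:
  fixes T :: "('v, 'e) bicolored_map" and U :: "('w, 'f) bicolored_map"
  assumes T: "pp_tree T" and U: "pp_tree U" and iso: "plane_isomorphic T U"
    and s: "pp_tree.spine T e1 e2 e3 e4"
  obtains f1 f2 f3 f4 where "pp_tree.spine U f1 f2 f3 f4" "pp_tree.gap U f2 f3 = pp_tree.gap T e2 e3"
proof -
  interpret T: pp_tree T by fact
  interpret U: pp_tree U by fact
  obtain f g where f: "bij_betw f (black T) (black U)" "bij_betw f (white T) (white U)"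
    and g: "bij_betw g (edges T) (edges U)"
    and inc: "\<And>v e. v \<in> vertices T \<Longrightarrow> e \<in> edges T \<Longrightarrow> incident U (f v) (g e) \<longleftrightarrow> incident T v e"
    and ord: "\<And>v e1 e2 e3. v \<in> vertices T \<Longrightarrow> e1 \<in> edges_at T v \<Longrightarrow> e2 \<in> edges_at T v \<Longrightarrow> e3 \<in> edges_at T v \<Longrightarrow>
         ccw U (f v) (g e1) (g e2) (g e3) \<longleftrightarrow> ccw T v e1 e2 e3"
    using iso unfolding plane_isomorphic_def by blast
  have gE: "g e \<in> edges U" if "e \<in> edges T" for e using bij_betwE[OF g] that by blast
  have fb: "end_black U (g e) = f (end_black T e)" if e: "e \<in> edges T" for e
  proof -
    have b: "end_black T e \<in> black T" by (rule T.end_black(1)[OF e])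
    then have "incident U (f (end_black T e)) (g e)" using inc[OF _ e] T.end_black(2)[OF e] by (simp add: vertices_def)
    moreover have "f (end_black T e) \<in> black U" using bij_betwE[OF f(1)] b by blast
    ultimately show ?thesis using U.end_black_unique[OF gE[OF e]] by blast
  qed
  have fw: "end_white U (g e) = f (end_white T e)" if e: "e \<in> edges T" for e
  proof -
    have b: "end_white T e \<in> white T" by (rule T.end_white(1)[OF e])
    then have "incident U (f (end_white T e)) (g e)" using inc[OF _ e] T.end_white(2)[OF e] by (simp add: vertices_def)
    moreover have "f (end_white T e) \<in> white U" using bij_betwE[OF f(2)] b by blast
    ultimately show ?thesis using U.end_white_unique[OF gE[OF e]] by blast
  qed
  have at: "edges_at U (f v) = g ` edges_at T v" if v: "v \<in> vertices T" for v
  proof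
    show "g ` edges_at T v \<subseteq> edges_at U (f v)" using inc[OF v] gE by (auto simp: edges_at_def)
    show "edges_at U (f v) \<subseteq> g ` edges_at T v"
    proof
      fix d assume "d \<in> edges_at U (f v)"
      then have d: "d \<in> edges U" "incident U (f v) d" by (auto simp: edges_at_def)
      obtain e where "e \<in> edges T" "d = g e" using d(1) bij_betw_imp_surj_on[OF g] by blast
      then show "d \<in> g ` edges_at T v" using inc[OF v] d(2) by (auto simp: edges_at_def)
    qed
  qed
  have bv: "end_black T e \<in> vertices T" if "e \<in> edges T" for e
    using T.end_black(1)[OF that] by (simp add: vertices_def)
  have deg: "vertex_degree U (f v) = vertex_degree T v" if v: "v \<in> vertices T" for v
  proof -
    have "inj_on g (edges_at T v)"
      by (rule inj_on_subset[OF bij_betw_imp_inj_on[OF g]]) (auto simp: edges_at_def)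
    then show ?thesis unfolding vertex_degree_def at[OF v] by (rule card_image)
  qed
  have big: "g e \<in> U.big_edges" if "e \<in> T.big_edges" for e
    using that deg[OF bv] gE fb by (simp add: T.big_edges_def U.big_edges_def)
  have blinj: "end_black U (g e) = end_black U (g d) \<longleftrightarrow> end_black T e = end_black T d" if "e \<in> edges T" "d \<in> edges T" for e d
    using fb that T.end_black(1) bij_betw_imp_inj_on[OF f(1)] by (auto dest: inj_onD)
  have whinj: "end_white U (g e) = end_white U (g d) \<longleftrightarrow> end_white T e = end_white T d" if "e \<in> edges T" "d \<in> edges T" for e d
    using fw that T.end_white(1) bij_betw_imp_inj_on[OF f(2)] by (auto dest: inj_onD)
  have E: "e1 \<in> edges T" "e2 \<in> edges T" "e3 \<in> edges T" "e4 \<in> edges T" using T.spine_edges[OF s] by auto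
  have s': "U.spine (g e1) (g e2) (g e3) (g e4)"
    unfolding U.spine_def blinj[OF E(1) E(2)] blinj[OF E(2) E(3)] blinj[OF E(2) E(4)] blinj[OF E(1) E(4)]
      whinj[OF E(1) E(2)] whinj[OF E(3) E(4)] whinj[OF E(2) E(3)]
    using s big unfolding T.spine_def by blast
  have "end_black T e3 = end_black T e2" using s unfolding T.spine_def by simp
  then have m: "e2 \<in> edges_at T (end_black T e2)" "e3 \<in> edges_at T (end_black T e2)"
    using E T.edges_at_bl[OF E(2)] by simp_all
  have eq: "{d \<in> edges_at U (end_black U (g e2)). ccw U (end_black U (g e2)) (g e2) d (g e3)} =
      g ` {d \<in> edges_at T (end_black T e2). ccw T (end_black T e2) e2 d e3}"
  proof -
    have 1: "{d \<in> g ` A. P d} = g ` {d \<in> A. P (g d)}" for A P by blast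
    have 2: "{d \<in> edges_at T (end_black T e2). ccw U (f (end_black T e2)) (g e2) (g d) (g e3)} =
        {d \<in> edges_at T (end_black T e2). ccw T (end_black T e2) e2 d e3}"
      using ord[OF bv[OF E(2)] m(1) _ m(2)] by blast
    show ?thesis unfolding fb[OF E(2)] at[OF bv[OF E(2)]] 1 2 ..
  qed
  have "inj_on g {d \<in> edges_at T (end_black T e2). ccw T (end_black T e2) e2 d e3}"
    by (rule inj_on_subset[OF bij_betw_imp_inj_on[OF g]]) (auto simp: edges_at_def)
  then have "U.gap (g e2) (g e3) = T.gap e2 e3"
    unfolding U.gap_def T.gap_def eq by (rule card_image)
  then show thesis using that s' by blast
qed

section \<open>The polynomials\<close>

text \<open>Here \<sigma> may be either real square root, so both polynomials of the theorem are
  instances. Only the estimates for the ray, the signs and the directions at 1 distinguish \<sigma>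
  > 0 from \<sigma> < 0.\<close>

locale sqrt273 =
  fixes \<sigma> :: real
  assumes square: "\<sigma> * \<sigma> = 273"
begin

definition "a = 2 * \<sigma> / 3 + 13"
definition "cr = 896/120285 * (-21 - \<sigma>) ^ 5 * (-111 - 7 * \<sigma>)"
text \<open>\<open>k1\<close> and \<open>k2\<close> are the value and the derivative at 1 of the
  cubic factor of \<open>P\<close>; its remaining Taylor coefficients there, -4/3 and 1, do not
  depend on \<sigma>.\<close>

definition "k1 = 28/495 * (111 + 7 * \<sigma>)"
definition "k2 = - 17/3 + (39 - 2 * \<sigma>) / 11"

abbreviation "s \<equiv> complex_of_real \<sigma>"
abbreviation "P \<equiv> P_poly s"
abbreviation "c \<equiv> complex_of_real cr"

definition "quad = [:complex_of_real a, 0, 1:]"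
definition "cub = [:91/15 + 26 * s / 45, - (2 * s / 11 - 39/11), - (13/3), 1:]"

lemma P_eq: "P = quad ^ 5 * cub"
  by (simp add: P_poly_def quad_def cub_def a_def)

lemma square_complex: "s * s = 273"
  using square by (metis of_real_mult of_real_numeral)

lemma sigma_bounds: "16.5225 < \<bar>\<sigma>\<bar>" "\<bar>\<sigma>\<bar> < 16.523"
proof -
  have sq: "\<bar>\<sigma>\<bar> ^ 2 = 273" using square by (simp add: power2_eq_square)
  show "16.5225 < \<bar>\<sigma>\<bar>"
    by (rule power_less_imp_less_base[of _ 2]) (simp_all only: sq, simp_all add: power2_eq_square)
  show "\<bar>\<sigma>\<bar> < 16.523"
    by (rule power_less_imp_less_base[of _ 2]) (simp_all only: sq, simp_all add: power2_eq_square)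
qed

lemma a_pos: "a > 0"
  using sigma_bounds by (simp add: a_def)

lemma P_at_1: "poly P 1 = c"
  by (simp add: poly_P_poly_1 cr_def)

lemma cr_nonzero: "cr \<noteq> 0"
  using sigma_bounds by (auto simp: cr_def)

lemma poly_quad: "poly quad z = z ^ 2 + a"
  by (simp add: quad_def power2_eq_square)

lemma poly_P: "poly P z = (z ^ 2 + a) ^ 5 * poly cub z"
  unfolding P_eq by (simp add: poly_quad)

text \<open>Once \<open>quad ^ 4\<close> is taken out, a quartic remains, and \<sigma>^2 = 273 is
  what turns it into 13 times the fourth power of x - 1.\<close>

lemma pderiv_P: "pderiv P = smult 13 (quad ^ 4 * [:-1, 1:] ^ 4)"
proof -
  have 1: "pderiv quad = [:0, 2:]" by (simp add: quad_def pderiv_pCons)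
  have 2: "[:-1, 1::complex:] ^ 4 = [:1, -4, 6, -4, 1:]" by (simp add: eval_nat_numeral)
  have "quad * pderiv cub + smult 5 ([:0, 2:] * cub) = smult 13 [:1, -4, 6, -4, 1:]"
    using square_complex by (simp add: quad_def cub_def a_def pderiv_pCons field_simps)
  moreover have "pderiv P = quad ^ 4 * (quad * pderiv cub + smult 5 ([:0, 2:] * cub))"
    unfolding P_eq pderiv_mult
    using pderiv_power_Suc[of quad 4] power_Suc[of quad 4] by (simp add: 1 algebra_simps)
  ultimately show ?thesis by (simp only: 2 mult_smult_right)
qed

lemma poly_pderiv_P: "poly (pderiv P) z = 13 * (z ^ 2 + a) ^ 4 * (z - 1) ^ 4"
  unfolding pderiv_P by (simp add: poly_quad)

lemma degree_P: "degree P = 13"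
proof -
  have "degree quad = 2" "degree cub = 3" "quad \<noteq> 0" "cub \<noteq> 0" by (simp_all add: quad_def cub_def)
  then show ?thesis unfolding P_eq by (simp add: degree_mult_eq degree_power_eq)
qed

lemma cr_eq: "cr = (1 + a) ^ 5 * k1"
proof -
  have "poly cub 1 = of_real k1" by (simp add: cub_def k1_def field_simps)
  then have "complex_of_real cr = complex_of_real ((1 + a) ^ 5 * k1)"
    using poly_P[of 1] unfolding P_at_1 by simp
  then show ?thesis using of_real_eq_iff by blast
qed

lemma cub_at:
  fixes h :: complex
  shows "poly cub (1 + h) = k1 + k2 * h - 4/3 * h ^ 2 + h ^ 3"
  by (simp add: cub_def k1_def k2_def field_simps power2_eq_square power3_eq_cube)

text \<open>The factor (z - 1)^4 of the derivative contributes y^4 \<omega>^4 along the ray, and the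
  quadratic factor is close to the positive number 1 + a near 1. So near 1 the sign is governed by
  the imaginary part of \<omega>^5.\<close>

lemma P_derivative_along_ray:
  fixes \<omega> :: complex
  shows "((\<lambda>y. Im (poly P (1 + \<omega> * of_real y))) has_real_derivative
     13 * y ^ 4 * Im (\<omega> ^ 5 * ((1 + \<omega> * of_real y) ^ 2 + a) ^ 4)) (at y)"
proof -
  have "((\<lambda>y. 1 + \<omega> * of_real y) has_vector_derivative \<omega>) (at y)"
    by (auto intro!: derivative_eq_intros simp: has_vector_derivative_def scaleR_conv_of_real)
  from field_vector_diff_chain_at[OF this poly_DERIV[of P "1 + \<omega> * of_real y"]]
  have "((\<lambda>y. poly P (1 + \<omega> * of_real y)) has_vector_derivative
      \<omega> * poly (pderiv P) (1 + \<omega> * of_real y)) (at y)"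
    by (simp add: o_def)
  from bounded_linear.has_vector_derivative[OF bounded_linear_Im this]
  have "((\<lambda>y. Im (poly P (1 + \<omega> * of_real y))) has_real_derivative
      Im (\<omega> * poly (pderiv P) (1 + \<omega> * of_real y))) (at y)"
    by (simp add: has_real_derivative_iff_has_vector_derivative)
  also have "\<omega> * poly (pderiv P) (1 + \<omega> * of_real y) =
      of_real (13 * y ^ 4) * (\<omega> ^ 5 * ((1 + \<omega> * of_real y) ^ 2 + a) ^ 4)"
    unfolding poly_pderiv_P by (simp add: power_mult_distrib eval_nat_numeral)
  also have "Im \<dots> = 13 * y ^ 4 * Im (\<omega> ^ 5 * ((1 + \<omega> * of_real y) ^ 2 + a) ^ 4)"
    by (simp only: times_complex.simps Re_complex_of_real Im_complex_of_real)
  finally show ?thesis .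
qed

text \<open>Near 1 the imaginary part of \<open>P\<close> is strictly monotone along the ray, hence nonzero; farther
  away both factors of \<open>P\<close> are at least as large as they are at 1, so \<open>\<bar>P\<bar> \<ge> \<bar>c\<bar>\<close>.\<close>

lemma ray_avoids_segment:
  fixes \<omega> :: complex
  assumes sign: "\<epsilon> \<noteq> 0" and near: "\<And>y. 0 < y \<Longrightarrow> y \<le> y1 \<Longrightarrow> \<epsilon> * Im (\<omega> ^ 5 * ((1 + \<omega> * of_real y) ^ 2 + a) ^ 4) > 0"
    and far: "\<And>y. y1 \<le> y \<Longrightarrow> 0 < y \<Longrightarrow> 1 + a \<le> cmod ((1 + \<omega> * of_real y) ^ 2 + a) \<and> \<bar>k1\<bar> \<le> cmod (poly cub (1 + \<omega> * of_real y))"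
    and y: "0 < y"
  shows "poly P (1 + \<omega> * of_real y) \<notin> open_segment 0 c"
proof
  assume seg: "poly P (1 + \<omega> * of_real y) \<in> open_segment 0 c"
  then obtain t where t: "0 < t" "t < 1" "poly P (1 + \<omega> * of_real y) = of_real (t * cr)"
    by (auto simp: in_segment scaleR_conv_of_real)
  show False
  proof (cases "y \<le> y1")
    case True
    define f where "f = (\<lambda>y. \<epsilon> * Im (poly P (1 + \<omega> * of_real y)))"
    have "f 0 < f y"
    proof (rule DERIV_pos_imp_increasing_open[OF y])
      fix x assume x: "0 < x" "x < y"
      have "(f has_real_derivative \<epsilon> * (13 * x ^ 4 * Im (\<omega> ^ 5 * ((1 + \<omega> * of_real x) ^ 2 + a) ^ 4))) (at x)"
        unfolding f_def by (intro DERIV_cmult P_derivative_along_ray)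
      moreover have "\<epsilon> * (13 * x ^ 4 * Im (\<omega> ^ 5 * ((1 + \<omega> * of_real x) ^ 2 + a) ^ 4)) =
          13 * x ^ 4 * (\<epsilon> * Im (\<omega> ^ 5 * ((1 + \<omega> * of_real x) ^ 2 + a) ^ 4))" by simp
      moreover have "13 * x ^ 4 * (\<epsilon> * Im (\<omega> ^ 5 * ((1 + \<omega> * of_real x) ^ 2 + a) ^ 4)) > 0"
        using near[of x] x True by (intro mult_pos_pos[of "13 * x ^ 4"]) auto
      ultimately show "\<exists>y. (f has_real_derivative y) (at x) \<and> 0 < y" by metis
    next
      show "continuous_on {0..y} f" unfolding f_def by (intro continuous_intros)
    qed
    moreover have "f 0 = 0" by (simp add: f_def P_at_1)
    moreover have "f y = 0" by (simp add: f_def t(3))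
    ultimately show False by simp
  next
    case False
    then have "(1 + a) ^ 5 * \<bar>k1\<bar> \<le> cmod ((1 + \<omega> * of_real y) ^ 2 + a) ^ 5 * cmod (poly cub (1 + \<omega> * of_real y))"
      using far[of y] y a_pos by (intro mult_mono power_mono) auto
    also have "\<dots> = cmod (poly P (1 + \<omega> * of_real y))"
      unfolding poly_P by (simp add: norm_mult norm_power)
    also have "\<dots> = t * \<bar>cr\<bar>" unfolding t(3) norm_of_real using t(1) by (simp add: abs_mult)
    finally have "\<bar>cr\<bar> \<le> t * \<bar>cr\<bar>" using a_pos by (simp add: cr_eq abs_mult)
    then show False using t cr_nonzero by simp
  qed
qed

lemma quad_ray:
  "(1 + Complex p q * of_real y) ^ 2 + a = Complex (1 + a + 2 * p * y + (p ^ 2 - q ^ 2) * y ^ 2) (2 * q * y + 2 * p * q * y ^ 2)"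
  by (simp add: complex_eq_iff power2_eq_square algebra_simps)

text \<open>The direction 3 + 4i has argument about 53 degrees and lies between the edge directions
  of 36 and 108 degrees at 1. Its small integer coordinates keep all estimates in rational
  arithmetic.\<close>

lemma ray_positive:
  assumes \<sigma>: "\<sigma> > 0" and y: "y > 0"
  shows "poly P (1 + Complex 3 4 * of_real y) \<notin> open_segment 0 c"
proof -
  have s: "16.5225 < \<sigma>" "\<sigma> < 16.523" using sigma_bounds \<sigma> by auto
  have a: "24 < a" "a < 24.1" using s by (auto simp: a_def)
  have k1: "12.81 < k1" "k1 < 12.83" using s by (auto simp: k1_def)
  have k2: "5.12 < - k2" "- k2 < 5.13" using s by (auto simp: k2_def field_simps)
  \<comment> \<open>The fifth power points almost straight down, so the imaginary part of
    \<open>P\<close> decreases along the ray; this is the reason for the sign -1.\<close>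
  have w5: "Complex 3 4 ^ 5 = Complex (-237) (-3116)" by (simp add: complex_eq_iff eval_nat_numeral)
  show ?thesis
  proof (rule ray_avoids_segment[of "-1" "1/2" "Complex 3 4" y])
    fix y :: real assume y: "0 < y" "y \<le> 1/2"
    \<comment> \<open>The real and imaginary parts of the quadratic factor. Up to y = 1/2 the
      quotient Y / X is at most 2/5, and 6 (2/5)^2 < 1 keeps the real part of (X + iY)^4
      positive.\<close>
    define X Y where "X = 1 + a + 2 * 3 * y + (3 ^ 2 - 4 ^ 2) * y ^ 2" and "Y = 2 * 4 * y + 2 * 3 * 4 * y ^ 2"
    have yy: "y ^ 2 \<le> y / 2" using mult_left_mono[OF y(2), of y] y by (simp add: power2_eq_square)
    have X: "X \<ge> 25" using a y yy by (simp add: X_def)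
    have Y: "0 < Y" "Y \<le> 10" using y yy by (auto simp: Y_def intro: add_pos_pos)
    have "Y ^ 2 \<le> (2/5 * X) ^ 2" using X Y by (intro power_mono) auto
    then have Y2: "Y ^ 2 \<le> 4/25 * X ^ 2" by (simp add: power2_eq_square)
    have im: "Im (Complex (-237) (-3116) * Complex X Y ^ 4) =
        - (3116 * (X ^ 2 * (X ^ 2 - 6 * Y ^ 2) + Y ^ 4) + 948 * X * Y * (X ^ 2 - Y ^ 2))"
      by (simp add: eval_nat_numeral algebra_simps)
    have "X ^ 2 > 0" using X by simp
    then have "X ^ 2 - 6 * Y ^ 2 > 0" and XY: "X ^ 2 - Y ^ 2 > 0" using Y2 by linarith+
    then have "X ^ 2 * (X ^ 2 - 6 * Y ^ 2) > 0" using \<open>X ^ 2 > 0\<close> by simp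
    then have "3116 * (X ^ 2 * (X ^ 2 - 6 * Y ^ 2) + Y ^ 4) + 948 * X * Y * (X ^ 2 - Y ^ 2) > 0"
      using X Y XY by (intro add_pos_pos mult_pos_pos[of _ "X ^ 2 - Y ^ 2"] mult_pos_pos[of 3116] mult_pos_pos[of 948]) auto
    then show "(-1) * Im (Complex 3 4 ^ 5 * ((1 + Complex 3 4 * of_real y) ^ 2 + a) ^ 4) > 0"
      unfolding quad_ray w5 X_def[symmetric] Y_def[symmetric] im by simp
  next
    fix y :: real assume y: "1/2 \<le> y"
    have pos: "0 < y" using y by simp
    have "(1 + a) ^ 2 \<le> cmod ((1 + Complex 3 4 * of_real y) ^ 2 + a) ^ 2"
    proof -
      have "12 * (1 + a) + (100 - 14 * (1 + a)) * y + 300 * y ^ 2 = 300 * (y - 1/2) ^ 2 + (400 - 14 * (1 + a)) * y + (12 * (1 + a) - 75)"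
        by (simp add: power2_eq_square algebra_simps)
      also have "\<dots> \<ge> 0" using a y by (intro add_nonneg_nonneg mult_nonneg_nonneg) auto
      finally have "0 \<le> 12 * (1 + a) + (100 - 14 * (1 + a)) * y + 300 * y ^ 2 + 625 * y ^ 3" using pos by simp
      then have "0 \<le> y * (12 * (1 + a) + (100 - 14 * (1 + a)) * y + 300 * y ^ 2 + 625 * y ^ 3)" using pos by simp
      then show ?thesis unfolding quad_ray cmod_power2 by (simp add: eval_nat_numeral algebra_simps)
    qed
    then have q: "1 + a \<le> cmod ((1 + Complex 3 4 * of_real y) ^ 2 + a)" by (rule power2_le_imp_le) simp
    have "k1 ^ 2 \<le> cmod (poly cub (1 + Complex 3 4 * of_real y)) ^ 2"
    proof -
      \<comment> \<open>The difference of the two squared moduli is y times a quintic in y. The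
        coefficients that depend on \<sigma> are bounded below by rationals; rewritten in t, the
        resulting quintic has only positive coefficients.\<close>
      define t where "t = y - 1/2"
      have t: "t \<ge> 0" "y = 1/2 + t" using y by (auto simp: t_def)
      define D where "D = - k2"
      have D: "5.12 < D" "D < 5.13" using k2 by (auto simp: D_def)
      have b1: "k1 * D \<le> 1283/100 * (513/100)" using k1 D by (intro mult_mono) auto
      have b2: "5.12 * 5.12 \<le> D * D" using D by (intro mult_mono) auto
      have c1: "(4472/5 :: real) * y \<le> (25 * (D * D) + 56/3 * k1) * y" using b2 k1 pos by (intro mult_right_mono) auto
      have c2: "(- 19783/10) * y ^ 2 \<le> (- 234 * k1 + 200 * D) * y ^ 2" using k1 D by (intro mult_right_mono) auto
      have c3: "(2903 :: real) * y ^ 3 \<le> (784/9 + 1024 + 350 * D) * y ^ 3" using D pos by (intro mult_right_mono) auto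
      have "0 \<le> - 395 + 4472/5 * y - 19783/10 * y ^ 2 + 2903 * y ^ 3 - 5000 * y ^ 4 + 15625 * y ^ 5"
        unfolding t(2) using t(1) by (simp add: eval_nat_numeral field_simps)
      also have "\<dots> \<le> - 6 * (k1 * D) + (25 * (D * D) + 56/3 * k1) * y + (- 234 * k1 + 200 * D) * y ^ 2 +
          (784/9 + 1024 + 350 * D) * y ^ 3 - 5000 * y ^ 4 + 15625 * y ^ 5"
        using b1 c1 c2 c3 by linarith
      finally have "0 \<le> y * (- 6 * (k1 * D) + (25 * (D * D) + 56/3 * k1) * y + (- 234 * k1 + 200 * D) * y ^ 2 +
          (784/9 + 1024 + 350 * D) * y ^ 3 - 5000 * y ^ 4 + 15625 * y ^ 5)" using pos by simp
      moreover have "poly cub (1 + Complex 3 4 * of_real y) =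
          Complex (k1 - 3 * D * y + 28/3 * y ^ 2 - 117 * y ^ 3) (- 4 * D * y - 32 * y ^ 2 + 44 * y ^ 3)"
        unfolding cub_at by (simp add: D_def complex_eq_iff eval_nat_numeral algebra_simps)
      ultimately show ?thesis unfolding cmod_power2 by (simp add: eval_nat_numeral algebra_simps)
    qed
    then have "k1 \<le> cmod (poly cub (1 + Complex 3 4 * of_real y))" by (rule power2_le_imp_le) simp
    then show "1 + a \<le> cmod ((1 + Complex 3 4 * of_real y) ^ 2 + a) \<and> \<bar>k1\<bar> \<le> cmod (poly cub (1 + Complex 3 4 * of_real y))"
      using q k1 by simp
  qed (use y in auto)
qed

text \<open>The scheme is that for positive \<sigma>. The direction 1 + 4i has argument about 76
  degrees and lies between the edge directions of 72 and 144 degrees at 1; its fifth power has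
  positive imaginary part, hence the sign 1.\<close>

lemma ray_negative:
  assumes \<sigma>: "\<sigma> < 0" and y: "y > 0"
  shows "poly P (1 + Complex 1 4 * of_real y) \<notin> open_segment 0 c"
proof -
  have s: "- 16.523 < \<sigma>" "\<sigma> < - 16.5225" using sigma_bounds \<sigma> by auto
  have a: "1.984 < a" "a < 1.986" using s by (auto simp: a_def)
  have k1: "- 0.264 < k1" "k1 < - 0.2634" using s by (auto simp: k1_def)
  have k2: "0.882 < k2" "k2 < 0.8835" using s by (auto simp: k2_def field_simps)
  have w5: "Complex 1 4 ^ 5 = Complex 1121 404" by (simp add: complex_eq_iff eval_nat_numeral)
  show ?thesis
  proof (rule ray_avoids_segment[of 1 "1/5" "Complex 1 4" y])
    fix y :: real assume y: "0 < y" "y \<le> 1/5"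
    define X Y where "X = 1 + a + 2 * 1 * y + (1 ^ 2 - 4 ^ 2) * y ^ 2" and "Y = 2 * 4 * y + 2 * 1 * 4 * y ^ 2"
    have yy: "y ^ 2 \<le> y / 5" using mult_left_mono[OF y(2), of y] y by (simp add: power2_eq_square)
    have X: "X \<ge> 2.784" using a y yy by (simp add: X_def)
    have Y: "0 < Y" "Y \<le> 1.92" using y yy by (auto simp: Y_def intro: add_pos_pos)
    have YX: "Y \<le> 7/10 * X" using X Y by simp
    have "Y ^ 2 \<le> (7/10 * X) ^ 2" using YX Y by (intro power_mono) auto
    then have Y2: "Y ^ 2 \<le> 49/100 * X ^ 2" by (simp add: power2_eq_square)
    have XY: "X * Y \<le> 7/10 * X ^ 2" using mult_left_mono[OF YX, of X] X by (simp add: power2_eq_square)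
    \<comment> \<open>Now Y / X gets close to 7/10, and the real part of (X + iY)^4 can be negative.
      Its negative term is therefore grouped with the imaginary part, which has the larger weight
      1121 and compensates for it.\<close>
    have im: "Im (Complex 1121 404 * Complex X Y ^ 4) =
        404 * X ^ 4 + (X * Y) * (4484 * X ^ 2 - 2424 * (X * Y) - 4484 * Y ^ 2) + 404 * Y ^ 4"
      by (simp add: eval_nat_numeral algebra_simps)
    have "X ^ 2 > 0" using X by simp
    then have "4484 * X ^ 2 - 2424 * (X * Y) - 4484 * Y ^ 2 > 0" using XY Y2 by linarith
    then have "404 * X ^ 4 + (X * Y) * (4484 * X ^ 2 - 2424 * (X * Y) - 4484 * Y ^ 2) + 404 * Y ^ 4 > 0"
      using X Y by (intro add_pos_pos mult_pos_pos) auto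
    then show "1 * Im (Complex 1 4 ^ 5 * ((1 + Complex 1 4 * of_real y) ^ 2 + a) ^ 4) > 0"
      unfolding quad_ray w5 X_def[symmetric] Y_def[symmetric] im by simp
  next
    fix y :: real assume y: "1/5 \<le> y"
    have pos: "0 < y" using y by simp
    have "(1 + a) ^ 2 \<le> cmod ((1 + Complex 1 4 * of_real y) ^ 2 + a) ^ 2"
    proof -
      have "4 * (1 + a) + (68 - 30 * (1 + a)) * y + 68 * y ^ 2 = 68 * (y - 1/5) ^ 2 + (476/5 - 30 * (1 + a)) * y + (4 * (1 + a) - 68/25)"
        by (simp add: power2_eq_square algebra_simps)
      also have "\<dots> \<ge> 0" using a y by (intro add_nonneg_nonneg mult_nonneg_nonneg) auto
      finally have "0 \<le> 4 * (1 + a) + (68 - 30 * (1 + a)) * y + 68 * y ^ 2 + 289 * y ^ 3" using pos by simp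
      then have "0 \<le> y * (4 * (1 + a) + (68 - 30 * (1 + a)) * y + 68 * y ^ 2 + 289 * y ^ 3)" using pos by simp
      then show ?thesis unfolding quad_ray cmod_power2 by (simp add: eval_nat_numeral algebra_simps)
    qed
    then have q: "1 + a \<le> cmod ((1 + Complex 1 4 * of_real y) ^ 2 + a)" by (rule power2_le_imp_le) simp
    have "k1 ^ 2 \<le> cmod (poly cub (1 + Complex 1 4 * of_real y)) ^ 2"
    proof -
      define t where "t = y - 1/5"
      have t: "t \<ge> 0" "y = 1/5 + t" using y by (auto simp: t_def)
      define K where "K = - k1"
      have K: "0.2634 < K" "K < 0.264" using k1 by (auto simp: K_def)
      have b1: "K * k2 \<le> 264/1000 * (8835/10000)" using K k2 by (intro mult_mono) auto
      have b2: "0.882 * 0.882 \<le> k2 * k2" using k2 by (intro mult_mono) auto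
      have c1: "(133/50 :: real) * y \<le> (17 * (k2 * k2) - 40 * K) * y" using b2 K pos by (intro mult_right_mono) auto
      have c2: "(- 31/2) * y ^ 2 \<le> (94 * K - 136/3 * k2) * y ^ 2" using K k2 by (intro mult_right_mono) auto
      have c3: "(63 :: real) * y ^ 3 \<le> (4624/9 - 510 * k2) * y ^ 3" using k2 pos by (intro mult_right_mono) auto
      have "0 \<le> - 467/1000 + 133/50 * y - 31/2 * y ^ 2 + 63 * y ^ 3 - 2312/3 * y ^ 4 + 4913 * y ^ 5"
        unfolding t(2) using t(1) by (simp add: eval_nat_numeral field_simps)
      also have "\<dots> \<le> - 2 * (K * k2) + (17 * (k2 * k2) - 40 * K) * y + (94 * K - 136/3 * k2) * y ^ 2 +
          (4624/9 - 510 * k2) * y ^ 3 - 2312/3 * y ^ 4 + 4913 * y ^ 5"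
        using b1 c1 c2 c3 by linarith
      finally have "0 \<le> y * (- 2 * (K * k2) + (17 * (k2 * k2) - 40 * K) * y + (94 * K - 136/3 * k2) * y ^ 2 +
          (4624/9 - 510 * k2) * y ^ 3 - 2312/3 * y ^ 4 + 4913 * y ^ 5)" using pos by simp
      moreover have "poly cub (1 + Complex 1 4 * of_real y) =
          Complex (- K + k2 * y + 20 * y ^ 2 - 47 * y ^ 3) (4 * k2 * y - 32/3 * y ^ 2 - 52 * y ^ 3)"
        unfolding cub_at by (simp add: K_def complex_eq_iff eval_nat_numeral algebra_simps)
      moreover have "k1 ^ 2 = K ^ 2" by (simp add: K_def)
      ultimately show ?thesis unfolding cmod_power2 by (simp add: eval_nat_numeral algebra_simps)
    qed
    then have "\<bar>k1\<bar> \<le> cmod (poly cub (1 + Complex 1 4 * of_real y))"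
      by (metis abs_le_square_iff abs_norm_cancel)
    then show "1 + a \<le> cmod ((1 + Complex 1 4 * of_real y) ^ 2 + a) \<and> \<bar>k1\<bar> \<le> cmod (poly cub (1 + Complex 1 4 * of_real y))"
      using q by simp
  qed (use y in auto)
qed

end

section \<open>Multiplicities over 0 and c\<close>

lemma sum_order_roots:
  fixes p :: "complex poly"
  assumes "p \<noteq> 0"
  shows "(\<Sum>z | poly p z = 0. order z p) = degree p"
proof -
  have "size (proots p) = degree p" by (rule size_proots_complex)
  then show ?thesis using assms by (simp add: size_multiset_overloaded_eq)
qed

lemma order_simple_root:
  fixes F :: "complex poly"
  assumes "poly F z = v" "poly (pderiv F) z \<noteq> 0"
  shows "order z (F - [:v:]) = 1"
proof -
  have 1: "pderiv (F - [:v:]) = pderiv F" by (simp add: pderiv_diff)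
  then have "F - [:v:] \<noteq> 0" using assms(2) by (metis pderiv_0 poly_0)
  then have "order z (F - [:v:]) = Suc (order z (pderiv (F - [:v:])))"
    using assms(1) by (intro order_pderiv) simp_all
  then show ?thesis using assms(2) 1 by (simp add: order_0I)
qed

text \<open>A form of the intermediate value theorem. It confines an edge with one known end to one
  side of a line that the edge does not meet.\<close>

lemma positive_on_connected:
  fixes f :: "complex \<Rightarrow> real"
  assumes e: "connected e" and f: "continuous_on UNIV f" and nz: "\<And>z. z \<in> e \<Longrightarrow> f z \<noteq> 0"
    and x: "x \<in> closure e" "f x > 0" and z: "z \<in> e"
  shows "f z > 0"
proof (rule ccontr)
  assume "\<not> f z > 0"
  have "open {w. f w > 0}" using f by (intro open_Collect_less continuous_on_const)
  then obtain y where y: "y \<in> e" "f y > 0"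
    using x by (metis (mono_tags, lifting) closure_iff_nhds_not_empty disjoint_iff mem_Collect_eq subset_refl)
  have "connected (f ` e)" using e f by (meson connected_continuous_image continuous_on_subset subset_UNIV)
  then have "{f z..f y} \<subseteq> f ` e" using y z by (intro connected_contains_Icc) auto
  then have "0 \<in> f ` e" using \<open>\<not> f z > 0\<close> y by auto
  then show False using nz by auto
qed

context sqrt273
begin

definition "A = \<i> * complex_of_real (sqrt a)"

lemma A_square: "A ^ 2 = - of_real a"
  using a_pos by (simp add: A_def power_mult_distrib flip: of_real_power)

lemma A_distinct: "A \<noteq> - A" "A \<noteq> 1" "- A \<noteq> 1" "Im A > 0" "Re A = 0"
  using a_pos by (auto simp: A_def complex_eq_iff)

lemma quad_factor: "quad = [:-A, 1:] * [:A, 1:]"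
  using A_square by (simp add: quad_def power2_eq_square)

lemma quad_root: "z ^ 2 + of_real a = 0 \<longleftrightarrow> z = A \<or> z = - A"
proof -
  have "z ^ 2 + of_real a = (z - A) * (z + A)" using A_square by (simp add: algebra_simps power2_eq_square)
  then show ?thesis by (simp add: eq_neg_iff_add_eq_0)
qed

lemma order_A: "order A P = 5" "order (- A) P = 5"
proof -
  have *: "order B P = 5" if B: "B = A \<or> B = - A" for B
  proof -
    have PB: "poly P B = 0" using quad_root[of B] B by (auto simp: poly_P)
    have P0: "P \<noteq> 0" using degree_P by auto
    have quadB: "quad = [:-B, 1:] * [:B, 1:]"
      using B quad_factor by (auto simp: mult.commute)
    have "pderiv P = [:-B, 1:] ^ 4 * smult 13 ([:B, 1:] ^ 4 * [:-1, 1:] ^ 4)"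
      unfolding pderiv_P quadB power_mult_distrib by (simp only: mult_smult_right mult.assoc)
    moreover have "poly (smult 13 ([:B, 1:] ^ 4 * [:-1, 1:] ^ 4)) B \<noteq> 0"
      using B A_distinct by (auto simp: eq_neg_iff_add_eq_0[symmetric])
    moreover have "pderiv P \<noteq> 0" using degree_P by (simp add: pderiv_eq_0_iff)
    ultimately have "order B (pderiv P) = 4"
      by (simp add: order_mult order_power_n_n order_0I del: mult_smult_right)
    then show ?thesis using order_pderiv[OF P0 PB] by simp
  qed
  show "order A P = 5" "order (- A) P = 5" using * by auto
qed

lemma order_P_simple: "poly P z = 0 \<Longrightarrow> z \<noteq> A \<Longrightarrow> z \<noteq> - A \<Longrightarrow> order z P = 1"
proof -
  assume z: "poly P z = 0" "z \<noteq> A" "z \<noteq> - A"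
  then have "z \<noteq> 1" using P_at_1 cr_nonzero by auto
  then have "poly (pderiv P) z \<noteq> 0" using z quad_root by (simp add: poly_pderiv_P)
  then show ?thesis using order_simple_root[OF z(1)] by simp
qed

lemma P_A: "poly P A = 0" "poly P (- A) = 0"
  using quad_root[of A] quad_root[of "- A"] by (auto simp: poly_P)

text \<open>The value of the cofactor comes from differentiating its defining equation, cancelling
  the fourth power of x - 1 and evaluating at 1. Being real and positive, it leaves the directions
  at 1 to depend only on the sign of \<open>cr\<close>.\<close>

lemma factor_at_1:
  obtains q where "P - [:c:] = [:-1, 1:] ^ 5 * q" "poly q 1 = of_real (13 / 5 * (1 + a) ^ 4)" "order 1 (P - [:c:]) = 5"
proof -
  have d: "pderiv (P - [:c:]) = pderiv P" by (simp add: pderiv_diff)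
  have nz: "P - [:c:] \<noteq> 0" using degree_P by auto
  have "poly (quad ^ 4) 1 \<noteq> 0" using quad_root[of 1] A_distinct by (auto simp: poly_quad)
  then have "order 1 (pderiv P) = 4"
    unfolding pderiv_P using degree_P by (subst order_smult, simp, subst order_mult) (auto simp: order_0I order_power_n_n)
  then have ord: "order 1 (P - [:c:]) = 5"
    using order_pderiv[OF nz, of 1] P_at_1 d by simp
  then obtain q where q: "P - [:c:] = [:-1, 1:] ^ 5 * q" using order_decomp[OF nz, of 1] by metis
  define X where "X = [:-1, 1 :: complex:]"
  have "X ^ 4 * (X * pderiv q + smult 5 q) = X ^ 4 * smult 13 (quad ^ 4)"
  proof -
    have 5: "of_nat (Suc 4) = (5 :: complex)" by simp
    have "X ^ 4 * (X * pderiv q + smult 5 q) = pderiv (X ^ Suc 4 * q)"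
      using lemma_order_pderiv1[of 1 4 q] power_Suc[of X 4] unfolding X_def[symmetric] 5
      by (simp add: algebra_simps)
    also have "\<dots> = pderiv P" using q d by (simp add: X_def)
    finally show ?thesis unfolding pderiv_P X_def[symmetric] by (simp add: mult.commute)
  qed
  moreover have "X ^ 4 \<noteq> 0" by (simp add: X_def)
  ultimately have "X * pderiv q + smult 5 q = smult 13 (quad ^ 4)" using mult_left_cancel by blast
  then have "poly (X * pderiv q + smult 5 q) 1 = poly (smult 13 (quad ^ 4)) 1" by simp
  then have "5 * poly q 1 = 13 * (1 + of_real a) ^ 4" by (simp add: poly_quad X_def)
  then have "poly q 1 = of_real (13 / 5 * (1 + a) ^ 4)" by (simp add: field_simps)
  then show thesis using that q ord by blast
qed

lemma order_Pc_simple: "poly P z = c \<Longrightarrow> z \<noteq> 1 \<Longrightarrow> order z (P - [:c:]) = 1"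
proof -
  assume z: "poly P z = c" "z \<noteq> 1"
  then have "z ^ 2 + of_real a \<noteq> 0" using cr_nonzero by (auto simp: poly_P)
  then have "poly (pderiv P) z \<noteq> 0" using z by (simp add: poly_pderiv_P)
  then show ?thesis using order_simple_root[OF z(1)] by simp
qed

lemma P_noncritical: "noncritical_segment P 0 c"
proof
  show "degree P > 0" using degree_P by simp
  show "0 \<noteq> c" using cr_nonzero by simp
  fix z assume z: "poly P z \<in> open_segment 0 c"
  then have "z \<noteq> 1" "z ^ 2 + of_real a \<noteq> 0" using P_at_1 by (auto simp: open_segment_def poly_P)
  then show "poly (pderiv P) z \<noteq> 0" by (simp add: poly_pderiv_P)
qed

sublocale PN: noncritical_segment P 0 c
  by (rule P_noncritical)

sublocale PS: noncritical_segment P c 0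
  by (rule PN.swap)

text \<open>Of the 13 roots counted with multiplicity, \<open>A\<close> and \<open>-A\<close>
  account for ten; the other three are simple.\<close>

lemma card_P_zero: "card {z. poly P z = 0} = 5"
proof -
  have fin: "finite {z. poly P z = 0}" by (rule PN.finite_fibre)
  have "13 = (\<Sum>z | poly P z = 0. order z P)" using sum_order_roots[of P] degree_P by force
  also have "\<dots> = (\<Sum>z \<in> {z. poly P z = 0} - {A, - A}. order z P) + (\<Sum>z \<in> {A, - A}. order z P)"
    using fin P_A by (intro sum.subset_diff) auto
  also have "(\<Sum>z \<in> {A, - A}. order z P) = 10" using A_distinct order_A by simp
  also have "(\<Sum>z \<in> {z. poly P z = 0} - {A, - A}. order z P) = card ({z. poly P z = 0} - {A, - A})"
    using order_P_simple by (subst sum.cong[OF refl, of _ _ "\<lambda>_. 1"]) auto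
  finally have "card ({z. poly P z = 0} - {A, - A}) = 3" by simp
  then show ?thesis using fin P_A A_distinct by (subst (asm) card_Diff_subset) auto
qed

lemma card_P_c: "card {z. poly P z = c} = 9"
proof -
  have fin: "finite {z. poly P z = c}" by (rule PN.finite_fibre)
  have nz: "P - [:c:] \<noteq> 0" by (rule PN.nonzero_shift)
  have deg: "degree (P - [:c:]) = 13" using degree_add_eq_left[of "- [:c:]" P] degree_P by (simp del: minus_pCons)
  have "13 = (\<Sum>z | poly P z = c. order z (P - [:c:]))" using sum_order_roots[OF nz] deg by simp
  also have "\<dots> = (\<Sum>z \<in> {z. poly P z = c} - {1}. order z (P - [:c:])) + (\<Sum>z \<in> {1}. order z (P - [:c:]))"
    using fin P_at_1 by (intro sum.subset_diff) auto
  also have "(\<Sum>z \<in> {1}. order z (P - [:c:])) = 5" by (rule factor_at_1) simp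
  also have "(\<Sum>z \<in> {z. poly P z = c} - {1}. order z (P - [:c:])) = card ({z. poly P z = c} - {1})"
    using order_Pc_simple by (subst sum.cong[OF refl, of _ _ "\<lambda>_. 1"]) auto
  finally have "card ({z. poly P z = c} - {1}) = 8" by simp
  then show ?thesis using fin P_at_1 by (subst (asm) card_Diff_subset) auto
qed

section \<open>Symmetry under complex conjugation\<close>

lemma poly_P_cnj: "poly P (cnj z) = cnj (poly P z)"
proof -
  have "poly cub (cnj z) = cnj (poly cub z)" by (simp add: cub_def)
  then show ?thesis by (simp add: poly_P)
qed

lemma segment_cnj: "w \<in> open_segment 0 c \<Longrightarrow> cnj w = w"
  by (auto simp: in_segment)

lemma cnj_E: "cnj ` X \<subseteq> PN.E" if "X \<subseteq> PN.E"
  using that segment_cnj by (auto simp: poly_P_cnj)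

lemma connected_cnj: "connected X \<Longrightarrow> connected (cnj ` X)"
  by (intro connected_continuous_image continuous_intros)

text \<open>The segment and the coefficients of \<open>P\<close> are real, so the conjugate of an
  edge lies inside some edge; conjugating that edge once more gives the opposite inclusion.\<close>

lemma cnj_edge: "cnj ` e \<in> components PN.E" if e: "e \<in> components PN.E"
proof -
  have eE: "e \<subseteq> PN.E" using e in_components_subset by blast
  obtain z where z: "z \<in> e" using e in_components_nonempty by blast
  have cc: "connected (cnj ` e)" "cnj ` e \<subseteq> PN.E"
    using connected_cnj in_components_connected e cnj_E[OF eE] by auto
  define e' where "e' = connected_component_set PN.E (cnj z)"
  have inE: "cnj z \<in> PN.E" using cc z by blast
  have e': "e' \<in> components PN.E" unfolding e'_def by (rule componentsI[OF inE])
  have ze': "cnj z \<in> e'" unfolding e'_def using inE by simp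
  have 1: "cnj ` e \<subseteq> e'" by (rule PN.component_superset[OF e' cc ze']) (use z in blast)
  have e'E: "e' \<subseteq> PN.E" using e' in_components_subset by blast
  have 2: "cnj ` e' \<subseteq> e"
  proof (rule PN.component_superset[OF e _ cnj_E[OF e'E] z])
    show "connected (cnj ` e')" using connected_cnj in_components_connected e' by blast
    show "z \<in> cnj ` e'" using ze' by (metis complex_cnj_cnj imageI)
  qed
  have "e' \<subseteq> cnj ` e" using 2 by (metis complex_cnj_cnj image_eqI image_subset_iff subsetI)
  then show ?thesis using 1 e' by (metis subset_antisym)
qed

lemma closure_cnj: "z \<in> closure e \<Longrightarrow> cnj z \<in> closure (cnj ` e)"
  using continuous_image_closure_subset[of UNIV cnj e] by (auto intro: continuous_intros)

lemma cnj_A: "cnj A = - A"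
  by (simp add: A_def)

text \<open>Otherwise both \<open>A\<close> and \<open>-A\<close> would be ends of \<open>e\<close>
  over 0.\<close>

lemma cnj_edge_ne:
  assumes e: "e \<in> components PN.E" "A \<in> closure e \<or> - A \<in> closure e"
  shows "cnj ` e \<noteq> e"
proof
  assume eq: "cnj ` e = e"
  have "cnj (- A) = A" by (simp add: cnj_A)
  then have "A \<in> closure e" "- A \<in> closure e"
    using closure_cnj[of A e] closure_cnj[of "- A" e] e(2) unfolding eq cnj_A by auto
  then show False using PN.unique_end[OF e(1) P_A(1) _ P_A(2)] A_distinct by blast
qed

text \<open>A real point of \<open>e\<close> also lies on the conjugate edge, and edges with a
  common point coincide.\<close>

lemma edge_nonreal:
  assumes e: "e \<in> components PN.E" "A \<in> closure e" and z: "z \<in> e"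
  shows "Im z > 0"
proof (rule positive_on_connected[OF _ _ _ e(2) _ z])
  show "connected e" using e in_components_connected by blast
  show "continuous_on UNIV Im" by (intro continuous_intros)
  show "Im A > 0" by (rule A_distinct)
  show "Im w \<noteq> 0" if "w \<in> e" for w
  proof
    assume "Im w = 0"
    then have "cnj w = w" by (simp add: complex_eq_iff)
    then have "w \<in> cnj ` e" using that by (metis imageI)
    then have "cnj ` e = e" using PN.component_eq[OF cnj_edge[OF e(1)] e(1)] that by blast
    then show False using cnj_edge_ne e by blast
  qed
qed

text \<open>At 1 the edges have the directions \<open>u\<close> with \<open>u\<^sup>5 = -1\<close> if \<open>\<sigma> > 0\<close>, and \<open>u\<^sup>5 = 1\<close> if
  \<open>\<sigma> < 0\<close>.  The ray in direction \<open>w0\<close> separates the two of them that lie in the upper half plane.\<close>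

definition "w0 = (if \<sigma> > 0 then Complex 3 4 else Complex 1 4)"

lemma ray_avoids_edges: "y > 0 \<Longrightarrow> poly P (1 + w0 * of_real y) \<notin> open_segment 0 c"
  using ray_positive ray_negative square by (cases "\<sigma> > 0"; cases "\<sigma> = 0") (auto simp: w0_def)

text \<open>The line through 1 in direction \<open>w0\<close> meets the upper half plane exactly in
  the ray. An edge that ends at \<open>A\<close> stays in that half plane and avoids the ray, so it
  never crosses the line.\<close>

lemma edge_left_of_ray:
  assumes e: "e \<in> components PN.E" "A \<in> closure e" and z: "z \<in> e"
  shows "Im ((z - 1) * cnj w0) > 0"
proof (rule positive_on_connected[OF _ _ _ e(2) _ z])
  show "connected e" using e in_components_connected by blast
  show "continuous_on UNIV (\<lambda>z. Im ((z - 1) * cnj w0))" by (intro continuous_intros)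
  show "Im ((A - 1) * cnj w0) > 0" proof -
    have "sqrt a > 0" using a_pos by simp
    then show ?thesis by (simp add: w0_def A_def algebra_simps add_pos_pos)
  qed
  show "Im ((w - 1) * cnj w0) \<noteq> 0" if w: "w \<in> e" for w
  proof
    assume 0: "Im ((w - 1) * cnj w0) = 0"
    \<comment> \<open>Both choices of \<open>w0\<close> have imaginary part 4.\<close>
    define y where "y = Im w / 4"
    have "y > 0" using edge_nonreal[OF e w] by (simp add: y_def)
    moreover have "w = 1 + w0 * of_real y"
      using 0 by (auto simp: w0_def complex_eq_iff y_def field_simps split: if_splits)
    moreover have "poly P w \<in> open_segment 0 c" using w in_components_subset[OF e(1)] by auto
    ultimately show False using ray_avoids_edges by metis
  qed
qed

lemma cr_sign: "sgn cr = sgn \<sigma>"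
proof -
  have "sgn k1 = sgn \<sigma>"
  proof (cases "\<sigma> > 0")
    case False
    then have "\<sigma> < - 16.5" using sigma_bounds by simp
    then show ?thesis by (simp add: k1_def)
  qed (simp add: k1_def)
  then show ?thesis using a_pos by (simp add: cr_eq sgn_mult)
qed

text \<open>The direction in which an edge towards \<open>A\<close> must leave 1: the fifth root of
  -1 or 1, respectively, in the upper half plane to the left of the ray.\<close>

definition "u0 = (if \<sigma> > 0 then cis (3 * pi / 5) else cis (4 * pi / 5))"

lemma u0_power: "u0 ^ 5 = of_real (- sgn \<sigma>)" "norm u0 = 1"
proof -
  have "\<sigma> \<noteq> 0" using square by auto
  have "cis (3 * pi / 5) ^ 5 = cis (2 * pi) * cis pi" "cis (4 * pi / 5) ^ 5 = cis (2 * pi) * cis (2 * pi)"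
    unfolding Complex.DeMoivre cis_mult by (rule arg_cong[of _ _ cis], simp)+
  then have "cis (3 * pi / 5) ^ 5 = -1" "cis (4 * pi / 5) ^ 5 = 1" by simp_all
  then show "u0 ^ 5 = of_real (- sgn \<sigma>)" using \<open>\<sigma> \<noteq> 0\<close> by (simp add: u0_def sgn_if)
qed (simp add: u0_def)

lemma fifth_roots:
  assumes "u ^ 5 = u0 ^ 5"
  obtains k where "k < 5" "u = u0 * cis (2 * pi * real k / 5)"
proof -
  have "u0 \<noteq> 0" using u0_power by auto
  then have "(u / u0) ^ 5 = 1" using assms by (simp add: power_divide)
  then have "u / u0 \<in> (\<lambda>k. cis (2 * pi * real k / real 5)) ` {..<5}"
    using Complex.bij_betw_roots_unity[of 5] by (auto simp: bij_betw_def)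
  then obtain k where "k < 5" "u / u0 = cis (2 * pi * real k / 5)" by auto
  then show thesis using that \<open>u0 \<noteq> 0\<close> by (auto simp: field_simps)
qed

text \<open>Two of the five roots lie strictly in the upper half plane, and \<open>left\<close>
  rejects the one on the wrong side of the ray. The inequalities are weak because they will arise as
  limits, so the real root has to be excluded by \<open>nr\<close>.\<close>

lemma direction_left:
  assumes u5: "u ^ 5 = u0 ^ 5" and im: "Im u \<ge> 0" and left: "Im (u * cnj w0) \<ge> 0" and nr: "cnj u \<noteq> u"
  shows "u = u0"
proof -
  obtain k where k: "k < 5" "u = u0 * cis (2 * pi * real k / 5)" using fifth_roots[OF u5] .
  have im': "Im u > 0" using im nr by (cases "Im u = 0") (auto simp: complex_eq_iff)
  show ?thesis
  proof (cases "\<sigma> > 0")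
    case True
    have u: "u = cis (3 * pi / 5 + 2 * pi * real k / 5)" using k True by (simp add: u0_def cis_mult)
    consider "k = 0" | "k = 1" | "k = 2 \<or> k = 3" | "k = 4" using k(1) by linarith
    then show ?thesis
    proof cases
      case 1 then show ?thesis using k by simp
    next
      case 2
      then have "u = cis pi" using u by (simp add: field_simps)
      then show ?thesis using im' by simp
    next
      case 3
      define \<theta> where "\<theta> = 3 * pi / 5 + 2 * pi * real k / 5 - pi"
      have "0 < \<theta>" "\<theta> < pi" using 3 by (auto simp: \<theta>_def)
      then have "sin \<theta> > 0" by (rule sin_gt_zero)
      moreover have "u = cis (\<theta> + pi)" using u by (simp add: \<theta>_def)
      ultimately show ?thesis using im' by simp
    next
      case 4
      then have "u = cis (2 * pi) * cis (pi / 5)" using u by (simp add: cis_mult field_simps)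
      then have u': "u = cis (pi / 5)" by simp
      \<comment> \<open>The angle is below 45 degrees, so the sine is less than the cosine, and 3
        sin < 4 cos contradicts \<open>left\<close>.\<close>
      have "sin (pi / 5) < sin (pi / 4)" using pi_gt_zero by (intro sin_monotone_2pi; linarith)
      also have "sin (pi / 4) = cos (pi / 4)" by (simp add: sin_45 cos_45)
      also have "cos (pi / 4) < cos (pi / 5)" using pi_gt_zero by (intro cos_monotone_0_pi; linarith)
      finally have "sin (pi / 5) < cos (pi / 5)" .
      moreover have "cos (pi / 5) > 0" using pi_gt_zero by (intro cos_gt_zero_pi; linarith)
      ultimately show ?thesis using left True by (simp add: u' w0_def)
    qed
  next
    case False
    have u: "u = cis (4 * pi / 5 + 2 * pi * real k / 5)" using k False by (simp add: u0_def cis_mult)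
    consider "k = 0" | "k = 1 \<or> k = 2" | "k = 3" | "k = 4" using k(1) by linarith
    then show ?thesis
    proof cases
      case 1 then show ?thesis using k by simp
    next
      case 2
      define \<theta> where "\<theta> = 4 * pi / 5 + 2 * pi * real k / 5 - pi"
      have "0 < \<theta>" "\<theta> < pi" using 2 by (auto simp: \<theta>_def)
      then have "sin \<theta> > 0" by (rule sin_gt_zero)
      moreover have "u = cis (\<theta> + pi)" using u by (simp add: \<theta>_def)
      ultimately show ?thesis using im' by simp
    next
      case 3
      then have "u = cis (2 * pi)" using u by (simp add: field_simps)
      then show ?thesis using im' by simp
    next
      case 4
      then have "u = cis (2 * pi) * cis (2 * pi / 5)" using u by (simp add: cis_mult field_simps)
      then have u': "u = cis (2 * pi / 5)" by simp
      \<comment> \<open>No closed form of the cosine is used. That the fifth power is real gives 12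
        x^2 = 16 x^4 + 1, hence 12 x^2 \<ge> 1, whereas y \<ge> 4 x would give 17 x^2 \<le>
        1.\<close>
      define x y where "x = cos (2 * pi / 5)" and "y = sin (2 * pi / 5)"
      have x: "x > 0" unfolding x_def using pi_gt_zero by (intro cos_gt_zero_pi; linarith)
      have y: "y > 0" unfolding y_def using pi_gt_zero by (intro sin_gt_zero; linarith)
      have xy: "x * x + y * y = 1" using sin_cos_squared_add3[of "2 * pi / 5"] by (simp add: x_def y_def)
      have "cis (2 * pi / 5) ^ 5 = 1" by (simp add: Complex.DeMoivre)
      then have "Im (Complex x y ^ 5) = 0" by (simp add: x_def y_def cis.code)
      then have "y * (5 * (x * x) * (x * x) - 10 * (x * x) * (y * y) + (y * y) * (y * y)) = 0"
        by (simp add: eval_nat_numeral algebra_simps)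
      then have "5 * (x * x) * (x * x) - 10 * (x * x) * (y * y) + (y * y) * (y * y) = 0" using y by simp
      moreover have "y * y = 1 - x * x" using xy by simp
      ultimately have quart: "16 * (x * x) * (x * x) - 12 * (x * x) + 1 = 0"
        by (simp add: algebra_simps)
      have "y < 4 * x"
      proof (rule ccontr)
        assume "\<not> y < 4 * x"
        then have "(4 * x) * (4 * x) \<le> y * y" using x by (intro mult_mono) auto
        then have "17 * (x * x) \<le> 1" using xy by simp
        moreover have "0 \<le> 16 * (x * x) * (x * x)" by simp
        ultimately show False using quart by linarith
      qed
      then show ?thesis using left False by (simp add: u' w0_def x_def y_def)
    qed
  qed
qed

end

section \<open>The edges between 1 and A\<close>

lemma image_in_closure:
  fixes g :: "complex \<Rightarrow> complex"
  assumes "continuous_on L g" "z \<in> L" "S \<subseteq> L" "z \<in> closure S" "z \<notin> S"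
  shows "g z \<in> closure (g ` S)"
proof -
  have "(g \<longlongrightarrow> g z) (at z within L)" using assms(1,2) by (simp add: continuous_on_def)
  then have lim: "(g \<longlongrightarrow> g z) (at z within S)" by (rule tendsto_within_subset) (rule assms(3))
  show ?thesis
  proof (rule Lim_in_closed_set[OF closed_closure _ _ lim])
    show "\<forall>\<^sub>F x in at z within S. g x \<in> closure (g ` S)"
      unfolding eventually_at_filter by (intro always_eventually) (auto intro: closure_subset[THEN subsetD])
    show "at z within S \<noteq> bot" using assms(4,5) by (simp add: at_within_eq_bot_iff)
  qed
qed

context sqrt273
begin

definition "edges_to v = {e \<in> components PN.E. v \<in> closure e}"

lemma cnj_direction:
  assumes "edge_direction 1 e u"
  shows "edge_direction 1 (cnj ` e) (cnj u)"
proof -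
  have "filterlim cnj (at 1 within e) (at 1 within cnj ` e)"
  proof (subst filterlim_at, intro conjI)
    have "(cnj \<longlongrightarrow> cnj 1) (at 1 within cnj ` e)" by (intro tendsto_cnj tendsto_ident_at)
    then show "(cnj \<longlongrightarrow> 1) (at 1 within cnj ` e)" by simp
    show "\<forall>\<^sub>F x in at 1 within cnj ` e. cnj x \<in> e \<and> cnj x \<noteq> 1"
      unfolding eventually_at_filter by (intro always_eventually) (auto simp: complex_eq_iff)
  qed
  then have "((\<lambda>z. sgn (cnj z - 1)) \<longlongrightarrow> u) (at 1 within cnj ` e)"
    using assms unfolding edge_direction_def by (rule filterlim_compose[rotated])
  then have "((\<lambda>z. cnj (sgn (cnj z - 1))) \<longlongrightarrow> cnj u) (at 1 within cnj ` e)" by (rule tendsto_cnj)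
  moreover have "cnj (sgn (cnj z - 1)) = sgn (z - 1)" for z
  proof -
    have "cnj (sgn w) = sgn (cnj w)" for w by (simp add: sgn_div_norm)
    then show ?thesis by simp
  qed
  ultimately show ?thesis by (simp add: edge_direction_def)
qed

text \<open>As 1 lies over \<open>c\<close>, the segment is traversed from \<open>c\<close> to 0.
  The fifth powers have the sign of \<open>- cr\<close>, which is opposite to that of
  \<sigma>.\<close>

lemma direction_at_1:
  obtains dir where "inj_on dir (edges_to 1)"
    "\<And>e. e \<in> edges_to 1 \<Longrightarrow> edge_direction 1 e (dir e)" "\<And>e. e \<in> edges_to 1 \<Longrightarrow> dir e ^ 5 = u0 ^ 5"
proof -
  obtain q where q: "P - [:c:] = [:-1, 1:] ^ 5 * q" "poly q 1 = of_real (13 / 5 * (1 + a) ^ 4)"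
    using factor_at_1 by metis
  define r where "r = 13 / 5 * (1 + a) ^ 4"
  have r: "r > 0" using a_pos by (simp add: r_def)
  have q1: "poly q 1 \<noteq> 0" using r unfolding q(2) r_def[symmetric] by simp
  have "sgn ((0 - c) / poly q 1) = of_real (sgn (- cr / r))"
    unfolding q(2) r_def[symmetric] by (simp add: sgn_of_real flip: of_real_divide of_real_minus)
  also have "sgn (- cr / r) = - sgn \<sigma>" using r cr_sign by (simp add: sgn_divide sgn_minus)
  finally have "sgn ((0 - c) / poly q 1) = u0 ^ 5" by (simp add: u0_power)
  then have "\<exists>dir. inj_on dir (edges_to 1) \<and> (\<forall>e. e \<in> components PN.E \<longrightarrow> 1 \<in> closure e \<longrightarrow>
      edge_direction 1 e (dir e) \<and> dir e ^ 5 = u0 ^ 5)"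
    using PS.vertex_edges(2)[OF P_at_1 q(1) q1 zero_less_numeral]
    unfolding PN.swap_segment edges_to_def[symmetric] by (simp only:)
  then obtain dir where "inj_on dir (edges_to 1)"
      "\<forall>e. e \<in> components PN.E \<longrightarrow> 1 \<in> closure e \<longrightarrow> edge_direction 1 e (dir e) \<and> dir e ^ 5 = u0 ^ 5"
    by blast
  then show thesis using that[of dir] by (simp add: edges_to_def)
qed

text \<open>The two inequalities that confine the edge pass to the limit at 1. A real direction
  would be shared with the conjugate edge, whereas distinct edges at 1 have distinct
  directions.\<close>

lemma edge_A_direction:
  assumes e: "e \<in> components PN.E" "A \<in> closure e" "1 \<in> closure e"
    and u: "edge_direction 1 e u"
  shows "u = u0"
proof -
  obtain dir where dir: "inj_on dir (edges_to 1)"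
    "\<And>e. e \<in> edges_to 1 \<Longrightarrow> edge_direction 1 e (dir e)" "\<And>e. e \<in> edges_to 1 \<Longrightarrow> dir e ^ 5 = u0 ^ 5"
    by (rule direction_at_1) blast
  have e1: "e \<in> edges_to 1" "cnj ` e \<in> edges_to 1"
    using e cnj_edge[OF e(1)] closure_cnj[OF e(3)] by (auto simp: edges_to_def)
  have du: "u = dir e"
    by (rule PN.edge_direction_unique[OF e(1,3) _ u dir(2)[OF e1(1)]]) (simp add: P_at_1)
  have "1 \<notin> PN.E" using P_at_1 by (simp add: open_segment_def)
  then have "1 \<notin> e" using in_components_subset[OF e(1)] by blast
  then have nb: "at 1 within e \<noteq> bot" using e(3) by (simp add: at_within_eq_bot_iff)
  have lim: "((\<lambda>z. sgn (z - 1)) \<longlongrightarrow> u) (at 1 within e)" using u by (simp add: edge_direction_def)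
  show ?thesis
  proof (rule direction_left)
    show "u ^ 5 = u0 ^ 5" using dir(3)[OF e1(1)] du by simp
    show "Im u \<ge> 0"
    proof (rule tendsto_lowerbound[OF tendsto_Im[OF lim] _ nb])
      show "\<forall>\<^sub>F z in at 1 within e. 0 \<le> Im (sgn (z - 1))"
        unfolding eventually_at_filter
      proof (intro always_eventually allI impI)
        fix z assume "z \<in> e"
        then have "Im z > 0" using edge_nonreal[OF e(1,2)] by simp
        then show "0 \<le> Im (sgn (z - 1))" by (simp add: sgn_div_norm)
      qed
    qed
    show "Im (u * cnj w0) \<ge> 0"
    proof (rule tendsto_lowerbound[OF tendsto_Im[OF tendsto_mult_right[OF lim]] _ nb])
      show "\<forall>\<^sub>F z in at 1 within e. 0 \<le> Im (sgn (z - 1) * cnj w0)"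
        unfolding eventually_at_filter
      proof (intro always_eventually allI impI)
        fix z assume "z \<in> e"
        then have "Im ((z - 1) * cnj w0) > 0" using edge_left_of_ray[OF e(1,2)] by simp
        moreover have "sgn (z - 1) * cnj w0 = inverse (cmod (z - 1)) *\<^sub>R ((z - 1) * cnj w0)"
          by (simp add: sgn_div_norm)
        ultimately show "0 \<le> Im (sgn (z - 1) * cnj w0)" by (simp only: scaleR_complex.sel) simp
      qed
    qed
    show "cnj u \<noteq> u"
    proof
      assume "cnj u = u"
      then have "edge_direction 1 (cnj ` e) u" using cnj_direction[OF u] by simp
      moreover have "cnj ` e \<in> components PN.E" "1 \<in> closure (cnj ` e)" using e1(2) by (auto simp: edges_to_def)
      ultimately have "dir (cnj ` e) = u"
        using PN.edge_direction_unique[OF _ _ _ dir(2)[OF e1(2)]] P_at_1 by blast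
      then have "cnj ` e = e" using inj_onD[OF dir(1) _ e1(2,1)] du by simp
      then show False using cnj_edge_ne e by blast
    qed
  qed
qed

lemma card_edges_to: "finite (edges_to v)" "card (edges_to A) = 5" "card (edges_to (- A)) = 5" "card (edges_to 1) = 5"
proof -
  show "finite (edges_to v)" unfolding edges_to_def
    by (rule finite_subset[OF _ PN.card_edges(1)]) blast
  show "card (edges_to A) = 5" "card (edges_to (- A)) = 5"
    using PN.degree_direction(1)[OF P_A(1)] PN.degree_direction(1)[OF P_A(2)] order_A
    unfolding vertex_degree_def PN.edges_at_tree edges_to_def by simp_all
  show "card (edges_to 1) = 5"
    using PN.degree_direction2(1)[OF P_at_1] factor_at_1
    unfolding vertex_degree_def PN.edges_at_tree edges_to_def by metis
qed

lemma A_edge_unique: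
  assumes "e \<in> edges_to A" "e \<in> edges_to 1" "d \<in> edges_to A" "d \<in> edges_to 1"
  shows "e = d"
proof -
  obtain dir where dir: "inj_on dir (edges_to 1)"
    "\<And>e. e \<in> edges_to 1 \<Longrightarrow> edge_direction 1 e (dir e)" "\<And>e. e \<in> edges_to 1 \<Longrightarrow> dir e ^ 5 = u0 ^ 5"
    by (rule direction_at_1) blast
  have *: "dir x = u0" if "x \<in> edges_to A" "x \<in> edges_to 1" for x
    using edge_A_direction[OF _ _ _ dir(2)[OF that(2)]] that unfolding edges_to_def by blast
  have "dir e = u0" "dir d = u0" using *[OF assms(1,2)] *[OF assms(3,4)] .
  then show ?thesis using inj_onD[OF dir(1) _ assms(2,4)] by simp
qed

lemma cnj_edges_to: "e \<in> edges_to v \<Longrightarrow> cnj ` e \<in> edges_to (cnj v)"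
  unfolding edges_to_def mem_Collect_eq using cnj_edge[of e] closure_cnj[of v e] by blast

text \<open>Exactly eight edges avoid 1, while \<open>A\<close> and \<open>-A\<close> have at least
  four of these each and none in common. Equality throughout gives both claims: four rather than
  five at \<open>A\<close> means that one edge at \<open>A\<close> reaches 1.\<close>

lemma edges_to_big_vertices:
  shows "\<exists>e. e \<in> edges_to A \<and> e \<in> edges_to 1"
    and "e \<in> components PN.E \<Longrightarrow> e \<in> edges_to 1 \<or> e \<in> edges_to A \<or> e \<in> edges_to (- A)"
proof -
  have one: "card (edges_to A \<inter> edges_to 1) \<le> 1"
  proof -
    have "\<forall>e\<in>edges_to A \<inter> edges_to 1. \<forall>d\<in>edges_to A \<inter> edges_to 1. e = d"
    proof (intro ballI)
      fix e d assume "e \<in> edges_to A \<inter> edges_to 1" "d \<in> edges_to A \<inter> edges_to 1"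
      then show "e = d" by (elim IntE) (rule A_edge_unique)
    qed
    then show ?thesis
      using card_le_Suc0_iff_eq[OF finite_Int[OF disjI1[OF card_edges_to(1)]], of A "edges_to 1"] by simp
  qed
  have uniq': "e = d" if "e \<in> edges_to (- A) \<inter> edges_to 1" "d \<in> edges_to (- A) \<inter> edges_to 1" for e d
  proof -
    have m: "cnj ` x \<in> edges_to A" "cnj ` x \<in> edges_to 1" if "x \<in> edges_to (- A) \<inter> edges_to 1" for x
      using cnj_edges_to[of x "- A"] cnj_edges_to[of x 1] that by (simp_all add: cnj_A)
    have "cnj ` e = cnj ` d" by (rule A_edge_unique[OF m[OF that(1)] m[OF that(2)]])
    moreover have "inj cnj" by (rule injI) simp
    ultimately show ?thesis by (simp only: inj_image_eq_iff)
  qed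
  have one': "card (edges_to (- A) \<inter> edges_to 1) \<le> 1"
  proof -
    have "\<forall>e\<in>edges_to (- A) \<inter> edges_to 1. \<forall>d\<in>edges_to (- A) \<inter> edges_to 1. e = d"
      by (intro ballI uniq')
    then show ?thesis
      using card_le_Suc0_iff_eq[OF finite_Int[OF disjI1[OF card_edges_to(1)]], of "- A" "edges_to 1"] by simp
  qed
  have c1: "card (edges_to A - edges_to 1) \<ge> 4" "card (edges_to (- A) - edges_to 1) \<ge> 4"
    using one one' card_edges_to by (simp_all add: card_Diff_subset_Int)
  have disj: "(edges_to A - edges_to 1) \<inter> (edges_to (- A) - edges_to 1) = {}"
    using PN.unique_end[OF _ P_A(1) _ P_A(2)] A_distinct by (auto simp: edges_to_def)
  let ?U = "(edges_to A - edges_to 1) \<union> (edges_to (- A) - edges_to 1)"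
  have cU: "card ?U = card (edges_to A - edges_to 1) + card (edges_to (- A) - edges_to 1)"
    using disj card_edges_to(1) by (intro card_Un_disjoint) auto
  have sub: "?U \<subseteq> components PN.E - edges_to 1" by (auto simp: edges_to_def)
  have c8: "card (components PN.E - edges_to 1) = 8"
    using PN.card_edges card_edges_to(1,4) degree_P by (subst card_Diff_subset) (auto simp: edges_to_def)
  have "card ?U \<le> 8" using card_mono[OF _ sub] PN.card_edges(1) c8 by simp
  then have U8: "card ?U = 8" "card (edges_to A - edges_to 1) = 4" using cU c1 by auto
  have "?U = components PN.E - edges_to 1"
    using PN.card_edges(1) sub U8(1) c8 by (intro card_subset_eq) auto
  then show "e \<in> components PN.E \<Longrightarrow> e \<in> edges_to 1 \<or> e \<in> edges_to A \<or> e \<in> edges_to (- A)" by blast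
  show "\<exists>e. e \<in> edges_to A \<and> e \<in> edges_to 1"
  proof (rule ccontr)
    assume "\<not> ?thesis"
    then have "edges_to A - edges_to 1 = edges_to A" by blast
    then show False using U8(2) card_edges_to(2) by simp
  qed
qed

section \<open>The composition with Q\<close>

definition "F = pcompose (Q_poly s) P"
text \<open>The value of x (x - c) at its critical point c / 2.\<close>

definition "d2 = - (cr ^ 2 / 4)"

lemma F_eq: "F = P * (P - [:c:])"
proof -
  have "Q_poly s = [:0, 1:] * [:- c, 1:]"
    unfolding Q_poly_def trans[OF poly_P_poly_1[symmetric] P_at_1] ..
  moreover have "pcompose [:0, 1:] P = P" "pcompose [:- c, 1:] P = [:- c:] + P"
    by (simp_all only: pcompose_pCons pcompose_0 pcompose_1) simp_all
  moreover have "[:- c:] + P = P - [:c:]" by simp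
  ultimately show ?thesis unfolding F_def by (simp only: pcompose_mult)
qed

lemma poly_F: "poly F z = poly P z * (poly P z - c)"
  unfolding F_eq by simp

lemma pderiv_F: "poly (pderiv F) z = poly (pderiv P) z * (2 * poly P z - c)"
proof -
  have "pderiv (P - [:c:]) = pderiv P" by (simp add: pderiv_diff)
  then show ?thesis unfolding F_eq pderiv_mult by (simp add: ring_distribs)
qed

lemma degree_F: "degree F = 26"
proof -
  have "degree (P - [:c:]) = 13" using degree_add_eq_left[of "- [:c:]" P] degree_P by (simp del: minus_pCons)
  moreover have "P \<noteq> 0" "P - [:c:] \<noteq> 0" using degree_P PN.nonzero_shift by auto
  ultimately show ?thesis unfolding F_eq using degree_P by (simp add: degree_mult_eq)
qed

lemma d2_nonzero: "d2 \<noteq> 0"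
  using cr_nonzero by (simp add: d2_def)

lemma F_zero: "poly F z = 0 \<longleftrightarrow> poly P z = 0 \<or> poly P z = c"
  by (simp add: poly_F)

text \<open>The square explains the white vertices: they are the points over the midpoint
  \<open>c / 2\<close>, and their degree is 2.\<close>

lemma F_minus_d2: "F - [:of_real d2:] = (P - [:c / 2:]) ^ 2"
proof -
  have "poly (F - [:of_real d2:]) z = poly ((P - [:c / 2:]) ^ 2) z" for z
    by (simp add: poly_F d2_def power2_eq_square field_simps)
  then show ?thesis by (simp add: poly_eq_poly_eq_iff[symmetric] fun_eq_iff)
qed

lemma F_d2: "poly F z = of_real d2 \<longleftrightarrow> poly P z = c / 2"
proof -
  have "poly F z - of_real d2 = (poly P z - c / 2) ^ 2"
    using arg_cong[OF F_minus_d2, of "\<lambda>p. poly p z"] by simp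
  then show ?thesis by (metis eq_iff_diff_eq_0 zero_eq_power2)
qed

lemma critical_F: "poly (pderiv F) z = 0 \<Longrightarrow> poly F z = 0 \<or> poly F z = of_real d2"
proof -
  assume "poly (pderiv F) z = 0"
  then consider "z ^ 2 + of_real a = 0" | "z = 1" | "poly P z = c / 2"
    by (auto simp: pderiv_F poly_pderiv_P field_simps)
  then show ?thesis
  proof cases
    case 1 then show ?thesis by (simp add: F_zero poly_P)
  next
    case 2 then show ?thesis by (simp add: F_zero P_at_1)
  next
    case 3 then show ?thesis by (simp add: F_d2)
  qed
qed

sublocale FN: noncritical_segment F 0 "of_real d2"
proof
  show "degree F > 0" using degree_F by simp
  show "0 \<noteq> complex_of_real d2" using d2_nonzero by simp
  fix z assume "poly F z \<in> open_segment 0 (of_real d2)"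
  then have "poly F z \<noteq> 0" "poly F z \<noteq> of_real d2" by (auto simp: open_segment_def)
  then show "poly (pderiv F) z \<noteq> 0" using critical_F by blast
qed

lemma edge_midpoint_segment: "c / 2 \<in> open_segment 0 c"
  unfolding in_segment using cr_nonzero by (intro conjI exI[of _ "1/2"]) (auto simp: scaleR_conv_of_real)

abbreviation "FT \<equiv> shabat_tree F 0 (of_real d2)"

end

section \<open>Subdivided edges, connectedness and passport\<close>

lemma plane_isomorphic_refl: "plane_isomorphic T T"
  unfolding plane_isomorphic_def by (intro exI[of _ id]) simp

context sqrt273
begin

text \<open>An edge of \<open>P\<close> is cut at its point over \<open>c / 2\<close>, and
  \<open>d\<close> selects the half towards the end over 0 or over \<open>c\<close>. The conclusion
  speaks of the closure of \<open>e \<inter> e1\<close>, not only of \<open>e1\<close>, so that the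
  direction of \<open>e\<close> at \<open>v\<close> can be transferred to \<open>e1\<close>.\<close>

lemma half_edge:
  assumes e: "e \<in> components PN.E" and g: "homeomorphism e (open_segment 0 c) (poly P) g"
    and d: "d = 0 \<or> d = 1" and v: "v \<in> closure e" "poly P v = of_real (d * cr)"
  obtains e1 where "e1 \<in> components FN.E" "v \<in> closure (e \<inter> e1)" "g (c / 2) \<in> closure e1"
proof -
  define S where "S = open_segment (complex_of_real (d * cr)) (c / 2)"
  have S_I: "of_real (t * cr) \<in> S" if "0 < t" "t < 1" "\<bar>t - d\<bar> < 1/2" "t \<noteq> d" for t
    using d
  proof
    assume "d = 0"
    then show ?thesis unfolding S_def in_segment using that cr_nonzero
      by (intro conjI exI[of _ "2 * t"]) (auto simp: scaleR_conv_of_real)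
  next
    assume "d = 1"
    then show ?thesis unfolding S_def in_segment using that cr_nonzero
      by (intro conjI exI[of _ "2 * (1 - t)"]) (auto simp: scaleR_conv_of_real algebra_simps)
  qed
  have S_D: "\<exists>r. 0 < r \<and> r < 1 \<and> r \<noteq> 1/2 \<and> y = of_real (r * cr)" if yS: "y \<in> S" for y
  proof -
    obtain t where t: "0 < t" "t < 1" "y = (1 - t) *\<^sub>R of_real (d * cr) + t *\<^sub>R (c / 2)"
      using yS by (auto simp only: S_def in_segment)
    then show ?thesis using d
      by (intro exI[of _ "(1 - t) * d + t / 2"]) (auto simp: scaleR_conv_of_real algebra_simps)
  qed
  have L_I: "of_real (r * cr) \<in> open_segment 0 c" if "0 < r" "r < 1" for r
    unfolding in_segment using that cr_nonzero by (intro conjI exI[of _ r]) (auto simp: scaleR_conv_of_real)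
  have SL: "S \<subseteq> open_segment 0 c" using S_D L_I by blast
  have FS: "y * (y - c) \<in> open_segment 0 (of_real d2)" if yS: "y \<in> S" for y
  proof -
    obtain r where r: "0 < r" "r < 1" "r \<noteq> 1/2" "y = of_real (r * cr)" using S_D[OF yS] by blast
    \<comment> \<open>For y = r c the quadratic equals 4 r (1 - r) d2, and 4 r (1 - r) < 1 away from
      the midpoint.\<close>
    have "y * (y - c) = (4 * r * (1 - r)) *\<^sub>R of_real d2"
      unfolding r(4) d2_def by (simp add: scaleR_conv_of_real power2_eq_square algebra_simps)
    moreover have "0 < 4 * r * (1 - r)" using r by simp
    moreover have "4 * r * (1 - r) < 1"
    proof -
      have "0 < (2 * r - 1) ^ 2" using r(3) by simp
      then show ?thesis by (simp add: power2_eq_square algebra_simps)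
    qed
    ultimately show ?thesis unfolding in_segment using d2_nonzero by auto
  qed
  define H where "H = g ` S"
  have contg: "continuous_on (open_segment 0 c) g" and gL: "g ` open_segment 0 c = e"
    and Pg: "\<And>y. y \<in> open_segment 0 c \<Longrightarrow> poly P (g y) = y" and gP: "\<And>z. z \<in> e \<Longrightarrow> g (poly P z) = z"
    using g by (auto simp: homeomorphism_def)
  have He: "H \<subseteq> e" unfolding H_def using SL gL by blast
  have "connected S" unfolding S_def by (intro convex_connected) auto
  then have conH: "connected H" unfolding H_def using contg SL by (meson connected_continuous_image continuous_on_subset)
  have HE: "H \<subseteq> FN.E" using FS Pg SL by (auto simp: H_def poly_F)
  have dc: "complex_of_real (d * cr) \<noteq> c / 2" using d cr_nonzero by auto
  then have "S \<noteq> {}" by (simp add: S_def)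
  then obtain y0 where y0: "y0 \<in> S" by blast
  have z0: "g y0 \<in> FN.E" "g y0 \<in> H" using HE y0 by (auto simp: H_def)
  define e1 where "e1 = connected_component_set FN.E (g y0)"
  have e1: "e1 \<in> components FN.E" unfolding e1_def by (rule componentsI[OF z0(1)])
  have "g y0 \<in> e1" unfolding e1_def using z0(1) by simp
  then have He1: "H \<subseteq> e1" by (rule FN.component_superset[OF e1 conH HE _ z0(2)])
  have "g (c / 2) \<in> closure H"
    unfolding H_def
  proof (rule image_in_closure[OF contg _ SL])
    show "c / 2 \<in> open_segment 0 c" using L_I[of "1/2"] by simp
    show "c / 2 \<in> closure S" unfolding S_def closure_open_segment using dc by simp
    show "c / 2 \<notin> S" by (simp add: S_def open_segment_def)
  qed
  then have x: "g (c / 2) \<in> closure e1" using closure_mono[OF He1] by blast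
  have "v \<in> closure H"
    unfolding closure_iff_nhds_not_empty
  proof (intro allI impI)
    fix X U assume U: "U \<subseteq> X" "open U" "v \<in> U"
    \<comment> \<open>On \<open>U'\<close> the values of \<open>P\<close> are closer to
      \<open>d * cr\<close> than the midpoint is, so a point of \<open>e\<close> found there belongs
      to the chosen half.\<close>
    define U' where "U' = U \<inter> {z. cmod (poly P z - of_real (d * cr)) < \<bar>cr\<bar> / 2}"
    have "open U'" unfolding U'_def using U(2)
      by (intro open_Int open_Collect_less continuous_intros)
    moreover have "v \<in> U'" using U(3) v(2) cr_nonzero by (simp add: U'_def)
    ultimately obtain z where z: "z \<in> e" "z \<in> U'" using v(1)
      by (metis closure_iff_nhds_not_empty disjoint_iff subset_refl)
    have "poly P z \<in> open_segment 0 c" using z(1) in_components_subset[OF e] by auto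
    then obtain t where t: "0 < t" "t < 1" "poly P z = (1 - t) *\<^sub>R 0 + t *\<^sub>R c"
      by (auto simp only: in_segment)
    then have t: "0 < t" "t < 1" "poly P z = of_real (t * cr)" by (simp_all add: scaleR_conv_of_real)
    have "cmod (of_real (t * cr) - of_real (d * cr)) = \<bar>t - d\<bar> * \<bar>cr\<bar>"
    proof -
      have "complex_of_real (t * cr) - of_real (d * cr) = of_real ((t - d) * cr)" by (simp add: left_diff_distrib)
      then show ?thesis by (simp only: norm_of_real abs_mult)
    qed
    then have "\<bar>t - d\<bar> * \<bar>cr\<bar> < 1/2 * \<bar>cr\<bar>" using z(2) t(3) by (simp add: U'_def)
    then have "\<bar>t - d\<bar> < 1/2" using cr_nonzero by (simp only: mult_less_cancel_right)
    then have "poly P z \<in> S" unfolding t(3) using t(1,2) d by (intro S_I) auto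
    then have "z \<in> H" unfolding H_def using gP[OF z(1)] by (metis imageI)
    then show "H \<inter> X \<noteq> {}" using z(2) U(1) by (auto simp: U'_def)
  qed
  then have "v \<in> closure (e \<inter> e1)" using closure_mono[of H "e \<inter> e1"] He He1 by blast
  then show thesis using that e1 x by blast
qed

lemma F_link:
  assumes e: "e \<in> components PN.E" and v: "v \<in> closure e" "poly P v = 0" and w: "w \<in> closure e" "poly P w = c"
  obtains x e1 e2 where "x \<in> e" "poly P x = c / 2" "e1 \<in> components FN.E" "e2 \<in> components FN.E"
    "v \<in> closure e1" "x \<in> closure e1" "x \<in> closure e2" "w \<in> closure e2" "w \<in> closure (e \<inter> e2)"
proof -
  obtain g where g: "homeomorphism e (open_segment 0 c) (poly P) g" by (rule PN.edge_homeomorphism[OF e])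
  have x: "g (c / 2) \<in> e" "poly P (g (c / 2)) = c / 2"
    using g edge_midpoint_segment by (auto simp: homeomorphism_def)
  obtain e1 where e1: "e1 \<in> components FN.E" "v \<in> closure (e \<inter> e1)" "g (c / 2) \<in> closure e1"
    by (rule half_edge[OF e g, of 0 v]) (use v in auto)
  obtain e2 where e2: "e2 \<in> components FN.E" "w \<in> closure (e \<inter> e2)" "g (c / 2) \<in> closure e2"
    by (rule half_edge[OF e g, of 1 w]) (use w in auto)
  show thesis
    using that[OF x e1(1) e2(1) _ e1(3) e2(3) _ e2(2)] e1(2) e2(2) closure_mono[of "e \<inter> e1" e1] closure_mono[of "e \<inter> e2" e2]
    by blast
qed

lemma F_adjacent:
  assumes "e \<in> components FN.E" "x \<in> closure e" "y \<in> closure e"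
    "poly F x = 0 \<or> poly F x = of_real d2" "poly F y = 0 \<or> poly F y = of_real d2"
  shows "(x, y) \<in> adjacency FT"
  using assms unfolding adjacency_def vertices_def FN.tree_simps by blast

abbreviation "linked x y \<equiv> (x, y) \<in> (adjacency FT)\<^sup>*"

lemma linked_sym: "linked x y \<Longrightarrow> linked y x"
proof -
  have "sym (adjacency FT)" by (auto simp: adjacency_def sym_def)
  then show "linked x y \<Longrightarrow> linked y x" by (meson sym_rtrancl symD)
qed

lemma linked_trans: "linked x y \<Longrightarrow> linked y z \<Longrightarrow> linked x z"
  by (rule rtrancl_trans)

lemma edge_linked:
  assumes e: "e \<in> components PN.E" and v: "v \<in> closure e" "poly P v = 0" and w: "w \<in> closure e" "poly P w = c"
    and y: "y \<in> e" "poly P y = c / 2"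
  shows "linked v y" "linked y w"
proof -
  obtain x e1 e2 where x: "x \<in> e" "poly P x = c / 2" and e1: "e1 \<in> components FN.E" and e2: "e2 \<in> components FN.E"
    and cl: "v \<in> closure e1" "x \<in> closure e1" "x \<in> closure e2" "w \<in> closure e2" "w \<in> closure (e \<inter> e2)"
    by (rule F_link[OF e v w])
  have "x = y" using inj_onD[OF PN.inj_on_edge[OF e] _ x(1) y(1)] x(2) y(2) by simp
  moreover have "poly F v = 0" "poly F w = 0" "poly F x = of_real d2"
    using v w x by (simp_all add: F_zero F_d2)
  ultimately show "linked v y" "linked y w"
    using F_adjacent[OF e1 cl(1,2)] F_adjacent[OF e2 cl(3,4)] by auto
qed

lemma edge_midpoint:
  assumes e: "e \<in> components PN.E"
  obtains y where "y \<in> e" "poly P y = c / 2"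
proof -
  have "c / 2 \<in> poly P ` e" unfolding PN.image_edge[OF e] by (rule edge_midpoint_segment)
  then show thesis using that by (elim imageE) simp
qed

lemma ends_linked:
  assumes e: "e \<in> components PN.E" and v: "v \<in> closure e" "poly P v = 0" and w: "w \<in> closure e" "poly P w = c"
  shows "linked v w"
proof -
  obtain y where y: "y \<in> e" "poly P y = c / 2" by (rule edge_midpoint[OF e])
  show ?thesis by (rule linked_trans[OF edge_linked[OF e v w y]])
qed

text \<open>One end of the edge is 1, \<open>A\<close> or \<open>-A\<close>, and these three are
  linked through the edge from 1 to \<open>A\<close> and its conjugate.\<close>

lemma ends_linked_to_1:
  assumes e: "e \<in> components PN.E" and v: "v \<in> closure e" "poly P v = 0" and w: "w \<in> closure e" "poly P w = c"
  shows "linked 1 v" "linked 1 w"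
proof -
  have A: "linked 1 A" "linked 1 (- A)"
  proof -
    obtain eA where eA: "eA \<in> edges_to A" "eA \<in> edges_to 1" using edges_to_big_vertices(1) by blast
    have "linked A 1" using ends_linked[of eA A 1] eA P_A P_at_1 by (simp add: edges_to_def)
    then show "linked 1 A" by (rule linked_sym)
    have "cnj ` eA \<in> edges_to (- A)" "cnj ` eA \<in> edges_to 1"
      using cnj_edges_to[OF eA(1)] cnj_edges_to[OF eA(2)] by (simp_all add: cnj_A)
    then have "linked (- A) 1" using ends_linked[of "cnj ` eA" "- A" 1] P_A P_at_1 by (simp add: edges_to_def)
    then show "linked 1 (- A)" by (rule linked_sym)
  qed
  have vw: "linked v w" by (rule ends_linked[OF e v w])
  consider "1 \<in> closure e" | "A \<in> closure e" | "- A \<in> closure e"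
    using edges_to_big_vertices(2)[OF e] by (auto simp: edges_to_def)
  then have "linked 1 v \<or> linked 1 w"
  proof cases
    case 1
    then have "w = 1" using PN.unique_end2[OF e w(2,1) P_at_1] by simp
    then show ?thesis by simp
  next
    case 2
    then have "v = A" using PN.unique_end[OF e v(2,1) P_A(1)] by simp
    then show ?thesis using A by simp
  next
    case 3
    then have "v = - A" using PN.unique_end[OF e v(2,1) P_A(2)] by simp
    then show ?thesis using A by simp
  qed
  then show "linked 1 v" "linked 1 w" using vw linked_sym[OF vw] linked_trans by metis+
qed

text \<open>\<open>P\<close> and \<open>P - [:c:]\<close> have no common root, so the multiplicities
  are those of one factor.\<close>

lemma order_F: "poly F z = 0 \<Longrightarrow> order z F = (if z \<in> {A, - A, 1} then 5 else 1)"
proof -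
  assume z: "poly F z = 0"
  have "order z F = order z P + order z (P - [:c:])"
    unfolding F_eq using degree_P PN.nonzero_shift[of c] by (intro order_mult) auto
  moreover have o1: "order 1 (P - [:c:]) = 5" by (rule factor_at_1)
  moreover consider "poly P z = 0" | "poly P z = c" using z by (auto simp: F_zero)
  then have "order z P + order z (P - [:c:]) = (if z \<in> {A, - A, 1} then 5 else 1)"
  proof cases
    case 1
    then have "z \<noteq> 1" using P_at_1 cr_nonzero by auto
    moreover have "order z (P - [:c:]) = 0" using 1 cr_nonzero by (intro order_0I) simp
    ultimately show ?thesis
      using order_A order_P_simple[OF 1] by (cases "z = A"; cases "z = - A") simp_all
  next
    case 2
    then have "z \<noteq> A" "z \<noteq> - A" using P_A cr_nonzero by auto
    moreover have "order z P = 0" using 2 cr_nonzero by (intro order_0I) simp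
    ultimately show ?thesis using o1 order_Pc_simple[OF 2] by (cases "z = 1") simp_all
  qed
  ultimately show ?thesis by simp
qed

lemma order_F2: "poly F z = of_real d2 \<Longrightarrow> order z (F - [:of_real d2:]) = 2"
proof -
  assume "poly F z = of_real d2"
  then have z: "poly P z = c / 2" by (simp add: F_d2)
  then have "poly (pderiv P) z \<noteq> 0"
    using edge_midpoint_segment by (intro PN.noncritical) (simp only: z)
  then have "order z (P - [:c / 2:]) = 1" by (rule order_simple_root[OF z])
  moreover have "P - [:c / 2:] \<noteq> 0" by (rule PN.nonzero_shift)
  ultimately show ?thesis unfolding F_minus_d2 power2_eq_square by (subst order_mult) auto
qed

lemma degree_FT: "poly F z = 0 \<Longrightarrow> vertex_degree FT z = (if z \<in> {A, - A, 1} then 5 else 1)"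
    "poly F z = of_real d2 \<Longrightarrow> vertex_degree FT z = 2"
proof -
  assume z: "poly F z = 0"
  then show "vertex_degree FT z = (if z \<in> {A, - A, 1} then 5 else 1)"
    using FN.degree_direction(1)[OF z] order_F[OF z] by simp
next
  assume z: "poly F z = of_real d2"
  then show "vertex_degree FT z = 2"
    using FN.degree_direction2(1)[OF z] order_F2[OF z] by simp
qed

lemma card_F_zero: "card {z. poly F z = 0} = 14"
proof -
  have "{z. poly F z = 0} = {z. poly P z = 0} \<union> {z. poly P z = c}" by (auto simp: F_zero)
  also have "card \<dots> = 5 + 9"
    using card_P_zero card_P_c PN.finite_fibre cr_nonzero by (subst card_Un_disjoint) auto
  finally show ?thesis by simp
qed

lemma card_F_d2: "card {z. poly F z = of_real d2} = 13"
  using PN.card_fibre[OF edge_midpoint_segment] degree_P by (simp add: F_d2)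

text \<open>Every vertex is an end of an edge of \<open>P\<close> or the point of such an edge over
  \<open>c / 2\<close>.\<close>

lemma vertex_linked: "x \<in> vertices FT \<Longrightarrow> linked 1 x"
proof -
  assume "x \<in> vertices FT"
  then consider "poly P x = 0" | "poly P x = c" | "poly P x = c / 2"
    unfolding vertices_def FN.tree_simps by (auto simp: F_zero F_d2)
  then show "linked 1 x"
  proof cases
    case 1
    have "order x P \<noteq> 0"
      using order_A order_P_simple[OF 1] by (cases "x = A"; cases "x = - A") simp_all
    then have "vertex_degree PN.tree x \<noteq> 0" unfolding PN.degree_direction(1)[OF 1] by simp
    then have "edges_at PN.tree x \<noteq> {}" by (auto simp: vertex_degree_def)
    then obtain e where e: "e \<in> components PN.E" "x \<in> closure e" by (auto simp: PN.edges_at_tree)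
    obtain w where "poly P w = c" "w \<in> closure e" using PN.exists_end2[OF e(1)] by blast
    then show ?thesis using ends_linked_to_1(1)[OF e 1] by blast
  next
    case 2
    have "order 1 (P - [:c:]) = 5" by (rule factor_at_1)
    then have "order x (P - [:c:]) \<noteq> 0" using order_Pc_simple[OF 2] by (cases "x = 1") simp_all
    then have "vertex_degree PN.tree x \<noteq> 0" unfolding PN.degree_direction2(1)[OF 2] .
    then have "edges_at PN.tree x \<noteq> {}" by (auto simp: vertex_degree_def)
    then obtain e where e: "e \<in> components PN.E" "x \<in> closure e" by (auto simp: PN.edges_at_tree)
    obtain v where "poly P v = 0" "v \<in> closure e" using PN.exists_end[OF e(1)] by blast
    then show ?thesis using ends_linked_to_1(2)[OF e(1) _ _ e(2) 2] by blast
  next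
    case 3
    then have xE: "x \<in> PN.E" using edge_midpoint_segment by (simp only: vimage_eq)
    define e where "e = connected_component_set PN.E x"
    have e: "e \<in> components PN.E" "x \<in> e" unfolding e_def using componentsI[OF xE] xE by simp_all
    obtain v where v: "v \<in> closure e" "poly P v = 0" using PN.exists_end[OF e(1)] by blast
    obtain w where w: "w \<in> closure e" "poly P w = c" using PN.exists_end2[OF e(1)] by blast
    show ?thesis using ends_linked_to_1(1)[OF e(1) v w] edge_linked(1)[OF e(1) v w e(2) 3] linked_trans by blast
  qed
qed

lemma FT_tree: "bicolored_plane_tree FT"
proof (rule FN.plane_tree)
  show "linked x y" if "x \<in> vertices FT" "y \<in> vertices FT" for x y
    using linked_trans[OF linked_sym[OF vertex_linked[OF that(1)]] vertex_linked[OF that(2)]] .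
  show "card {z. poly F z = 0} + card {z. poly F z = of_real d2} = degree F + 1"
    by (simp add: card_F_zero card_F_d2 degree_F)
qed

lemma FT_passport: "passport FT = (replicate_mset 3 5 + replicate_mset 11 1, replicate_mset 13 2, 26)"
proof -
  define R where "R = {z. poly F z = 0} - {A, - A, 1}"
  have fin: "finite {z. poly F z = 0}" by (rule FN.finite_fibre)
  have sub: "{A, - A, 1} \<subseteq> {z. poly F z = 0}"
    by (simp add: F_zero P_A P_at_1)
  have c3: "card {A, - A, 1} = 3" using A_distinct by simp
  then have cR: "card R = 11" using sub card_F_zero by (simp add: R_def card_Diff_subset)
  have "mset_set {z. poly F z = 0} = mset_set ({A, - A, 1} \<union> R)"
    using sub by (intro arg_cong[of _ _ mset_set]) (auto simp: R_def)
  also have "\<dots> = mset_set {A, - A, 1} + mset_set R"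
    using fin by (intro mset_set_Union) (auto simp: R_def)
  finally have "image_mset (vertex_degree FT) (mset_set {z. poly F z = 0}) =
      image_mset (vertex_degree FT) (mset_set {A, - A, 1}) + image_mset (vertex_degree FT) (mset_set R)" by simp
  also have "image_mset (vertex_degree FT) (mset_set {A, - A, 1}) = image_mset (\<lambda>_. 5) (mset_set {A, - A, 1})"
    using sub degree_FT(1) by (intro image_mset_cong) auto
  also have "image_mset (vertex_degree FT) (mset_set R) = image_mset (\<lambda>_. 1) (mset_set R)"
    using fin degree_FT(1) by (intro image_mset_cong) (auto simp: R_def)
  finally have black: "image_mset (vertex_degree FT) (mset_set {z. poly F z = 0}) = replicate_mset 3 5 + replicate_mset 11 1"
    using cR c3 by (simp only: image_mset_const_eq size_mset_set)
  have "image_mset (vertex_degree FT) (mset_set {z. poly F z = of_real d2}) =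
      image_mset (\<lambda>_. 2) (mset_set {z. poly F z = of_real d2})"
    using FN.finite_fibre degree_FT(2) by (intro image_mset_cong) auto
  then have white: "image_mset (vertex_degree FT) (mset_set {z. poly F z = of_real d2}) = replicate_mset 13 2"
    by (simp only: image_mset_const_eq size_mset_set card_F_d2)
  show ?thesis unfolding passport_def FN.tree_simps black white using FN.card_edges degree_F by simp
qed

section \<open>The gap at the middle vertex\<close>

sublocale FP: pp_tree FT
  using FT_tree FT_passport by unfold_locales

text \<open>The quotient that governs the directions is -c / (4 q(1)), a positive multiple of the
  one for \<open>P\<close>; so \<open>F\<close> and \<open>P\<close> have the same five directions
  at 1.\<close>

lemma F_direction_at_1:
  obtains dir where "inj_on dir (edges_at FT 1)"
    "\<And>e. e \<in> edges_at FT 1 \<Longrightarrow> edge_direction 1 e (dir e)" "\<And>e. e \<in> edges_at FT 1 \<Longrightarrow> dir e ^ 5 = u0 ^ 5"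
proof -
  obtain q where q: "P - [:c:] = [:-1, 1:] ^ 5 * q" "poly q 1 = of_real (13 / 5 * (1 + a) ^ 4)"
    by (rule factor_at_1)
  define r where "r = 13 / 5 * (1 + a) ^ 4"
  have r: "r > 0" using a_pos by (simp add: r_def)
  have F1: "F - [:0:] = [:-1, 1:] ^ 5 * (P * q)" unfolding F_eq q(1) by (simp add: mult_ac)
  have Pq: "poly (P * q) 1 = of_real (cr * r)" using q(2) by (simp add: P_at_1 r_def)
  then have Pq0: "poly (P * q) 1 \<noteq> 0" using r cr_nonzero by simp
  have F0: "poly F 1 = 0" by (simp add: F_zero P_at_1)
  have "(of_real d2 - 0) / poly (P * q) 1 = of_real (- cr / (4 * r))"
    unfolding Pq using cr_nonzero by (simp add: d2_def power2_eq_square)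
  then have "sgn ((of_real d2 - 0) / poly (P * q) 1) = of_real (sgn (- cr / (4 * r)))"
    by (simp only: sgn_of_real)
  also have "sgn (- cr / (4 * r)) = - sgn \<sigma>" using r cr_sign by (simp add: sgn_divide sgn_minus sgn_mult)
  finally have "sgn ((of_real d2 - 0) / poly (P * q) 1) = u0 ^ 5" by (simp add: u0_power)
  then have "\<exists>dir. inj_on dir (edges_at FT 1) \<and> (\<forall>e. e \<in> components FN.E \<longrightarrow> 1 \<in> closure e \<longrightarrow>
      edge_direction 1 e (dir e) \<and> dir e ^ 5 = u0 ^ 5)"
    using FN.vertex_edges(2)[OF F0 F1 Pq0 zero_less_numeral]
    unfolding FN.edges_at_tree by (simp only:)
  then obtain dir where "inj_on dir (edges_at FT 1)"
      "\<forall>e. e \<in> components FN.E \<longrightarrow> 1 \<in> closure e \<longrightarrow> edge_direction 1 e (dir e) \<and> dir e ^ 5 = u0 ^ 5"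
    by blast
  then show thesis using that[of dir] by (simp add: FN.edges_at_tree)
qed

lemma same_direction:
  assumes "1 \<in> closure (e \<inter> e')" "1 \<notin> e" "edge_direction 1 e u" "edge_direction 1 e' u'"
  shows "u = u'"
proof -
  have nb: "at 1 within (e \<inter> e') \<noteq> bot" using assms(1,2) by (simp add: at_within_eq_bot_iff)
  have "((\<lambda>z. sgn (z - 1)) \<longlongrightarrow> u) (at 1 within (e \<inter> e'))"
    using assms(3) unfolding edge_direction_def by (rule tendsto_within_subset) blast
  moreover have "((\<lambda>z. sgn (z - 1)) \<longlongrightarrow> u') (at 1 within (e \<inter> e'))"
    using assms(4) unfolding edge_direction_def by (rule tendsto_within_subset) blast
  ultimately show ?thesis by (rule tendsto_unique[OF nb])
qed

text \<open>The number of fifths of a turn counterclockwise from \<open>u0\<close> to its conjugate: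
  from 3 pi / 5 to 7 pi / 5 for \<sigma> > 0, and from 4 pi / 5 to 6 pi / 5 for \<sigma> <
  0.\<close>

definition "steps = (if \<sigma> > 0 then 2 else 1 :: nat)"

lemma u0_quotient: "cnj u0 / u0 = cis (2 * pi * real steps / 5)"
proof (cases "\<sigma> > 0")
  case True
  then have "cnj u0 / u0 = cis (- (3 * pi / 5) - 3 * pi / 5)" by (simp add: u0_def cis_cnj cis_divide)
  \<comment> \<open>A full turn brings the angle into the range of \<open>Arg2pi\<close>.\<close>
  also have "\<dots> = cis (- (3 * pi / 5) - 3 * pi / 5) * cis (2 * pi)" by simp
  also have "\<dots> = cis (2 * pi * real steps / 5)"
    unfolding cis_mult by (rule arg_cong[of _ _ cis]) (simp add: steps_def True field_simps)
  finally show ?thesis .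
next
  case False
  then have "cnj u0 / u0 = cis (- (4 * pi / 5) - 4 * pi / 5)" by (simp add: u0_def cis_cnj cis_divide)
  also have "\<dots> = cis (- (4 * pi / 5) - 4 * pi / 5) * cis (2 * pi)" by simp
  also have "\<dots> = cis (2 * pi * real steps / 5)"
    unfolding cis_mult by (rule arg_cong[of _ _ cis]) (simp add: steps_def False field_simps)
  finally show ?thesis .
qed

lemma Arg2pi_fifth:
  assumes "k < 5"
  shows "Arg2pi (cis (2 * pi * real k / 5)) = 2 * pi * real k / 5"
proof (rule Arg2pi_unique[of 1])
  show "complex_of_real 1 * exp (\<i> * complex_of_real (2 * pi * real k / 5)) = cis (2 * pi * real k / 5)"
    by (simp add: cis_conv_exp)
  have "real k < 5" using assms by simp
  then show "2 * pi * real k / 5 < 2 * pi" by (simp add: field_simps)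
qed simp_all

text \<open>The edge from 1 to \<open>A\<close> and its conjugate, both subdivided, form the spine.
  Its middle edges leave 1 in the directions \<open>u0\<close> and \<open>cnj u0\<close>, so the gap
  counts the edge directions strictly between these on the arc through -1.\<close>

lemma FT_spine: "\<exists>e1 e2 e3 e4. FP.spine e1 e2 e3 e4 \<and> FP.gap e2 e3 = steps - 1"
proof -
  obtain eA where eA: "eA \<in> edges_to A" "eA \<in> edges_to 1" using edges_to_big_vertices(1) by blast
  define eB where "eB = cnj ` eA"
  have eB: "eB \<in> edges_to (- A)" "eB \<in> edges_to 1"
    using cnj_edges_to[OF eA(1)] cnj_edges_to[OF eA(2)] by (simp_all add: cnj_A eB_def)
  have CA: "eA \<in> components PN.E" "A \<in> closure eA" "1 \<in> closure eA"
    and CB: "eB \<in> components PN.E" "- A \<in> closure eB" "1 \<in> closure eB"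
    using eA eB by (simp_all add: edges_to_def)
  obtain x a1 a2 where x: "x \<in> eA" "poly P x = c / 2" and a: "a1 \<in> components FN.E" "a2 \<in> components FN.E"
    "A \<in> closure a1" "x \<in> closure a1" "x \<in> closure a2" "1 \<in> closure a2" "1 \<in> closure (eA \<inter> a2)"
    by (rule F_link[OF CA(1,2) P_A(1) CA(3) P_at_1])
  obtain y b1 b2 where y: "y \<in> eB" "poly P y = c / 2" and b: "b1 \<in> components FN.E" "b2 \<in> components FN.E"
    "- A \<in> closure b1" "y \<in> closure b1" "y \<in> closure b2" "1 \<in> closure b2" "1 \<in> closure (eB \<inter> b2)"
    by (rule F_link[OF CB(1,2) P_A(2) CB(3) P_at_1])
  have "eB \<noteq> eA" unfolding eB_def by (rule cnj_edge_ne) (use CA in auto)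
  then have xy: "x \<noteq> y" using PN.component_eq[OF CB(1) CA(1)] x(1) y(1) by blast
  have ends: "end_black FT a1 = A" "end_black FT a2 = 1" "end_black FT b2 = 1" "end_black FT b1 = - A"
    using FP.end_black_unique[of a1 A] FP.end_black_unique[of a2 1] FP.end_black_unique[of b2 1] FP.end_black_unique[of b1 "- A"]
      a b by (simp_all add: F_zero P_A P_at_1)
  have wends: "end_white FT a1 = x" "end_white FT a2 = x" "end_white FT b2 = y" "end_white FT b1 = y"
    using FP.end_white_unique[of a1 x] FP.end_white_unique[of a2 x] FP.end_white_unique[of b2 y] FP.end_white_unique[of b1 y]
      a b x y by (simp_all add: F_d2)
  have deg: "vertex_degree FT A = 5" "vertex_degree FT (- A) = 5" "vertex_degree FT 1 = 5"
    using degree_FT(1)[of A] degree_FT(1)[of "- A"] degree_FT(1)[of 1] by (simp_all add: F_zero P_A P_at_1)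
  have spine: "FP.spine a1 a2 b2 b1"
    unfolding FP.spine_def FP.big_edges_def using a b ends wends deg xy A_distinct by simp
  obtain dir where dir: "inj_on dir (edges_at FT 1)"
    "\<And>e. e \<in> edges_at FT 1 \<Longrightarrow> edge_direction 1 e (dir e)" "\<And>e. e \<in> edges_at FT 1 \<Longrightarrow> dir e ^ 5 = u0 ^ 5"
    by (rule F_direction_at_1) blast
  have m: "a2 \<in> edges_at FT 1" "b2 \<in> edges_at FT 1" using a b by (simp_all add: FN.edges_at_tree)
  obtain dirP where dirP: "inj_on dirP (edges_to 1)"
    "\<And>e. e \<in> edges_to 1 \<Longrightarrow> edge_direction 1 e (dirP e)" "\<And>e. e \<in> edges_to 1 \<Longrightarrow> dirP e ^ 5 = u0 ^ 5"
    by (rule direction_at_1) blast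
  have dA: "edge_direction 1 eA u0" using edge_A_direction[OF CA dirP(2)[OF eA(2)]] dirP(2)[OF eA(2)] by simp
  have dB: "edge_direction 1 eB (cnj u0)" unfolding eB_def by (rule cnj_direction[OF dA])
  have "1 \<notin> PN.E" using P_at_1 by (simp add: open_segment_def)
  then have n1: "1 \<notin> eA" "1 \<notin> eB" using in_components_subset[OF CA(1)] in_components_subset[OF CB(1)] by blast+
  have da: "dir a2 = u0" using same_direction[OF a(7) n1(1) dA dir(2)[OF m(1)]] by simp
  have db: "dir b2 = cnj u0" using same_direction[OF b(7) n1(2) dB dir(2)[OF m(2)]] by simp
  have u0nz: "u0 \<noteq> 0" using u0_power(2) by auto
  \<comment> \<open>All five roots occur as directions; this supplies the edge in between when
    \<open>steps = 2\<close>.\<close>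
  have img: "dir ` edges_at FT 1 = {u. u ^ 5 = u0 ^ 5}"
  proof (rule card_subset_eq)
    have "u0 ^ 5 \<noteq> 0" using u0nz by simp
    then show "finite {u. u ^ 5 = u0 ^ 5}" "card (dir ` edges_at FT 1) = card {u. u ^ 5 = u0 ^ 5}"
      using card_nth_roots[of "u0 ^ 5" 5] finite_nth_roots[of 5 "u0 ^ 5"] card_image[OF dir(1)] deg(3) by (simp_all add: vertex_degree_def)
    show "dir ` edges_at FT 1 \<subseteq> {u. u ^ 5 = u0 ^ 5}" using dir(3) by auto
  qed
  have ccw: "ccw FT 1 a2 d b2 \<longleftrightarrow> steps = 2 \<and> dir d = u0 * cis (2 * pi / 5)" if d: "d \<in> edges_at FT 1" for d
  proof -
    obtain k where k: "k < 5" "dir d = u0 * cis (2 * pi * real k / 5)"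
      by (rule fifth_roots[OF dir(3)[OF d]])
    have s5: "steps < 5" by (simp add: steps_def)
    have "ccw FT 1 a2 d b2 \<longleftrightarrow> 0 < Arg2pi (dir d / u0) \<and> Arg2pi (dir d / u0) < Arg2pi (cnj u0 / u0)"
      using FN.tree_ccw[of 1 dir a2 d b2] dir(2) m d da db by (simp add: F_zero P_at_1)
    also have "dir d / u0 = cis (2 * pi * real k / 5)" using k(2) u0nz by simp
    also have "0 < Arg2pi (cis (2 * pi * real k / 5)) \<and> Arg2pi (cis (2 * pi * real k / 5)) < Arg2pi (cnj u0 / u0) \<longleftrightarrow> 0 < k \<and> k < steps"
      unfolding u0_quotient Arg2pi_fifth[OF k(1)] Arg2pi_fifth[OF s5]
      by (simp add: field_simps zero_less_mult_iff)
    also have "\<dots> \<longleftrightarrow> steps = 2 \<and> k = 1" by (auto simp: steps_def)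
    also have "k = 1 \<longleftrightarrow> dir d = u0 * cis (2 * pi / 5)"
    proof
      assume "dir d = u0 * cis (2 * pi / 5)"
      then have "cis (2 * pi * real k / 5) = cis (2 * pi * real 1 / 5)" using k(2) u0nz by simp
      then have "2 * pi * real k / 5 = 2 * pi * real 1 / 5"
        using Arg2pi_fifth[OF k(1)] Arg2pi_fifth[of 1] by (metis one_less_numeral_iff semiring_norm(77) numeral_One)
      then show "k = 1" by simp
    qed (use k in simp)
    finally show ?thesis .
  qed
  have "FP.gap a2 b2 = steps - 1"
  proof (cases "steps = 2")
    case True
    have "u0 * cis (2 * pi / 5) \<in> {u. u ^ 5 = u0 ^ 5}"
      by (simp add: power_mult_distrib Complex.DeMoivre)
    then obtain d where d: "d \<in> edges_at FT 1" "dir d = u0 * cis (2 * pi / 5)" unfolding img[symmetric] by auto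
    have "{d' \<in> edges_at FT 1. ccw FT 1 a2 d' b2} = {d}"
    proof (intro equalityI subsetI)
      fix d' assume "d' \<in> {d' \<in> edges_at FT 1. ccw FT 1 a2 d' b2}"
      then have "d' \<in> edges_at FT 1" "dir d' = dir d" using ccw d(2) by auto
      then show "d' \<in> {d}" using inj_onD[OF dir(1) _ _ d(1)] by simp
    next
      fix d' assume "d' \<in> {d}"
      then show "d' \<in> {d' \<in> edges_at FT 1. ccw FT 1 a2 d' b2}" using ccw d True by simp
    qed
    then show ?thesis using True unfolding FP.gap_def ends by simp
  next
    case False
    then have empty: "{d' \<in> edges_at FT 1. ccw FT 1 a2 d' b2} = {}" using ccw by blast
    have "steps - 1 = 0" using False by (simp add: steps_def split: if_splits)
    then show ?thesis unfolding FP.gap_def ends empty by simp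
  qed
  then show ?thesis using spine by blast
qed

lemma FT_shabat: "shabat_polynomial_of F 0 (of_real d2) FT"
  unfolding shabat_polynomial_of_def shabat_polynomial_def critical_values_def
  using degree_F d2_nonzero critical_F plane_isomorphic_refl[of FT] FN.degree_direction(1) FN.degree_direction2(1)
  by auto

end

section \<open>The two isomorphism classes\<close>

lemma two_trees:
  fixes T1 T2 :: "(complex, complex set) bicolored_map" and T :: "('v, 'e) bicolored_map"
  assumes T1: "pp_tree T1" and T2: "pp_tree T2" and T: "pp_tree T"
    and s1: "pp_tree.spine T1 a1 a2 a3 a4" "pp_tree.gap T1 a2 a3 = 1"
    and s2: "pp_tree.spine T2 b1 b2 b3 b4" "pp_tree.gap T2 b2 b3 = 0"
  shows "plane_isomorphic T T1 \<or> plane_isomorphic T T2"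
proof -
  interpret T: pp_tree T by fact
  obtain e1 e2 e3 e4 where e: "T.spine e1 e2 e3 e4" using T.spine_exists by blast
  have sum: "T.gap e2 e3 + T.gap e3 e2 = 3" by (rule T.gap_sym[OF e])
  \<comment> \<open>Gaps 2 and 3 become 1 and 0 when the spine is reversed.\<close>
  consider "T.gap e2 e3 = 0" | "T.gap e2 e3 = 1" | "T.gap e3 e2 = 1" | "T.gap e3 e2 = 0" using sum by linarith
  then show ?thesis
  proof cases
    case 1 then show ?thesis using spine_isomorphic[OF T T2 e s2(1)] s2(2) by simp
  next
    case 2 then show ?thesis using spine_isomorphic[OF T T1 e s1(1)] s1(2) by simp
  next
    case 3 then show ?thesis using spine_isomorphic[OF T T1 T.spine_sym[OF e] s1(1)] s1(2) by simp
  next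
    case 4 then show ?thesis using spine_isomorphic[OF T T2 T.spine_sym[OF e] s2(1)] s2(2) by simp
  qed
qed

text \<open>The gaps that \<open>T2\<close> admits are 0 and, after reversal, 3; so the gap 1 cannot
  be transported to it.\<close>

lemma not_isomorphic:
  fixes T1 :: "('v, 'e) bicolored_map" and T2 :: "('w, 'f) bicolored_map"
  assumes T1: "pp_tree T1" and T2: "pp_tree T2"
    and s1: "pp_tree.spine T1 a1 a2 a3 a4" "pp_tree.gap T1 a2 a3 = 1"
    and s2: "pp_tree.spine T2 b1 b2 b3 b4" "pp_tree.gap T2 b2 b3 = 0"
  shows "\<not> plane_isomorphic T1 T2"
proof
  interpret T2: pp_tree T2 by fact
  assume "plane_isomorphic T1 T2"
  then obtain f1 f2 f3 f4 where f: "T2.spine f1 f2 f3 f4" "T2.gap f2 f3 = pp_tree.gap T1 a2 a3"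
    by (rule isomorphic_spine[OF T1 T2 _ s1(1)])
  have "f2 = b2 \<and> f3 = b3 \<or> f2 = b3 \<and> f3 = b2" by (rule T2.spine_unique[OF s2(1) f(1)])
  then have "T2.gap b2 b3 = 1 \<or> T2.gap b3 b2 = 1" using f(2) s1(2) by auto
  moreover have "T2.gap b2 b3 + T2.gap b3 b2 = 3" by (rule T2.gap_sym[OF s2(1)])
  ultimately show False using s2(2) by simp
qed

theorem lemma9p4:
  fixes s :: complex
    and pp :: "nat multiset \<times> nat multiset \<times> nat"
  defines "s \<equiv> complex_of_real (sqrt 273)"
    and "pp \<equiv> (replicate_mset 3 5 + replicate_mset 11 1, replicate_mset 13 2, 26)"
  shows "\<exists>(T1 :: (complex, complex set) bicolored_map) (T2 :: (complex, complex set) bicolored_map).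
           bicolored_plane_tree T1 \<and> passport T1 = pp \<and>
           bicolored_plane_tree T2 \<and> passport T2 = pp \<and>
           \<not> plane_isomorphic T1 T2 \<and>
           (\<forall>T :: ('v, 'e) bicolored_map. bicolored_plane_tree T \<and> passport T = pp \<longrightarrow>
              plane_isomorphic T T1 \<or> plane_isomorphic T T2) \<and>
           (\<exists>c2. shabat_polynomial_of (pcompose (Q_poly s) (P_poly s)) 0 c2 T1) \<and>
           (\<exists>c2. shabat_polynomial_of (pcompose (Q_poly (- s)) (P_poly (- s))) 0 c2 T2)"
proof -
  \<comment> \<open>The positive root yields the tree with gap 1, the negative root the one with gap
    0. The trees of the two polynomials themselves serve as \<open>T1\<close> and
    \<open>T2\<close>.\<close>
  interpret X: sqrt273 "sqrt 273" by unfold_locales simp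
  interpret Y: sqrt273 "- sqrt 273" by unfold_locales simp
  have X: "pp_tree X.FT" and Y: "pp_tree Y.FT" by unfold_locales
  obtain a1 a2 a3 a4 where a: "X.FP.spine a1 a2 a3 a4" "X.FP.gap a2 a3 = 1"
    using X.FT_spine by (auto simp: X.steps_def)
  obtain b1 b2 b3 b4 where b: "Y.FP.spine b1 b2 b3 b4" "Y.FP.gap b2 b3 = 0"
    using Y.FT_spine by (auto simp: Y.steps_def)
  have FX: "pcompose (Q_poly s) (P_poly s) = X.F" and FY: "pcompose (Q_poly (- s)) (P_poly (- s)) = Y.F"
    by (simp_all add: s_def X.F_def Y.F_def)
  have all: "plane_isomorphic T X.FT \<or> plane_isomorphic T Y.FT"
    if "bicolored_plane_tree T" "passport T = pp" for T :: "('v, 'e) bicolored_map"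
  proof -
    have "pp_tree T" using that unfolding pp_def by unfold_locales
    then show ?thesis by (rule two_trees[OF X Y _ a b])
  qed
  show ?thesis
    unfolding FX FY
  proof (rule exI[of _ X.FT], rule exI[of _ Y.FT], intro conjI allI impI)
    show "bicolored_plane_tree X.FT" by (rule X.FT_tree)
    show "passport X.FT = pp" unfolding pp_def by (rule X.FT_passport)
    show "bicolored_plane_tree Y.FT" by (rule Y.FT_tree)
    show "passport Y.FT = pp" unfolding pp_def by (rule Y.FT_passport)
    show "\<not> plane_isomorphic X.FT Y.FT" by (rule not_isomorphic[OF X Y a b])
    show "plane_isomorphic T X.FT \<or> plane_isomorphic T Y.FT"
      if "bicolored_plane_tree T \<and> passport T = pp" for T :: "('v, 'e) bicolored_map"
      using all that by blast
    show "\<exists>c2. shabat_polynomial_of X.F 0 c2 X.FT" using X.FT_shabat by blast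
    show "\<exists>c2. shabat_polynomial_of Y.F 0 c2 Y.FT" using Y.FT_shabat by blast
  qed
qed

end
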